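(* Let $\mathfrak g$ be a simple Lie algebra endowed with the invariant scalar product $\langle\cdot,\cdot\rangle=\lambda\cdot(\text{Killing form})$, $\lambda\neq 0$, and let $w_{\mathfrak g}$ be the associated Lie algebra weight system and $\bar w_{\mathfrak g}=w_{\mathfrak g}\circ\pi$. Then for all integers $i\ge 1$, $j\ge 0$, $$\bar w_{\mathfrak g}(J_{i,j})=\bar w_{\mathfrak g}(J_{i-1,j+1})+\frac{1}{\lambda}\,\bar w_{\mathfrak g}(J_{i-1,j}).$$
   Context: A closed Jacobi diagram is a connected graph consisting of a distinguished oriented circle (the Wilson loop) together with vertices on the loop (each incident to exactly one edge off the loop, called a leg) and internal trivalent vertices off the loop, each with a fixed cyclic order of its three half-edges; its degree is half its number of vertices. Chord diagrams are those closed diagrams with no internal vertices. The internal graph is obtained by deleting the Wilson loop; its connected components are the components of the diagram. Let $\mathcal C$ be the vector space spanned by closed diagrams modulo the STU relations $S=T-U$, where $S$ has an internal vertex joined to the loop by a leg and to two further half-edges $x,y$ (in the vertex's cyclic order), and $T$, $U$ are obtained by deleting that vertex and attaching $x,y$ directly to two adjacent points of the loop, in the order $x,y$ along the loop orientation for $T$ and $y,x$ for $U$. $\mathcal C$ is isomorphic to the space $\mathcal A^{fr}$ of chord diagrams modulo 4-term relations, and is a commutative cocommutative connected graded Hopf algebra: the product glues two Wilson loops by cutting them, and the coproduct is $\delta(D)=\sum_{J\subseteq [D]}D_J\otimes D_{\bar J}$ over subsets $J$ of the set $[D]$ of components. The projection $\pi$ onto primitive elements along the subspace of decomposable elements (products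 of elements of positive degree) is $$\pi(D)=D-\sum_{i\ge 2}(-1)^i(i-1)!\sum_{[D_1]\sqcup\dots\sqcup[D_i]=[D],\ [D_j]\ne\emptyset}D_1\cdots D_i,$$ the inner sum over unordered splittings of the set of components into nonempty parts, $D_j$ the subdiagram formed by the components in $[D_j]$. For a Lie algebra $\mathfrak g$ with a nondegenerate invariant form, basis $e_1,\dots,e_m$ and dual basis $e_1^*,\dots,e_m^*$, the weight system $w_{\mathfrak g}$ sends a chord diagram $D$ with $n$ chords to the element of $ZU(\mathfrak g)$ obtained by choosing a base point on the loop, labelling the first endpoint of each chord $a$ by $e_{i_a}$ and the second by $e_{i_a}^*$, multiplying the labels in the order along the loop and summing over all $i_a\in\{1,\dots,m\}$; it satisfies the 4-term relations and extends linearly to $\mathcal C$ via the STU relations. Write $\bar w_{\mathfrak g}=w_{\mathfrak g}\circ\pi$. The diagram $J_{i,j}$ ($i,j\ge0$), of degree $i+j+2$, is drawn in the plane inside its Wilson loop (loop oriented counterclockwise, internal vertices oriented counterclockwise by the planar drawing). Counterclockwise along the loop take points $p_1$, then $a_1,\dots,a_j$, then $p_2$, $p_3$, then $b_j,\dots,b_1$, then $p_4$ (so $p_1,p_2$ lie on the upper arc, $p_3,p_4$ on the lower arc, $p_2,p_3$ on the left and $p_4,p_1$ on the right), with chords $a_kb_k$, $k=1,\dots,j$ (mutually parallel, each separating $\{p_2,p_3\}$ from $\{p_1,p_4\}$). If $i=0$, the remaining part consists of the two chords $p_1p_2$ and $p_3p_4$, so $J_{0,j}$ is a chord diagram whose intersection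 graph is the complete bipartite graph $K_{2,j}$. If $i\ge1$, the remaining part is a planar ladder: internal vertices $u_1,\dots,u_i$ (upper rail) and $v_1,\dots,v_i$ (lower rail), edges $u_ku_{k+1}$, $v_kv_{k+1}$ ($1\le k<i$), rungs $u_kv_k$ ($1\le k\le i$), and legs $u_1p_2$, $v_1p_3$, $u_ip_1$, $v_ip_4$ (thus $i-1$ square cells, and the $j$ chords cross both rails). In particular $J_{i,0}$ is the ladder with $i$ rungs and four legs. *)

theory Defs
  imports Complex_Main "HOL-Library.FuncSet" "HOL-Library.Disjoint_Sets"
begin

section \<open>Lie algebras given by structure constants (basis e_0..e_{m-1})\<close>

text \<open>[e_a, e_b] = sum over k < m of c a b k e_k.\<close>

definition lie_alg :: "nat \<Rightarrow> (nat \<Rightarrow> nat \<Rightarrow> nat \<Rightarrow> complex) \<Rightarrow> bool" where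
  "lie_alg m c \<longleftrightarrow>
     (\<forall>a<m. \<forall>b<m. \<forall>k<m. c a b k = - c b a k) \<and>
     (\<forall>a<m. \<forall>b<m. \<forall>d<m. \<forall>l<m.
        (\<Sum>k<m. c b d k * c a k l) + (\<Sum>k<m. c d a k * c b k l) + (\<Sum>k<m. c a b k * c d k l) = 0)"

definition lvecs :: "nat \<Rightarrow> (nat \<Rightarrow> complex) set" where
  "lvecs m = {v. \<forall>i\<ge>m. v i = 0}"

definition lbracket :: "nat \<Rightarrow> (nat \<Rightarrow> nat \<Rightarrow> nat \<Rightarrow> complex) \<Rightarrow> (nat \<Rightarrow> complex) \<Rightarrow> (nat \<Rightarrow> complex) \<Rightarrow> nat \<Rightarrow> complex" where
  "lbracket m c v w k = (if k < m then (\<Sum>a<m. \<Sum>b<m. v a * w b * c a b k) else 0)"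

definition lie_ideal :: "nat \<Rightarrow> (nat \<Rightarrow> nat \<Rightarrow> nat \<Rightarrow> complex) \<Rightarrow> (nat \<Rightarrow> complex) set \<Rightarrow> bool" where
  "lie_ideal m c S \<longleftrightarrow> S \<subseteq> lvecs m \<and> (\<lambda>_. 0) \<in> S \<and>
     (\<forall>x\<in>S. \<forall>y\<in>S. (\<lambda>i. x i + y i) \<in> S) \<and>
     (\<forall>r. \<forall>x\<in>S. (\<lambda>i. r * x i) \<in> S) \<and>
     (\<forall>x\<in>lvecs m. \<forall>s\<in>S. lbracket m c x s \<in> S)"

text \<open>Simple (complex) Lie algebra: non-abelian, only trivial ideals.\<close>
definition simple_lie :: "nat \<Rightarrow> (nat \<Rightarrow> nat \<Rightarrow> nat \<Rightarrow> complex) \<Rightarrow> bool" where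
  "simple_lie m c \<longleftrightarrow> lie_alg m c \<and> (\<exists>a<m. \<exists>b<m. \<exists>k<m. c a b k \<noteq> 0) \<and>
     (\<forall>S. lie_ideal m c S \<longrightarrow> S = {\<lambda>_. 0} \<or> S = lvecs m)"

text \<open>Killing form: K(e_a,e_b) = tr(ad e_a ad e_b).\<close>
definition killing :: "nat \<Rightarrow> (nat \<Rightarrow> nat \<Rightarrow> nat \<Rightarrow> complex) \<Rightarrow> nat \<Rightarrow> nat \<Rightarrow> complex" where
  "killing m c a b = (\<Sum>i<m. \<Sum>k<m. c b i k * c a k i)"

text \<open>Invariant form <.,.> = lam * Killing (Gram matrix).\<close>
definition gform :: "nat \<Rightarrow> (nat \<Rightarrow> nat \<Rightarrow> nat \<Rightarrow> complex) \<Rightarrow> complex \<Rightarrow> nat \<Rightarrow> nat \<Rightarrow> complex" where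
  "gform m c lam a b = lam * killing m c a b"

text \<open>Inverse Gram matrix: dual basis e_i^* = sum_j ginv j i e_j.\<close>
definition ginv :: "nat \<Rightarrow> (nat \<Rightarrow> nat \<Rightarrow> nat \<Rightarrow> complex) \<Rightarrow> complex \<Rightarrow> nat \<Rightarrow> nat \<Rightarrow> complex" where
  "ginv m c lam = (SOME M. \<forall>a<m. \<forall>b<m.
      (\<Sum>k<m. gform m c lam a k * M k b) = (if a = b then 1 else 0))"

text \<open><[e_a,e_b],e_d>\<close>
definition trip :: "nat \<Rightarrow> (nat \<Rightarrow> nat \<Rightarrow> nat \<Rightarrow> complex) \<Rightarrow> complex \<Rightarrow> nat \<Rightarrow> nat \<Rightarrow> nat \<Rightarrow> complex" where
  "trip m c lam a b d = (\<Sum>k<m. c a b k * gform m c lam k d)"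

section \<open>Free associative algebra and U(g)\<close>

type_synonym falg = "nat list \<Rightarrow> complex"

definition fa_word :: "nat list \<Rightarrow> falg" where
  "fa_word xs = (\<lambda>w. if w = xs then 1 else 0)"
definition fa_add :: "falg \<Rightarrow> falg \<Rightarrow> falg" where
  "fa_add f g = (\<lambda>w. f w + g w)"
definition fa_sub :: "falg \<Rightarrow> falg \<Rightarrow> falg" where
  "fa_sub f g = (\<lambda>w. f w - g w)"
definition fa_smult :: "complex \<Rightarrow> falg \<Rightarrow> falg" where
  "fa_smult r f = (\<lambda>w. r * f w)"
definition fa_mult :: "falg \<Rightarrow> falg \<Rightarrow> falg" where
  "fa_mult f g = (\<lambda>w. \<Sum>k\<le>length w. f (take k w) * g (drop k w))"

text \<open>Two-sided ideal generated by x y - y x - [x,y]; U(g) = free algebra / ideal.\<close>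
inductive_set ug_ideal :: "nat \<Rightarrow> (nat \<Rightarrow> nat \<Rightarrow> nat \<Rightarrow> complex) \<Rightarrow> falg set"
  for m c where
  gen: "a < m \<Longrightarrow> b < m \<Longrightarrow>
     (\<lambda>w. fa_word [a,b] w - fa_word [b,a] w - (\<Sum>k<m. c a b k * fa_word [k] w)) \<in> ug_ideal m c"
| zero: "(\<lambda>_. 0) \<in> ug_ideal m c"
| add: "x \<in> ug_ideal m c \<Longrightarrow> y \<in> ug_ideal m c \<Longrightarrow> fa_add x y \<in> ug_ideal m c"
| smult: "x \<in> ug_ideal m c \<Longrightarrow> fa_smult r x \<in> ug_ideal m c"
| mult: "x \<in> ug_ideal m c \<Longrightarrow> fa_mult (fa_mult (fa_word u) x) (fa_word v) \<in> ug_ideal m c"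

definition U_eq :: "nat \<Rightarrow> (nat \<Rightarrow> nat \<Rightarrow> nat \<Rightarrow> complex) \<Rightarrow> falg \<Rightarrow> falg \<Rightarrow> bool" where
  "U_eq m c x y \<longleftrightarrow> fa_sub x y \<in> ug_ideal m c"

section \<open>Closed Jacobi diagrams (half-edge representation)\<close>

text \<open>loop: half-edges attached to the Wilson loop, in loop order from a base point;
  verts: internal trivalent vertices, each a triple of half-edges in cyclic order;
  edges: pairs of half-edges glued to an edge.\<close>
record diagram =
  dloop :: "nat list"
  dverts :: "(nat \<times> nat \<times> nat) list"
  dedges :: "(nat \<times> nat) list"

definition halfedges :: "diagram \<Rightarrow> nat set" where
  "halfedges D = set (dloop D) \<union> (\<Union>(a,b,d)\<in>set (dverts D). {a,b,d})"

definition adj :: "diagram \<Rightarrow> nat rel" where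
  "adj D = set (dedges D) \<union> (\<Union>(a,b,d)\<in>set (dverts D). {(a,b),(b,d)})"

text \<open>Components of the internal graph, as sets of half-edges.\<close>
definition comps :: "diagram \<Rightarrow> nat set set" where
  "comps D = halfedges D // ((adj D \<union> (adj D)\<inverse>)\<^sup>*)"

definition subdiag :: "diagram \<Rightarrow> nat set \<Rightarrow> diagram" where
  "subdiag D U = \<lparr> dloop = filter (\<lambda>h. h \<in> U) (dloop D),
                  dverts = filter (\<lambda>(a,_,_). a \<in> U) (dverts D),
                  dedges = filter (\<lambda>(a,_). a \<in> U) (dedges D) \<rparr>"

text \<open>Product: cut the two Wilson loops at their base points and glue.\<close>
definition dmult :: "diagram \<Rightarrow> diagram \<Rightarrow> diagram" where
  "dmult D1 D2 = \<lparr> dloop = dloop D1 @ dloop D2, dverts = dverts D1 @ dverts D2,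
                  dedges = dedges D1 @ dedges D2 \<rparr>"

definition dunit :: diagram where
  "dunit = \<lparr> dloop = [], dverts = [], dedges = [] \<rparr>"

section \<open>Lie algebra weight system\<close>

text \<open>State sum: each half-edge gets a basis label; an edge with labels p,q contributes
  ginv q p (i.e. labels e_i and e_i^*), an internal vertex with cyclic labels a,b,d contributes
  <[e_a,e_b],e_d> (the extension forced by STU), the loop gives the word of its labels.\<close>
definition wsys :: "nat \<Rightarrow> (nat \<Rightarrow> nat \<Rightarrow> nat \<Rightarrow> complex) \<Rightarrow> complex \<Rightarrow> diagram \<Rightarrow> falg" where
  "wsys m c lam D = (\<lambda>w. \<Sum>f \<in> (halfedges D \<rightarrow>\<^sub>E {..<m}).
      (prod_list (map (\<lambda>(x,y). ginv m c lam (f y) (f x)) (dedges D)) *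
       prod_list (map (\<lambda>(a,b,d). trip m c lam (f a) (f b) (f d)) (dverts D))) *
      (if map f (dloop D) = w then 1 else 0))"

text \<open>Product D_1 ... D_i of the subdiagrams for the blocks of a splitting P.\<close>
definition split_prod :: "diagram \<Rightarrow> nat set set set \<Rightarrow> diagram" where
  "split_prod D P = foldr dmult (map (\<lambda>B. subdiag D (\<Union>B)) (SOME ps. distinct ps \<and> set ps = P)) dunit"

text \<open>wbar = w o pi.\<close>
definition wbar :: "nat \<Rightarrow> (nat \<Rightarrow> nat \<Rightarrow> nat \<Rightarrow> complex) \<Rightarrow> complex \<Rightarrow> diagram \<Rightarrow> falg" where
  "wbar m c lam D = (\<lambda>w. wsys m c lam D w -
     (\<Sum>P \<in> {P. partition_on (comps D) P \<and> card P \<ge> 2}.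
        (-1) ^ card P * of_nat (fact (card P - 1)) * wsys m c lam (split_prod D P) w))"

section \<open>The diagrams J_{i,j}\<close>

text \<open>Half-edges: p1=0, p2=1, p3=2, p4=3 at the loop; a_k = 2k+2, b_k = 2k+3 (1 \<le> k \<le> j).
  For ladder vertex number k (1..i), with s = 2j+4+6(k-1): u_k has half-edges
  s (towards right), s+1 (towards left), s+2 (down); v_k has s+3 (right), s+4 (up), s+5 (left).
  Counterclockwise cyclic orders: u_k = (right, left, down), v_k = (right, up, left).\<close>
definition Jdiag :: "nat \<Rightarrow> nat \<Rightarrow> diagram" where
  "Jdiag i j =
    (let a = (\<lambda>k. 2*k+2); b = (\<lambda>k. 2*k+3); s = (\<lambda>k. 2*j+4+6*(k-1));
         chords = map (\<lambda>k. (a k, b k)) [1..<j+1]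
     in \<lparr> dloop = [0] @ map a [1..<j+1] @ [1,2] @ rev (map b [1..<j+1]) @ [3],
          dverts = (if i = 0 then [] else
                    concat (map (\<lambda>k. [(s k, s k + 1, s k + 2), (s k + 3, s k + 4, s k + 5)]) [1..<i+1])),
          dedges = (if i = 0 then [(0,1),(2,3)] @ chords else
                    map (\<lambda>k. (s k + 2, s k + 4)) [1..<i+1] @
                    map (\<lambda>k. (s k, s (k+1) + 1)) [1..<i] @
                    map (\<lambda>k. (s k + 3, s (k+1) + 5)) [1..<i] @
                    [(s 1 + 1, 1), (s 1 + 5, 2), (s i, 0), (s i + 3, 3)] @ chords) \<rparr>)"

end

theory Submission
  imports Defs "Jordan_Normal_Form.Jordan_Normal_Form_Existence" "HOL-Library.Function_Algebras"
    "HOL-Library.Poly_Mapping"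
begin

text \<open>
  Write \<open>\<Phi>(x) = \<Sum> e\<^sub>a x e\<^sub>a\<^sup>*\<close> for the enclosure of \<open>x\<close> by a chord and \<open>C = \<Phi>(1)\<close> for the central Casimir element. As the
  form is \<open>\<lambda>\<close> times the Killing form, \<open>C\<close> acts on the adjoint representation by \<open>1/\<lambda>\<close>, so
  \<open>\<Phi>(x) = (C - 1/(2\<lambda>)) x\<close> for \<open>x\<close> in the Lie algebra. Resolving both ends of the leftmost rung of the ladder by STU
  moves that rung to a chord in four positions: across both legs, across one of them (twice), and across none. With
  \<open>X\<^sub>i(n)\<close> the value of the ladder with \<open>i\<close> rungs crossed by \<open>n\<close> chords, and \<open>S\<close> the shift of \<open>n\<close>, this reads
  \<open>X\<^sub>i\<^sub>+\<^sub>1 = (S - C + 1/\<lambda>) X\<^sub>i\<close>.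

  In every splitting all parts other than the one containing the ladder are products of parallel chords, that is, powers of
  \<open>C\<close>, and the sum over all splittings comes out as \<open>(S - C)\<^sup>j X\<^sub>i\<close> at \<open>n = 0\<close>; the recursion follows. For \<open>i = 0\<close> the ladder
  consists of two chords; the splittings that separate them contribute a further term, which is multiplied by \<open>-1/\<lambda>\<close> when a
  chord is added, so it drops out.

  That the dual basis exists is Cartan's criterion: the Killing form of a simple Lie algebra does not vanish, for
  otherwise every \<open>ad x\<close> would be nilpotent, which Engel's theorem excludes.
\<close>

section \<open>Linear operators on coordinate vectors\<close>

definition vscale :: "complex \<Rightarrow> (nat \<Rightarrow> complex) \<Rightarrow> nat \<Rightarrow> complex" where
  "vscale r v = (\<lambda>i. r * v i)"

interpretation cvec: vector_space vscale
  by unfold_locales (auto simp: vscale_def fun_eq_iff algebra_simps)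

definition unitv :: "nat \<Rightarrow> nat \<Rightarrow> complex" where
  "unitv k = (\<lambda>i. if i = k then 1 else 0)"

lemma vscale_apply [simp]: "vscale r v i = r * v i"
  by (simp add: vscale_def)

lemma sum_fun_apply: "(\<Sum>k\<in>S. F k) x = (\<Sum>k\<in>S. F k x)" for F :: "'b \<Rightarrow> 'c \<Rightarrow> 'a::comm_monoid_add"
  by (induction S rule: infinite_finite_induct) auto

lemma unitv_in_lvecs: "k < m \<Longrightarrow> unitv k \<in> lvecs m"
  by (auto simp: unitv_def lvecs_def)

lemma subspace_lvecs: "cvec.subspace (lvecs m)"
  by (auto simp: cvec.subspace_def lvecs_def)

lemma sum_unitv_apply: "(\<Sum>k<m. v k * unitv k i) = (if i < m then v i else 0)"
proof -
  have "(\<Sum>k<m. v k * unitv k i) = (\<Sum>k<m. if i = k then v k else 0)"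
    by (intro sum.cong) (auto simp: unitv_def)
  then show ?thesis by simp
qed

lemma sum_unitv_mult: "b < m \<Longrightarrow> (\<Sum>j<m. unitv b j * F j) = F b"
proof -
  have "(\<Sum>j<m. unitv b j * F j) = (\<Sum>j<m. if j = b then F j else 0)"
    by (intro sum.cong) (auto simp: unitv_def)
  then show "b < m \<Longrightarrow> (\<Sum>j<m. unitv b j * F j) = F b" by simp
qed

lemma lvecs_expand:
  assumes "v \<in> lvecs m"
  shows "v = (\<Sum>k<m. vscale (v k) (unitv k))"
  using assms by (auto simp: fun_eq_iff sum_fun_apply sum_unitv_apply lvecs_def)

lemma card_independent_le:
  assumes "cvec.independent B" "B \<subseteq> lvecs m"
  shows "card B \<le> m"
proof -
  have "lvecs m \<subseteq> cvec.span (unitv ` {..<m})"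
  proof
    show "v \<in> cvec.span (unitv ` {..<m})" if "v \<in> lvecs m" for v
      by (subst lvecs_expand[OF that]) (intro cvec.span_sum cvec.span_scale cvec.span_base, auto)
  qed
  then have "card B \<le> card (unitv ` {..<m})"
    using cvec.independent_span_bound[of "unitv ` {..<m}" B] assms by auto
  also have "\<dots> \<le> m" using card_image_le[of "{..<m}" unitv] by simp
  finally show ?thesis .
qed

text \<open>Linear maps of the infinite coordinate space that factor through the first \<open>m\<close> coordinates, in domain and range;
  unlike the \<open>m \<times> m\<close> matrices they can be compared as functions.\<close>
definition lin_op :: "nat \<Rightarrow> ((nat \<Rightarrow> complex) \<Rightarrow> nat \<Rightarrow> complex) \<Rightarrow> bool" where
  "lin_op m T \<longleftrightarrow> Vector_Spaces.linear vscale vscale T \<and> (\<forall>v. T v \<in> lvecs m) \<and>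
     (\<forall>v. (\<forall>k<m. v k = 0) \<longrightarrow> T v = 0)"

lemma lin_opI:
  assumes "\<And>u v. T (u + v) = T u + T v" "\<And>r v. T (vscale r v) = vscale r (T v)"
    and "\<And>v. T v \<in> lvecs m" "\<And>v. (\<And>k. k < m \<Longrightarrow> v k = 0) \<Longrightarrow> T v = 0"
  shows "lin_op m T"
  using assms cvec.vector_space_axioms by (simp add: lin_op_def Vector_Spaces.linear_iff)

lemma lin_op_in_lvecs: "lin_op m T \<Longrightarrow> T v \<in> lvecs m"
  by (simp add: lin_op_def)

lemma lin_op_module_hom: "lin_op m T \<Longrightarrow> Modules.module_hom vscale vscale T"
  by (simp add: lin_op_def linear_iff_module_hom)

lemmas lin_op_add = module_hom.add[OF lin_op_module_hom]
  and lin_op_scale = module_hom.scale[OF lin_op_module_hom]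
  and lin_op_zero = module_hom.zero[OF lin_op_module_hom]
  and lin_op_diff = module_hom.diff[OF lin_op_module_hom]
  and lin_op_sum = module_hom.sum[OF lin_op_module_hom]

lemma lin_op_eq_zero: "lin_op m T \<Longrightarrow> (\<And>k. k < m \<Longrightarrow> v k = 0) \<Longrightarrow> T v = 0"
  by (simp add: lin_op_def)

lemma lin_op_comp:
  assumes "lin_op m S" "lin_op m T"
  shows "lin_op m (S \<circ> T)"
  by (intro lin_opI)
    (simp_all add: lin_op_add[OF assms(1)] lin_op_add[OF assms(2)] lin_op_scale[OF assms(1)] lin_op_scale[OF assms(2)]
      lin_op_in_lvecs[OF assms(1)] lin_op_eq_zero[OF assms(2)] lin_op_zero[OF assms(1)])

lemma lin_op_plus:
  assumes "lin_op m S" "lin_op m T"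
  shows "lin_op m (S + T)"
  by (intro lin_opI)
    (simp_all add: lin_op_add[OF assms(1)] lin_op_add[OF assms(2)] lin_op_scale[OF assms(1)] lin_op_scale[OF assms(2)]
      lin_op_in_lvecs[OF assms(1)] lin_op_in_lvecs[OF assms(2)] lin_op_eq_zero[OF assms(1)] lin_op_eq_zero[OF assms(2)]
      cvec.scale_right_distrib cvec.subspace_add[OF subspace_lvecs] add_ac)

lemma lin_op_zero_map: "lin_op m 0"
  by (intro lin_opI) (auto simp: fun_eq_iff lvecs_def)

lemma lin_op_funpow: "lin_op m T \<Longrightarrow> lin_op m (T ^^ Suc n)"
  by (induction n) (auto intro: lin_op_comp)

lemma lin_op_expand:
  assumes "lin_op m T"
  shows "T v = (\<Sum>k<m. vscale (v k) (T (unitv k)))"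
proof -
  have "T (v - (\<Sum>k<m. vscale (v k) (unitv k))) = 0"
    using assms by (simp add: lin_op_def sum_fun_apply sum_unitv_apply)
  then show ?thesis
    by (simp add: lin_op_diff[OF assms] lin_op_sum[OF assms] lin_op_scale[OF assms])
qed

lemma lin_op_expand_apply: "lin_op m T \<Longrightarrow> T v i = (\<Sum>k<m. v k * T (unitv k) i)"
  by (subst lin_op_expand) (auto simp: sum_fun_apply)

lemma lin_op_eqI:
  assumes "lin_op m S" "lin_op m T" "\<And>k. k < m \<Longrightarrow> S (unitv k) = T (unitv k)"
  shows "S = T"
proof
  show "S v = T v" for v
    unfolding lin_op_expand[OF assms(1), of v] lin_op_expand[OF assms(2), of v] using assms(3) by simp
qed

lemma lin_op_uminus:
  assumes "lin_op m T"
  shows "lin_op m (- T)"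
  by (intro lin_opI)
    (simp_all add: lin_op_add[OF assms] lin_op_scale[OF assms] lin_op_eq_zero[OF assms]
      cvec.subspace_neg[OF subspace_lvecs lin_op_in_lvecs[OF assms]] cvec.scale_minus_right)

lemma bilin_op_eqI:
  assumes "\<And>x. lin_op m (B x)" "\<And>y. lin_op m (\<lambda>x. B x y)" "\<And>x. lin_op m (B' x)" "\<And>y. lin_op m (\<lambda>x. B' x y)"
    and "\<And>a b. a < m \<Longrightarrow> b < m \<Longrightarrow> B (unitv a) (unitv b) = B' (unitv a) (unitv b)"
  shows "B x y = B' x y"
proof -
  have "B (unitv a) = B' (unitv a)" if "a < m" for a
    using assms(1,3,5) that by (intro lin_op_eqI) auto
  then have "(\<lambda>x. B x y) = (\<lambda>x. B' x y)"
    using assms(2,4) by (intro lin_op_eqI) auto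
  then show ?thesis by (rule fun_cong)
qed

definition op_trace :: "nat \<Rightarrow> ((nat \<Rightarrow> complex) \<Rightarrow> nat \<Rightarrow> complex) \<Rightarrow> complex" where
  "op_trace m T = (\<Sum>k<m. T (unitv k) k)"

lemma op_trace_diff: "op_trace m (S - T) = op_trace m S - op_trace m T"
  by (simp add: op_trace_def sum_subtractf)

lemma op_trace_comm:
  assumes "lin_op m S" "lin_op m T"
  shows "op_trace m (S \<circ> T) = op_trace m (T \<circ> S)"
proof -
  have "op_trace m (S \<circ> T) = (\<Sum>k<m. \<Sum>l<m. T (unitv k) l * S (unitv l) k)"
    by (simp add: op_trace_def lin_op_expand_apply[OF assms(1), of "T _"])
  also have "\<dots> = (\<Sum>l<m. \<Sum>k<m. S (unitv l) k * T (unitv k) l)"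
    by (subst sum.swap) (simp add: mult.commute)
  also have "\<dots> = op_trace m (T \<circ> S)"
    by (simp add: op_trace_def lin_op_expand_apply[OF assms(2), of "S _"])
  finally show ?thesis .
qed

text \<open>A basis \<open>f\<close> of \<open>lvecs m\<close> with its coordinate functionals \<open>q\<close>.\<close>
locale lvecs_basis =
  fixes m :: nat and f :: "nat \<Rightarrow> nat \<Rightarrow> complex" and q :: "nat \<Rightarrow> (nat \<Rightarrow> complex) \<Rightarrow> complex"
  assumes basis_in_lvecs: "j < m \<Longrightarrow> f j \<in> lvecs m"
    and coord_expand: "q k v = (\<Sum>l<m. v l * q k (unitv l))"
    and coord_basis: "j < m \<Longrightarrow> k < m \<Longrightarrow> q k (f j) = (if k = j then 1 else 0)"
    and basis_expand: "v \<in> lvecs m \<Longrightarrow> v = (\<Sum>k<m. vscale (q k v) (f k))"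
begin

lemma coord_module_hom: "Modules.module_hom vscale (*) (q k)"
proof -
  have "q k (u + v) = q k u + q k v" "q k (vscale r u) = r * q k u" for u v r
    by (subst (1 2 3) coord_expand, simp add: distrib_right sum.distrib)
      (subst (1 2) coord_expand, simp add: sum_distrib_left mult_ac)
  then show ?thesis
    using cvec.module_axioms by (simp add: module_hom_iff Modules.module_def algebra_simps)
qed

lemmas coord_add = module_hom.add[OF coord_module_hom]
  and coord_scale = module_hom.scale[OF coord_module_hom]
  and coord_zero = module_hom.zero[OF coord_module_hom]
  and coord_diff = module_hom.diff[OF coord_module_hom]
  and coord_sum = module_hom.sum[OF coord_module_hom]

lemma lin_op_basis_expand:
  assumes "lin_op m T" "v \<in> lvecs m"
  shows "T v = (\<Sum>k<m. vscale (q k v) (T (f k)))"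
  by (subst basis_expand[OF assms(2)]) (simp add: lin_op_sum[OF assms(1)] lin_op_scale[OF assms(1)])

lemma lin_op_eq_on_basisI:
  assumes "lin_op m S" "lin_op m T" "\<And>j. j < m \<Longrightarrow> S (f j) = T (f j)"
  shows "S = T"
proof (rule lin_op_eqI[OF assms(1,2)])
  show "S (unitv k) = T (unitv k)" if "k < m" for k
    unfolding lin_op_basis_expand[OF assms(1) unitv_in_lvecs[OF that]]
      lin_op_basis_expand[OF assms(2) unitv_in_lvecs[OF that]]
    using assms(3) by simp
qed

lemma op_trace_basis:
  assumes "lin_op m T"
  shows "op_trace m T = (\<Sum>k<m. q k (T (f k)))"
proof -
  have "(\<Sum>k<m. q k (T (f k))) = (\<Sum>k<m. \<Sum>i<m. f k i * q k (T (unitv i)))"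
    by (simp add: lin_op_expand[OF assms, of "f _"] coord_sum coord_scale)
  also have "\<dots> = (\<Sum>i<m. \<Sum>k<m. q k (T (unitv i)) * f k i)"
    by (subst sum.swap) (simp add: mult.commute)
  also have "\<dots> = (\<Sum>i<m. (\<Sum>k<m. vscale (q k (T (unitv i))) (f k)) i)"
    by (simp add: sum_fun_apply)
  also have "\<dots> = op_trace m T"
    by (simp add: op_trace_def flip: basis_expand[OF lin_op_in_lvecs[OF assms]])
  finally show ?thesis by simp
qed

end

lemma mult_mat_index_sum:
  assumes "A \<in> carrier_mat m m" "B \<in> carrier_mat m m" "i < m" "j < m"
  shows "(A * B) $$ (i,j) = (\<Sum>k<m. A $$ (i,k) * B $$ (k,j))"
  using assms by (simp add: scalar_prod_def atLeast0LessThan)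

lemma lvecs_basis_columns:
  assumes carrier: "P \<in> carrier_mat m m" "Q \<in> carrier_mat m m" and inverse: "P * Q = 1\<^sub>m m" "Q * P = 1\<^sub>m m"
  shows "lvecs_basis m (\<lambda>j i. if i < m then P $$ (i,j) else 0) (\<lambda>k v. \<Sum>l<m. Q $$ (k,l) * v l)"
proof
  fix v :: "nat \<Rightarrow> complex" assume v: "v \<in> lvecs m"
  have "(\<Sum>k<m. (\<Sum>l<m. Q $$ (k,l) * v l) * P $$ (i,k)) = v i" if "i < m" for i
  proof -
    have "(\<Sum>k<m. (\<Sum>l<m. Q $$ (k,l) * v l) * P $$ (i,k)) = (\<Sum>l<m. (\<Sum>k<m. P $$ (i,k) * Q $$ (k,l)) * v l)"
      unfolding sum_distrib_right by (subst sum.swap) (simp add: mult_ac)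
    also have "\<dots> = (\<Sum>l<m. if i = l then v l else 0)"
      using that inverse(1) by (intro sum.cong) (auto simp: mult_mat_index_sum[OF carrier, symmetric])
    finally show ?thesis using that by simp
  qed
  then have "v i = (\<Sum>k<m. vscale (\<Sum>l<m. Q $$ (k,l) * v l) (\<lambda>i. if i < m then P $$ (i,k) else 0)) i" for i
    using v by (cases "i < m") (simp_all add: sum_fun_apply lvecs_def)
  then show "v = (\<Sum>k<m. vscale (\<Sum>l<m. Q $$ (k,l) * v l) (\<lambda>i. if i < m then P $$ (i,k) else 0))"
    by (rule ext)
next
  fix k j assume "k < m" "j < m"
  then show "(\<Sum>l<m. Q $$ (k,l) * (if l < m then P $$ (l,j) else 0)) = (if k = j then 1 else 0)"
    using mult_mat_index_sum[OF carrier(2,1), of k j] inverse(2) by simp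
next
  fix k v
  show "(\<Sum>l<m. Q $$ (k,l) * v l) = (\<Sum>l<m. v l * (\<Sum>i<m. Q $$ (k,i) * unitv l i))"
    by (intro sum.cong refl) (auto simp: unitv_def mult.commute if_distrib[of "(*) _"] cong: if_cong)
qed (auto simp: lvecs_def)

text \<open>A basis of generalized eigenvectors in which \<open>T\<close> has Jordan normal form: \<open>\<alpha>\<close> is the diagonal of the matrix
  and \<open>\<epsilon>\<close> the superdiagonal.\<close>
locale jordan_chain_basis = lvecs_basis m f q for m f q +
  fixes T :: "(nat \<Rightarrow> complex) \<Rightarrow> nat \<Rightarrow> complex" and \<alpha> \<epsilon> :: "nat \<Rightarrow> complex"
  assumes lin_op: "lin_op m T"
    and chain: "j < m \<Longrightarrow> T (f j) = vscale (\<alpha> j) (f j) + vscale (\<epsilon> j) (f (j - 1))"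
    and chain_eigenvalue: "j < m \<Longrightarrow> \<epsilon> j \<noteq> 0 \<Longrightarrow> 0 < j \<and> \<alpha> (j - 1) = \<alpha> j"

lemma jordan_matrix_entries:
  fixes n_as :: "(nat \<times> 'a::zero_neq_one) list"
  shows "\<exists>\<alpha> \<epsilon>. (\<forall>i<sum_list (map fst n_as). \<forall>j<sum_list (map fst n_as).
      jordan_matrix n_as $$ (i,j) = (if i = j then \<alpha> j else if Suc i = j then \<epsilon> j else 0)) \<and>
     (\<forall>j<sum_list (map fst n_as). \<epsilon> j \<noteq> 0 \<longrightarrow> 0 < j \<and> \<alpha> (j - 1) = \<alpha> j)"
proof (induction n_as)
  case Nil
  then show ?case by simp
next
  case (Cons na n_as)
  obtain n a where na: "na = (n,a)" by (cases na)
  let ?s = "sum_list (map fst n_as)"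
  from Cons obtain \<alpha> \<epsilon> where
    entries: "\<And>i j. i < ?s \<Longrightarrow> j < ?s \<Longrightarrow>
      jordan_matrix n_as $$ (i,j) = (if i = j then \<alpha> j else if Suc i = j then \<epsilon> j else 0)"
    and eigenvalue: "\<And>j. j < ?s \<Longrightarrow> \<epsilon> j \<noteq> 0 \<Longrightarrow> 0 < j \<and> \<alpha> (j - 1) = \<alpha> j" by blast
  define \<alpha>' where "\<alpha>' = (\<lambda>j. if j < n then a else \<alpha> (j - n))"
  define \<epsilon>' where "\<epsilon>' = (\<lambda>j. if j < n then of_bool (0 < j) else if j = n then 0 else \<epsilon> (j - n))"
  have "jordan_matrix (na # n_as) $$ (i, j) = (if i = j then \<alpha>' j else if Suc i = j then \<epsilon>' j else 0)"
    if "i < sum_list (map fst (na # n_as))" "j < sum_list (map fst (na # n_as))" for i j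
    using that unfolding na jordan_matrix_Cons by (auto simp: entries \<alpha>'_def \<epsilon>'_def)
  moreover have "0 < j \<and> \<alpha>' (j - 1) = \<alpha>' j"
    if "j < sum_list (map fst (na # n_as))" "\<epsilon>' j \<noteq> 0" for j
    using that eigenvalue[of "j - n"] by (auto simp: na \<alpha>'_def \<epsilon>'_def diff_commute split: if_splits)
  ultimately show ?case by blast
qed

lemma complex_mat_jordan_columns:
  fixes M :: "complex mat"
  assumes M: "M \<in> carrier_mat m m"
  obtains P Q \<alpha> \<epsilon> where "P \<in> carrier_mat m m" "Q \<in> carrier_mat m m" "P * Q = 1\<^sub>m m" "Q * P = 1\<^sub>m m"
    and "\<And>i j. i < m \<Longrightarrow> j < m \<Longrightarrow> (M * P) $$ (i,j) = \<alpha> j * P $$ (i,j) + \<epsilon> j * P $$ (i,j - 1)"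
    and "\<And>j. j < m \<Longrightarrow> \<epsilon> j \<noteq> 0 \<Longrightarrow> 0 < j \<and> \<alpha> (j - 1) = \<alpha> j"
proof -
  obtain as where "char_poly M = (\<Prod>a\<leftarrow>as. [:- a, 1:])" using char_poly_factorized[OF M] by blast
  then obtain n_as where "jordan_nf M n_as" using jordan_nf_exists[OF M] by blast
  then obtain P Q where "similar_mat_wit M (jordan_matrix n_as) P Q"
    unfolding jordan_nf_def similar_mat_def by blast
  note similar = similar_mat_witD2[OF M this]
  note carrier = similar(4-7)
  let ?J = "jordan_matrix n_as"
  have size: "sum_list (map fst n_as) = m" using carrier(2) by (metis carrier_matD(1) jordan_matrix_dim(1))
  from jordan_matrix_entries[of n_as, unfolded size] obtain \<alpha> \<epsilon> where
    entries: "\<forall>i<m. \<forall>j<m. ?J $$ (i,j) = (if i = j then \<alpha> j else if Suc i = j then \<epsilon> j else 0)"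
    and eigenvalue: "\<forall>j<m. \<epsilon> j \<noteq> 0 \<longrightarrow> 0 < j \<and> \<alpha> (j - 1) = \<alpha> j"
    by (elim exE conjE) (rule that)
  have "M * P = P * ?J * (Q * P)"
    unfolding similar(3) by (rule assoc_mult_mat[OF mult_carrier_mat[OF carrier(3,2)] carrier(4,3)])
  then have MP: "M * P = P * ?J"
    unfolding similar(2) using right_mult_one_mat[OF mult_carrier_mat[OF carrier(3,2)]] by simp
  have columns: "(M * P) $$ (i,j) = \<alpha> j * P $$ (i,j) + \<epsilon> j * P $$ (i,j - 1)" if "i < m" "j < m" for i j
  proof -
    have "(M * P) $$ (i,j) = (\<Sum>k<m. P $$ (i,k) * ?J $$ (k,j))"
      unfolding MP by (rule mult_mat_index_sum[OF carrier(3,2) that])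
    also have "\<dots> = (\<Sum>k<m. (if k = j then \<alpha> j * P $$ (i,j) else 0) + (if k = j - 1 then \<epsilon> j * P $$ (i,j - 1) else 0))"
      using that eigenvalue by (intro sum.cong) (auto simp: entries)
    finally show ?thesis using that by (simp add: sum.distrib)
  qed
  show thesis by (rule that[OF carrier(3,4) similar(1,2) columns]) (use eigenvalue in auto)
qed

lemma jordan_chain_basis_exists:
  assumes T: "lin_op m T"
  shows "\<exists>f q \<alpha> \<epsilon>. jordan_chain_basis m f q T \<alpha> \<epsilon>"
proof -
  define M where "M = mat m m (\<lambda>(i,j). T (unitv j) i)"
  have M: "M \<in> carrier_mat m m" by (simp add: M_def)
  obtain P Q \<alpha> \<epsilon> where carrier: "P \<in> carrier_mat m m" "Q \<in> carrier_mat m m"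
    and inverse: "P * Q = 1\<^sub>m m" "Q * P = 1\<^sub>m m"
    and columns: "\<And>i j. i < m \<Longrightarrow> j < m \<Longrightarrow> (M * P) $$ (i,j) = \<alpha> j * P $$ (i,j) + \<epsilon> j * P $$ (i,j - 1)"
    and eigenvalue: "\<And>j. j < m \<Longrightarrow> \<epsilon> j \<noteq> 0 \<Longrightarrow> 0 < j \<and> \<alpha> (j - 1) = \<alpha> j"
    by (rule complex_mat_jordan_columns[OF M]) (rule that)
  let ?f = "\<lambda>j i. if i < m then P $$ (i,j) else 0"
  have "T (?f j) i = (vscale (\<alpha> j) (?f j) + vscale (\<epsilon> j) (?f (j - 1))) i" if "j < m" for i j
  proof (cases "i < m")
    case True
    have "T (?f j) i = (M * P) $$ (i,j)"
      unfolding mult_mat_index_sum[OF M carrier(1) True that] lin_op_expand_apply[OF T, of "?f j"]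
      using True by (intro sum.cong) (auto simp: M_def)
    then show ?thesis using columns[OF True that] True by simp
  next
    case False
    then show ?thesis using lin_op_in_lvecs[OF T] by (simp add: lvecs_def)
  qed
  then have "jordan_chain_basis m ?f (\<lambda>k v. \<Sum>l<m. Q $$ (k,l) * v l) T \<alpha> \<epsilon>"
    using lvecs_basis_columns[OF carrier inverse] T eigenvalue
    by (intro jordan_chain_basis.intro jordan_chain_basis_axioms.intro) auto
  then show ?thesis by blast
qed

context jordan_chain_basis
begin

definition gen_eigenspace :: "complex \<Rightarrow> (nat \<Rightarrow> complex) set" where
  "gen_eigenspace \<beta> = {v \<in> lvecs m. \<forall>k<m. \<alpha> k \<noteq> \<beta> \<longrightarrow> q k v = 0}"

lemma subspace_gen_eigenspace: "cvec.subspace (gen_eigenspace \<beta>)"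
  using subspace_lvecs[of m]
  by (auto simp: cvec.subspace_def gen_eigenspace_def coord_zero coord_add coord_scale)

lemma basis_in_gen_eigenspace: "j < m \<Longrightarrow> f j \<in> gen_eigenspace (\<alpha> j)"
  by (auto simp: gen_eigenspace_def basis_in_lvecs coord_basis)

lemma coord_image:
  assumes "v \<in> lvecs m" "k < m"
  shows "q k (T v) = \<alpha> k * q k v + (if Suc k < m then \<epsilon> (Suc k) * q (Suc k) v else 0)"
proof -
  have "q k (T v) = (\<Sum>j<m. q j v * q k (T (f j)))"
    by (simp add: lin_op_basis_expand[OF lin_op assms(1)] coord_sum coord_scale)
  also have "\<dots> = (\<Sum>j<m. (if j = k then \<alpha> k * q k v else 0) + (if j = Suc k then \<epsilon> (Suc k) * q (Suc k) v else 0))"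
  proof (intro sum.cong refl)
    fix j assume "j \<in> {..<m}"
    then have j: "j < m" by simp
    have "q k (f (j - 1)) = (if j = Suc k then 1 else 0)" if "\<epsilon> j \<noteq> 0"
      using coord_basis[of "j - 1" k] j assms(2) chain_eigenvalue[OF j that] by auto
    then show "q j v * q k (T (f j))
        = (if j = k then \<alpha> k * q k v else 0) + (if j = Suc k then \<epsilon> (Suc k) * q (Suc k) v else 0)"
      using j assms(2) by (cases "\<epsilon> j = 0") (auto simp: chain coord_add coord_scale coord_basis)
  qed
  also have "\<dots> = \<alpha> k * q k v + (if Suc k < m then \<epsilon> (Suc k) * q (Suc k) v else 0)"
    using assms(2) by (simp add: sum.distrib)
  finally show ?thesis .
qed

lemma gen_eigenspaceI:
  assumes v: "v \<in> lvecs m" and image: "T v - vscale \<beta> v \<in> gen_eigenspace \<beta>"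
  shows "v \<in> gen_eigenspace \<beta>"
proof -
  have "q k v = 0" if "k < m" "\<alpha> k \<noteq> \<beta>" for k
    using that
  proof (induction "m - k" arbitrary: k rule: less_induct)
    case less
    have "(if Suc k < m then \<epsilon> (Suc k) * q (Suc k) v else 0) = 0"
      using less.hyps[OF diff_less_mono2[OF lessI]] less.prems chain_eigenvalue[of "Suc k"]
      by (cases "\<epsilon> (Suc k) = 0") auto
    then have "(\<alpha> k - \<beta>) * q k v = 0"
      using image coord_image[OF v less.prems(1)] less.prems
      by (simp add: gen_eigenspace_def coord_diff coord_scale algebra_simps)
    then show ?case using less.prems(2) by simp
  qed
  then show ?thesis using v by (simp add: gen_eigenspace_def)
qed

definition conj_semisimple :: "(nat \<Rightarrow> complex) \<Rightarrow> nat \<Rightarrow> complex" where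
  "conj_semisimple v = (\<Sum>k<m. vscale (cnj (\<alpha> k) * q k v) (f k))"

lemma lin_op_conj_semisimple: "lin_op m conj_semisimple"
proof (rule lin_opI)
  show "conj_semisimple (u + v) = conj_semisimple u + conj_semisimple v" for u v
    by (simp add: conj_semisimple_def coord_add distrib_left cvec.scale_left_distrib sum.distrib)
  show "conj_semisimple (vscale r v) = vscale r (conj_semisimple v)" for r v
    by (simp add: conj_semisimple_def coord_scale cvec.scale_sum_right mult_ac)
  show "conj_semisimple v \<in> lvecs m" for v
    unfolding conj_semisimple_def
    by (intro cvec.subspace_sum cvec.subspace_scale subspace_lvecs basis_in_lvecs) simp
  show "conj_semisimple v = 0" if "\<And>k. k < m \<Longrightarrow> v k = 0" for v
    using that by (simp add: conj_semisimple_def coord_expand[of _ v])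
qed

lemma conj_semisimple_gen_eigenspace:
  assumes "v \<in> gen_eigenspace \<beta>"
  shows "conj_semisimple v = vscale (cnj \<beta>) v"
proof -
  have v: "v \<in> lvecs m" using assms by (simp add: gen_eigenspace_def)
  have "conj_semisimple v = (\<Sum>k<m. vscale (cnj \<beta>) (vscale (q k v) (f k)))"
    unfolding conj_semisimple_def
  proof (intro sum.cong refl)
    show "vscale (cnj (\<alpha> k) * q k v) (f k) = vscale (cnj \<beta>) (vscale (q k v) (f k))" if "k \<in> {..<m}" for k
      using that assms by (cases "\<alpha> k = \<beta>") (auto simp: gen_eigenspace_def)
  qed
  then show ?thesis by (simp only: flip: cvec.scale_sum_right basis_expand[OF v])
qed

lemma trace_conj_semisimple: "op_trace m (conj_semisimple \<circ> T) = of_real (\<Sum>k<m. (cmod (\<alpha> k))\<^sup>2)"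
proof -
  note hom = lin_op_conj_semisimple
  have "q k (conj_semisimple (T (f k))) = of_real ((cmod (\<alpha> k))\<^sup>2)" if k: "k < m" for k
  proof -
    have "conj_semisimple (f (k - 1)) = vscale (cnj (\<alpha> k)) (f (k - 1))" if "\<epsilon> k \<noteq> 0"
      using chain_eigenvalue[OF k that] k
      by (intro conj_semisimple_gen_eigenspace) (use basis_in_gen_eigenspace[of "k - 1"] in auto)
    moreover have "q k (f (k - 1)) = 0" if "\<epsilon> k \<noteq> 0"
      using coord_basis[of "k - 1" k] chain_eigenvalue[OF k that] k by auto
    ultimately show ?thesis
      using k conj_semisimple_gen_eigenspace[OF basis_in_gen_eigenspace[OF k]]
      by (cases "\<epsilon> k = 0")
        (simp_all add: chain lin_op_add[OF hom] lin_op_scale[OF hom] coord_add coord_scale coord_basis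
          complex_norm_square del: of_real_power)
  qed
  then show ?thesis by (simp add: op_trace_basis[OF lin_op_comp[OF hom lin_op]])
qed

lemma nilpotent_if_eigenvalues_zero:
  assumes "\<And>k. k < m \<Longrightarrow> \<alpha> k = 0"
  shows "T ^^ Suc m = 0"
proof (rule lin_op_eq_on_basisI[OF lin_op_funpow[OF lin_op] lin_op_zero_map])
  have kills: "(T ^^ Suc n) (f j) = 0" if "j \<le> n" "j < m" for n j
    using that
  proof (induction n arbitrary: j)
    case 0
    then have "\<epsilon> 0 = 0" using chain_eigenvalue[of 0] by auto
    then show ?case using 0 chain[of 0] assms[of 0] by simp
  next
    case (Suc n)
    note hom = lin_op_funpow[OF lin_op, of n]
    have "(T ^^ Suc (Suc n)) (f j) = (T ^^ Suc n) (T (f j))" by (simp add: funpow_swap1)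
    also have "\<dots> = vscale (\<epsilon> j) ((T ^^ Suc n) (f (j - 1)))"
      by (simp only: chain[OF Suc.prems(2)] assms[OF Suc.prems(2)] cvec.scale_zero_left add_0 lin_op_scale[OF hom])
    also have "\<dots> = 0"
      using Suc.IH[of "j - 1"] Suc.prems chain_eigenvalue[OF Suc.prems(2)] by (cases "\<epsilon> j = 0") auto
    finally show ?case .
  qed
  show "(T ^^ Suc m) (f j) = 0 (f j)" if "j < m" for j
    using kills[of j m] that by simp
qed

end

section \<open>Lie algebras and the Killing form\<close>

lemma lbracket_in_lvecs: "lbracket m c x y \<in> lvecs m"
  by (simp add: lvecs_def lbracket_def)

lemma lin_op_lbracket: "lin_op m (lbracket m c x)"
  by (intro lin_opI lbracket_in_lvecs)
    (auto simp: lbracket_def fun_eq_iff distrib_left distrib_right sum.distrib sum_distrib_left mult_ac)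

lemma lin_op_lbracket_left: "lin_op m (\<lambda>x. lbracket m c x y)"
  by (intro lin_opI lbracket_in_lvecs)
    (auto simp: lbracket_def fun_eq_iff distrib_left distrib_right sum.distrib sum_distrib_left mult_ac)

lemmas lbracket_add_right = lin_op_add[OF lin_op_lbracket]
  and lbracket_scale_right = lin_op_scale[OF lin_op_lbracket]
  and lbracket_neg_right = module_hom.neg[OF lin_op_module_hom[OF lin_op_lbracket]]
  and lbracket_add_left = lin_op_add[OF lin_op_lbracket_left]
  and lbracket_scale_left = lin_op_scale[OF lin_op_lbracket_left]
  and lbracket_zero_left = lin_op_zero[OF lin_op_lbracket_left]

lemma lbracket_unitv:
  assumes "a < m" "b < m" "k < m"
  shows "lbracket m c (unitv a) (unitv b) k = c a b k"
  using assms by (simp add: lbracket_def mult.assoc sum_unitv_mult flip: sum_distrib_left)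

lemma lbracket_lbracket_unitv:
  assumes "a < m" "b < m" "d < m" "l < m"
  shows "lbracket m c (unitv a) (lbracket m c (unitv b) (unitv d)) l = (\<Sum>k<m. c b d k * c a k l)"
  unfolding lin_op_expand_apply[OF lin_op_lbracket, of _ _ _ "lbracket m c (unitv b) (unitv d)"]
  using assms by (simp add: lbracket_unitv)

locale lie_algebra =
  fixes m :: nat and c :: "nat \<Rightarrow> nat \<Rightarrow> nat \<Rightarrow> complex"
  assumes lie_alg: "lie_alg m c"
begin

abbreviation br :: "(nat \<Rightarrow> complex) \<Rightarrow> (nat \<Rightarrow> complex) \<Rightarrow> nat \<Rightarrow> complex" where
  "br \<equiv> lbracket m c"

lemma br_antisym: "br x y = - br y x"
proof (rule bilin_op_eqI[of m br "\<lambda>x y. - br y x"])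
  show "lin_op m (\<lambda>y. - br y x)" "lin_op m (\<lambda>x. - br y x)" for x y
    using lin_op_uminus[OF lin_op_lbracket_left[of m c x]] lin_op_uminus[OF lin_op_lbracket[of m c y]]
    by (simp_all add: fun_Compl_def)
  fix a b assume "a < m" "b < m"
  moreover from this have "c a b k = - c b a k" if "k < m" for k
    using lie_alg that unfolding lie_alg_def by blast
  ultimately have "br (unitv a) (unitv b) k = (- br (unitv b) (unitv a)) k" for k
    by (cases "k < m") (simp_all add: lbracket_unitv, simp add: lbracket_def)
  then show "br (unitv a) (unitv b) = - br (unitv b) (unitv a)" by (rule ext)
qed (rule lin_op_lbracket lin_op_lbracket_left)+

lemma br_derivation_unitv:
  assumes "a < m" "b < m" "d < m"
  shows "br (unitv a) (br (unitv b) (unitv d))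
    = br (br (unitv a) (unitv b)) (unitv d) + br (unitv b) (br (unitv a) (unitv d))"
proof
  fix l
  let ?e = unitv
  have antisym_outer: "br (br (?e a) (?e b)) (?e d) = - br (?e d) (br (?e a) (?e b))"
    by (rule br_antisym)
  have antisym_inner: "br (?e b) (br (?e a) (?e d)) = - br (?e b) (br (?e d) (?e a))"
    unfolding br_antisym[of "?e a" "?e d"] by (rule lbracket_neg_right)
  show "br (?e a) (br (?e b) (?e d)) l = (br (br (?e a) (?e b)) (?e d) + br (?e b) (br (?e a) (?e d))) l"
  proof (cases "l < m")
    case True
    have "(\<Sum>k<m. c b d k * c a k l) + (\<Sum>k<m. c d a k * c b k l) + (\<Sum>k<m. c a b k * c d k l) = 0"
      using lie_alg assms True unfolding lie_alg_def by blast
    then have "br (?e a) (br (?e b) (?e d)) l + br (?e b) (br (?e d) (?e a)) l + br (?e d) (br (?e a) (?e b)) l = 0"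
      using assms True by (simp only: lbracket_lbracket_unitv)
    then show ?thesis
      unfolding antisym_outer antisym_inner plus_fun_apply uminus_apply
      by (simp add: eq_diff_eq eq_neg_iff_add_eq_0)
  next
    case False
    then show ?thesis using lbracket_in_lvecs by (simp add: lvecs_def)
  qed
qed

lemma br_derivation: "br x (br y z) = br (br x y) z + br y (br x z)"
proof -
  have unitv: "br x (br y (unitv d)) = br (br x y) (unitv d) + br y (br x (unitv d))" if "d < m" for x y d
  proof (rule bilin_op_eqI[of m "\<lambda>x y. br x (br y (unitv d))"
        "\<lambda>x y. br (br x y) (unitv d) + br y (br x (unitv d))"])
    let ?ad_d = "\<lambda>y. br y (unitv d)"
    note comp = lin_op_comp[OF lin_op_lbracket lin_op_lbracket_left] lin_op_comp[OF lin_op_lbracket_left lin_op_lbracket]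
      lin_op_comp[OF lin_op_lbracket_left lin_op_lbracket_left]
    show "lin_op m (\<lambda>y. br x (?ad_d y))" "lin_op m (\<lambda>y. br y (?ad_d x))" for x
      using comp(1)[of m c x c "unitv d"] lin_op_lbracket_left by (simp_all add: o_def)
    show "lin_op m (\<lambda>y. ?ad_d (br x y) + br y (?ad_d x))" for x
      using lin_op_plus[OF comp(2)[of m c "unitv d" c x] lin_op_lbracket_left[of m c "?ad_d x"]]
      by (simp add: o_def plus_fun_def)
    show "lin_op m (\<lambda>x. ?ad_d (br x y) + br y (?ad_d x))" for y
      using lin_op_plus[OF comp(3)[of m c "unitv d" c y] comp(1)[of m c y c "unitv d"]]
      by (simp add: o_def plus_fun_def)
  qed (rule br_derivation_unitv[OF _ _ that])
  have "br x \<circ> br y = br (br x y) + (br y \<circ> br x)"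
  proof (rule lin_op_eqI[of m])
    show "(br x \<circ> br y) (unitv k) = (br (br x y) + (br y \<circ> br x)) (unitv k)" if "k < m" for k
      by (simp only: o_apply plus_fun_apply) (rule unitv[OF that])
  qed (intro lin_op_comp lin_op_plus lin_op_lbracket)+
  from fun_cong[OF this, of z] show ?thesis by (simp only: o_apply plus_fun_apply)
qed

definition kform :: "(nat \<Rightarrow> complex) \<Rightarrow> (nat \<Rightarrow> complex) \<Rightarrow> complex" where
  "kform x y = op_trace m (br x \<circ> br y)"

lemma kform_unitv: "a < m \<Longrightarrow> b < m \<Longrightarrow> kform (unitv a) (unitv b) = killing m c a b"
  by (simp add: kform_def op_trace_def killing_def lbracket_lbracket_unitv)

lemma kform_sym: "kform x y = kform y x"
  unfolding kform_def by (rule op_trace_comm[OF lin_op_lbracket lin_op_lbracket])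

lemma kform_expand: "kform v w = (\<Sum>a<m. v a * kform (unitv a) w)"
proof -
  have "kform v w = (\<Sum>k<m. \<Sum>a<m. v a * br (unitv a) (br w (unitv k)) k)"
    unfolding kform_def op_trace_def o_apply
    by (intro sum.cong refl lin_op_expand_apply[OF lin_op_lbracket_left])
  also have "\<dots> = (\<Sum>a<m. v a * kform (unitv a) w)"
    by (subst sum.swap) (simp add: kform_def op_trace_def sum_distrib_left)
  finally show ?thesis .
qed

definition derivation :: "((nat \<Rightarrow> complex) \<Rightarrow> nat \<Rightarrow> complex) \<Rightarrow> bool" where
  "derivation D \<longleftrightarrow> lin_op m D \<and> (\<forall>y z. D (br y z) = br (D y) z + br y (D z))"

lemma derivation_br: "derivation (br x)"
  unfolding derivation_def using lin_op_lbracket br_derivation by blast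

lemma kform_derivation:
  assumes "derivation D"
  shows "kform (D y) z = op_trace m (D \<circ> br (br y z))"
proof -
  have D: "lin_op m D" and leibniz: "\<And>y z. D (br y z) = br (D y) z + br y (D z)"
    using assms by (auto simp: derivation_def)
  have "br (D y) \<circ> br z = (D \<circ> (br y \<circ> br z)) - (br y \<circ> (D \<circ> br z))"
    by (rule ext) (simp add: leibniz)
  then have "kform (D y) z = op_trace m (D \<circ> (br y \<circ> br z)) - op_trace m (br y \<circ> (D \<circ> br z))"
    by (simp only: kform_def op_trace_diff)
  also have "op_trace m (br y \<circ> (D \<circ> br z)) = op_trace m ((D \<circ> br z) \<circ> br y)"
    by (intro op_trace_comm lin_op_comp lin_op_lbracket D)
  also have "op_trace m (D \<circ> (br y \<circ> br z)) - op_trace m ((D \<circ> br z) \<circ> br y)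
      = op_trace m (D \<circ> br (br y z))"
  proof -
    have "D \<circ> br (br y z) = (D \<circ> (br y \<circ> br z)) - ((D \<circ> br z) \<circ> br y)"
      by (rule ext) (simp add: br_derivation[of y z] lin_op_add[OF D])
    then show ?thesis by (simp only: op_trace_diff)
  qed
  finally show ?thesis .
qed

lemma kform_invariant: "kform (br x y) z = kform x (br y z)"
  unfolding kform_derivation[OF derivation_br] by (simp add: kform_def)

end

section \<open>Nondegeneracy of the Killing form of a simple Lie algebra\<close>

locale ad_jordan_basis = lie_algebra m c + jordan_chain_basis m f q "lbracket m c x" \<alpha> \<epsilon>
  for m c x f q \<alpha> \<epsilon>
begin

lemma br_gen_eigenspaces:
  "i < m \<Longrightarrow> j < m \<Longrightarrow> br (f i) (f j) \<in> gen_eigenspace (\<alpha> i + \<alpha> j)"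
proof (induction "i + j" arbitrary: i j rule: less_induct)
  case less
  let ?W = "gen_eigenspace (\<alpha> i + \<alpha> j)"
  have left: "vscale (\<epsilon> i) (br (f (i - 1)) (f j)) \<in> ?W"
  proof (cases "\<epsilon> i = 0")
    case False
    then show ?thesis
      using less.hyps[of "i - 1" j] less.prems chain_eigenvalue[OF less.prems(1)]
      by (auto intro!: cvec.subspace_scale[OF subspace_gen_eigenspace])
  qed (simp add: cvec.subspace_0[OF subspace_gen_eigenspace])
  have right: "vscale (\<epsilon> j) (br (f i) (f (j - 1))) \<in> ?W"
  proof (cases "\<epsilon> j = 0")
    case False
    then show ?thesis
      using less.hyps[of i "j - 1"] less.prems chain_eigenvalue[OF less.prems(2)]
      by (auto intro!: cvec.subspace_scale[OF subspace_gen_eigenspace])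
  qed (simp add: cvec.subspace_0[OF subspace_gen_eigenspace])
  have regroup: "(a + b) + (d + e) - (a + d) = b + e" for a b d e :: "nat \<Rightarrow> complex"
    by (simp add: algebra_simps)
  have "br x (br (f i) (f j)) - vscale (\<alpha> i + \<alpha> j) (br (f i) (f j))
      = vscale (\<epsilon> i) (br (f (i - 1)) (f j)) + vscale (\<epsilon> j) (br (f i) (f (j - 1)))"
    unfolding br_derivation[of x] chain[OF less.prems(1)] chain[OF less.prems(2)]
      lbracket_add_left lbracket_add_right lbracket_scale_left lbracket_scale_right cvec.scale_left_distrib
    by (rule regroup)
  then have "br x (br (f i) (f j)) - vscale (\<alpha> i + \<alpha> j) (br (f i) (f j)) \<in> ?W"
    using cvec.subspace_add[OF subspace_gen_eigenspace left right] by (simp only:)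
  then show ?case by (rule gen_eigenspaceI[OF lbracket_in_lvecs])
qed

lemma derivation_conj_semisimple: "derivation conj_semisimple"
proof -
  let ?D = conj_semisimple
  note D = lin_op_conj_semisimple
  have basis: "?D (br (f i) (f j)) = br (?D (f i)) (f j) + br (f i) (?D (f j))" if "i < m" "j < m" for i j
    unfolding conj_semisimple_gen_eigenspace[OF br_gen_eigenspaces[OF that]]
      conj_semisimple_gen_eigenspace[OF basis_in_gen_eigenspace[OF that(1)]]
      conj_semisimple_gen_eigenspace[OF basis_in_gen_eigenspace[OF that(2)]]
      lbracket_scale_left lbracket_scale_right complex_cnj_add by (rule cvec.scale_left_distrib)
  have "?D \<circ> br (f i) = br (?D (f i)) + (br (f i) \<circ> ?D)" if "i < m" for i
  proof (rule lin_op_eq_on_basisI)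
    show "(?D \<circ> br (f i)) (f j) = (br (?D (f i)) + (br (f i) \<circ> ?D)) (f j)" if "j < m" for j
      using basis[OF \<open>i < m\<close> that] by simp
  qed (intro lin_op_comp lin_op_plus lin_op_lbracket D)+
  from fun_cong[OF this] have basis_left: "?D (br (f i) w) = br (?D (f i)) w + br (f i) (?D w)" if "i < m" for i w
    using that by (simp only: o_apply plus_fun_apply)
  have "?D \<circ> (\<lambda>u. br u w) = ((\<lambda>u. br u w) \<circ> ?D) + (\<lambda>u. br u (?D w))" for w
  proof (rule lin_op_eq_on_basisI)
    show "(?D \<circ> (\<lambda>u. br u w)) (f i) = (((\<lambda>u. br u w) \<circ> ?D) + (\<lambda>u. br u (?D w))) (f i)" if "i < m" for i
      using basis_left[OF that] by simp
  qed (intro lin_op_comp lin_op_plus lin_op_lbracket_left D)+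
  from fun_cong[OF this] have "?D (br u w) = br (?D u) w + br u (?D w)" for u w
    by (simp only: o_apply plus_fun_apply)
  then show ?thesis unfolding derivation_def using D by blast
qed

end

context lie_algebra
begin

text \<open>With \<open>D\<close> the semisimple part of \<open>br x\<close> with conjugated eigenvalues, \<open>tr (D br [y,z]) = kform (D y) z = 0\<close>, while
  \<open>tr (D br x)\<close> is the sum of the squared moduli of the eigenvalues.\<close>
lemma br_nilpotent_if_kform_zero:
  assumes kform_zero: "\<And>y z. kform y z = 0" and x: "x \<in> cvec.span {br y z | y z. P y z}"
  shows "br x ^^ Suc m = 0"
proof -
  obtain f q \<alpha> \<epsilon> where "jordan_chain_basis m f q (br x) \<alpha> \<epsilon>"
    using jordan_chain_basis_exists[OF lin_op_lbracket] by blast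
  then interpret ad_jordan_basis m c x f q \<alpha> \<epsilon>
    by (intro ad_jordan_basis.intro lie_algebra_axioms)
  let ?trace_D = "\<lambda>u. op_trace m (conj_semisimple \<circ> br u)"
  note D = lin_op_conj_semisimple
  have "?trace_D 0 = 0" "?trace_D (u + v) = ?trace_D u + ?trace_D v" "?trace_D (vscale r u) = r * ?trace_D u" for u v r
    by (simp_all add: op_trace_def lbracket_zero_left lbracket_add_left lbracket_scale_left lin_op_zero[OF D]
        lin_op_add[OF D] lin_op_scale[OF D] sum.distrib sum_distrib_left)
  then have subspace: "cvec.subspace {u. ?trace_D u = 0}"
    by (simp add: cvec.subspace_def)
  have "?trace_D (br y z) = 0" for y z
    unfolding kform_derivation[OF derivation_conj_semisimple, symmetric] by (rule kform_zero)
  then have "{br y z | y z. P y z} \<subseteq> {u. ?trace_D u = 0}" by blast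
  then have "cvec.span {br y z | y z. P y z} \<subseteq> {u. ?trace_D u = 0}"
    by (rule cvec.span_minimal[OF _ subspace])
  then have "?trace_D x = 0" using x by (rule subsetD[THEN CollectD])
  then have "(\<Sum>k<m. (cmod (\<alpha> k))\<^sup>2) = 0" by (simp only: trace_conj_semisimple of_real_eq_0_iff)
  then have "\<alpha> k = 0" if "k < m" for k
    using that by (subst (asm) sum_nonneg_eq_0_iff) auto
  then show ?thesis by (rule nilpotent_if_eigenvalues_zero)
qed

lemma killing_sym: "a < m \<Longrightarrow> b < m \<Longrightarrow> killing m c a b = killing m c b a"
  by (simp flip: kform_unitv) (rule kform_sym)

lemma lie_ideal_iff:
  "lie_ideal m c S \<longleftrightarrow> S \<subseteq> lvecs m \<and> cvec.subspace S \<and> (\<forall>x\<in>lvecs m. \<forall>s\<in>S. br x s \<in> S)"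
  by (auto simp: lie_ideal_def cvec.subspace_def vscale_def plus_fun_def zero_fun_def)

text \<open>\<open>bracket_series S k\<close> is spanned by the \<open>k\<close>-fold brackets \<open>[s\<^sub>1, [s\<^sub>2, \<dots> [s\<^sub>k, v]]]\<close>.\<close>
primrec bracket_series :: "(nat \<Rightarrow> complex) set \<Rightarrow> nat \<Rightarrow> (nat \<Rightarrow> complex) set" where
  "bracket_series S 0 = lvecs m"
| "bracket_series S (Suc k) = cvec.span {br s v | s v. s \<in> S \<and> v \<in> bracket_series S k}"

lemma subspace_bracket_series: "cvec.subspace (bracket_series S k)"
  by (cases k) (auto simp: subspace_lvecs)

lemma br_in_bracket_series: "s \<in> S \<Longrightarrow> v \<in> bracket_series S k \<Longrightarrow> br s v \<in> bracket_series S (Suc k)"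
  by (auto intro: cvec.span_base)

lemma bracket_series_subsetI:
  assumes "cvec.subspace W" "\<And>s v. s \<in> S \<Longrightarrow> v \<in> bracket_series S k \<Longrightarrow> br s v \<in> W"
  shows "bracket_series S (Suc k) \<subseteq> W"
  unfolding bracket_series.simps by (rule cvec.span_minimal[OF _ assms(1)]) (use assms(2) in blast)

lemma bracket_series_decreasing: "bracket_series S (Suc k) \<subseteq> bracket_series S k"
proof (induction k)
  case 0
  show ?case by (rule bracket_series_subsetI) (simp_all add: subspace_lvecs lbracket_in_lvecs)
next
  case (Suc k)
  show ?case by (rule bracket_series_subsetI[OF subspace_bracket_series]) (use Suc br_in_bracket_series in blast)
qed

lemma bracket_series_subset_lvecs: "bracket_series S k \<subseteq> lvecs m"
  using bracket_series_decreasing by (induction k) (auto simp del: bracket_series.simps(2))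

lemma normalizing_vector_exists:
  assumes S: "cvec.subspace S" "S \<subset> lvecs m" and vanish: "bracket_series S N \<subseteq> {0}"
  obtains y where "y \<in> lvecs m" "y \<notin> S" "\<And>s. s \<in> S \<Longrightarrow> br s y \<in> S"
proof -
  have "\<exists>y\<in>lvecs m - S. \<forall>s\<in>S. br s y \<in> S"
  proof (rule ccontr)
    assume "\<not> ?thesis"
    then have escape: "\<exists>s\<in>S. br s y \<notin> S" if "y \<in> lvecs m" "y \<notin> S" for y using that by blast
    have "\<exists>y\<in>bracket_series S k. y \<notin> S" for k
    proof (induction k)
      case 0
      then show ?case using S by auto
    next
      case (Suc k)
      then obtain y where y: "y \<in> bracket_series S k" "y \<notin> S" by blast
      then obtain s where "s \<in> S" "br s y \<notin> S" using escape bracket_series_subset_lvecs by blast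
      then show ?case using br_in_bracket_series[OF _ y(1)] by blast
    qed
    then show False using vanish cvec.subspace_0[OF S(1)] by blast
  qed
  then show ?thesis using that by blast
qed

lemma bracket_series_stable:
  assumes S: "cvec.subspace S" and y: "\<And>s. s \<in> S \<Longrightarrow> br s y \<in> S"
  shows "v \<in> bracket_series S k \<Longrightarrow> br y v \<in> bracket_series S k"
proof (induction k arbitrary: v)
  case 0
  then show ?case by (simp add: lbracket_in_lvecs)
next
  case (Suc k)
  have "bracket_series S (Suc k) \<subseteq> br y -` bracket_series S (Suc k)"
  proof (rule bracket_series_subsetI)
    show "cvec.subspace (br y -` bracket_series S (Suc k))"
      by (rule module_hom.subspace_vimage[OF lin_op_module_hom[OF lin_op_lbracket] subspace_bracket_series])
    fix s v assume sv: "s \<in> S" "v \<in> bracket_series S k"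
    have "br y s \<in> S"
      unfolding br_antisym[of y s] by (intro cvec.subspace_neg[OF S] y sv)
    then show "br s v \<in> br y -` bracket_series S (Suc k)"
      unfolding vimage_eq br_derivation[of y s v]
      by (intro cvec.subspace_add[OF subspace_bracket_series] br_in_bracket_series sv Suc.IH)
  qed
  then show ?case using Suc.prems by blast
qed

lemma module_hom_funpow_br: "Modules.module_hom vscale vscale (br y ^^ r)"
proof (induction r)
  case 0
  show ?case unfolding funpow.simps id_def by (rule Modules.module.module_hom_ident[OF cvec.module_axioms])
next
  case (Suc r)
  from module_hom_compose[OF this lin_op_module_hom[OF lin_op_lbracket]] show ?case by (simp only: funpow.simps)
qed

lemma br_add_funpow:
  "br t (u + (br y ^^ r) v)
    = (br (t - vscale a y) (u + (br y ^^ r) v) + vscale a (br y u)) + (br y ^^ Suc r) (vscale a v)"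
proof -
  let ?w = "u + (br y ^^ r) v"
  have "br t ?w = br (t - vscale a y) ?w + vscale a (br y ?w)"
    by (simp only: lbracket_scale_left[symmetric] lbracket_add_left[symmetric] diff_add_cancel)
  moreover have "br y ?w = br y u + (br y ^^ Suc r) v"
    by (simp only: lbracket_add_right funpow.simps o_apply)
  ultimately show ?thesis
    by (simp only: module_hom.scale[OF module_hom_funpow_br] cvec.scale_right_distrib add.assoc)
qed

text \<open>\<open>S\<close> lowers the series by one step and \<open>y\<close> preserves it, so modulo the next step only powers of \<open>y\<close> survive in a
  word in \<open>S + y\<close>.\<close>
lemma bracket_series_extend_step:
  assumes S: "cvec.subspace S" and y: "\<And>s. s \<in> S \<Longrightarrow> br s y \<in> S"
    and S': "\<And>t. t \<in> S' \<Longrightarrow> \<exists>a. t - vscale a y \<in> S" and start: "bracket_series S' n \<subseteq> bracket_series S k"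
  shows "bracket_series S' (n + r)
    \<subseteq> {u + w | u w. u \<in> bracket_series S (Suc k) \<and> w \<in> (br y ^^ r) ` bracket_series S k}"
proof (induction r)
  case 0
  have "bracket_series S k \<subseteq> {u + w | u w. u \<in> bracket_series S (Suc k) \<and> w \<in> (br y ^^ 0) ` bracket_series S k}"
    using cvec.subspace_0[OF subspace_bracket_series[of S "Suc k"]] by force
  then show ?case using start by (simp only: add_0_right)
next
  case (Suc r)
  let ?V = "bracket_series S"
  let ?A = "\<lambda>r. {u + w | u w. u \<in> ?V (Suc k) \<and> w \<in> (br y ^^ r) ` ?V k}"
  have "bracket_series S' (Suc (n + r)) \<subseteq> ?A (Suc r)"
  proof (rule bracket_series_subsetI)
    show "cvec.subspace (?A (Suc r))"
      by (intro cvec.subspace_sums subspace_bracket_series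
          module_hom.subspace_image[OF module_hom_funpow_br subspace_bracket_series])
    fix t w assume "t \<in> S'" and "w \<in> bracket_series S' (n + r)"
    then obtain a u v where s: "t - vscale a y \<in> S" and w: "w = u + (br y ^^ r) v" and uv: "u \<in> ?V (Suc k)" "v \<in> ?V k"
      using S' Suc.IH by blast
    have "(br y ^^ r) v \<in> ?V k"
      by (induction r) (auto simp: uv(2) bracket_series_stable[OF S y])
    then have "w \<in> ?V k"
      unfolding w using uv(1) bracket_series_decreasing by (intro cvec.subspace_add[OF subspace_bracket_series]) blast+
    then have "br (t - vscale a y) w + vscale a (br y u) \<in> ?V (Suc k)"
      by (intro cvec.subspace_add[OF subspace_bracket_series] br_in_bracket_series s
          cvec.subspace_scale[OF subspace_bracket_series] bracket_series_stable[OF S y uv(1)])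
    moreover have "vscale a v \<in> ?V k"
      by (rule cvec.subspace_scale[OF subspace_bracket_series uv(2)])
    moreover have "br t w = (br (t - vscale a y) w + vscale a (br y u)) + (br y ^^ Suc r) (vscale a v)"
      unfolding w by (rule br_add_funpow)
    ultimately show "br t w \<in> ?A (Suc r)" by blast
  qed
  then show ?case by (simp only: add_Suc_right)
qed

lemma bracket_series_extend:
  assumes "cvec.subspace S" "\<And>s. s \<in> S \<Longrightarrow> br s y \<in> S" "\<And>t. t \<in> S' \<Longrightarrow> \<exists>a. t - vscale a y \<in> S"
    and nilpotent: "br y ^^ M = 0"
  shows "bracket_series S' (k * M) \<subseteq> bracket_series S k"
proof (induction k)
  case (Suc k)
  show ?case
  proof
    fix w assume "w \<in> bracket_series S' (Suc k * M)"
    then have "w \<in> bracket_series S' (k * M + M)" by (simp only: mult_Suc add.commute)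
    then obtain u v where "u \<in> bracket_series S (Suc k)" "w = u + (br y ^^ M) v"
      using bracket_series_extend_step[OF assms(1-3) Suc.IH, of M] by blast
    then show "w \<in> bracket_series S (Suc k)"
      by (simp only: nilpotent zero_fun_apply add.right_neutral)
  qed
qed simp

lemma engel:
  assumes nilpotent: "\<And>y. y \<in> lvecs m \<Longrightarrow> \<exists>M. br y ^^ M = 0"
  shows "\<exists>N. bracket_series (lvecs m) N \<subseteq> {0}"
proof (rule ccontr)
  assume not_nilpotent: "\<not> ?thesis"
  have "\<exists>B. B \<subseteq> lvecs m \<and> finite B \<and> cvec.independent B \<and> card B = n \<and> (\<exists>N. bracket_series (cvec.span B) N \<subseteq> {0})" for n
  proof (induction n)
    case 0
    have "bracket_series (cvec.span {}) (Suc 0) \<subseteq> {0}"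
      by (rule bracket_series_subsetI) (auto simp: cvec.subspace_single_0 lbracket_zero_left)
    then show ?case using cvec.independent_empty by (metis card.empty empty_subsetI finite.emptyI)
  next
    case (Suc n)
    then obtain B N where B: "B \<subseteq> lvecs m" "finite B" "cvec.independent B" "card B = n"
      and N: "bracket_series (cvec.span B) N \<subseteq> {0}" by blast
    have "cvec.span B \<noteq> lvecs m" using N not_nilpotent by metis
    then have "cvec.span B \<subset> lvecs m"
      using cvec.span_minimal[OF B(1) subspace_lvecs] by (simp only: psubsetI)
    then obtain y where y: "y \<in> lvecs m" "y \<notin> cvec.span B" "\<And>s. s \<in> cvec.span B \<Longrightarrow> br s y \<in> cvec.span B"
      by (rule normalizing_vector_exists[OF cvec.subspace_span _ N]) (rule that)
    obtain M where M: "br y ^^ M = 0" using nilpotent[OF y(1)] by blast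
    have "bracket_series (cvec.span (insert y B)) (N * M) \<subseteq> bracket_series (cvec.span B) N"
      by (rule bracket_series_extend[OF cvec.subspace_span y(3) cvec.span_breakdown_eq[THEN iffD1] M])
    then have "bracket_series (cvec.span (insert y B)) (N * M) \<subseteq> {0}" using N by (rule order.trans)
    moreover have "insert y B \<subseteq> lvecs m" "finite (insert y B)" using B y(1) by simp_all
    moreover have "card (insert y B) = Suc n" using B(2,4) y(2) cvec.span_base by (metis card_insert_disjoint)
    moreover have "cvec.independent (insert y B)" by (rule cvec.independent_insertI[OF y(2) B(3)])
    ultimately show ?case by blast
  qed
  then obtain B where B: "B \<subseteq> lvecs m" "cvec.independent B" "card B = Suc m" by blast
  with card_independent_le[OF B(2,1)] show False by simp
qed

end

locale simple_lie_algebra =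
  fixes m :: nat and c :: "nat \<Rightarrow> nat \<Rightarrow> nat \<Rightarrow> complex"
  assumes simple: "simple_lie m c"

sublocale simple_lie_algebra \<subseteq> lie_algebra m c
  using simple by unfold_locales (simp add: simple_lie_def)

context simple_lie_algebra
begin

lemma ideal_cases: "lie_ideal m c S \<Longrightarrow> S = {0} \<or> S = lvecs m"
  using simple by (simp add: simple_lie_def zero_fun_def)

lemma perfect: "bracket_series (lvecs m) (Suc 0) = lvecs m"
proof -
  let ?S = "bracket_series (lvecs m) (Suc 0)"
  have "lie_ideal m c ?S"
    unfolding lie_ideal_iff
  proof (intro conjI ballI bracket_series_subset_lvecs subspace_bracket_series)
    fix x s assume "x \<in> lvecs m" "s \<in> ?S"
    then have "s \<in> bracket_series (lvecs m) 0" using bracket_series_decreasing by blast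
    then show "br x s \<in> ?S" by (rule br_in_bracket_series[OF \<open>x \<in> lvecs m\<close>])
  qed
  then have "?S = {0} \<or> ?S = lvecs m" by (rule ideal_cases)
  moreover have "?S \<noteq> {0}"
  proof -
    obtain a b k where abk: "a < m" "b < m" "k < m" "c a b k \<noteq> 0"
      using simple unfolding simple_lie_def by blast
    then have "br (unitv a) (unitv b) \<in> ?S"
      by (intro br_in_bracket_series) (auto intro: unitv_in_lvecs)
    moreover have "br (unitv a) (unitv b) k \<noteq> 0" using abk by (simp add: lbracket_unitv)
    ultimately show ?thesis by (metis singletonD zero_fun_apply)
  qed
  ultimately show ?thesis by blast
qed

lemma kform_nonzero: "\<exists>y z. kform y z \<noteq> 0"
proof (rule ccontr)
  assume "\<not> ?thesis"
  then have kform_zero: "kform y z = 0" for y z by blast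
  have "br y ^^ Suc m = 0" if "y \<in> lvecs m" for y
  proof (rule br_nilpotent_if_kform_zero[OF kform_zero])
    show "y \<in> cvec.span {br s v | s v. s \<in> lvecs m \<and> v \<in> lvecs m}" using that perfect by simp
  qed
  then obtain N where N: "bracket_series (lvecs m) N \<subseteq> {0}" using engel by blast
  have "bracket_series (lvecs m) k = lvecs m" for k
  proof (induction k)
    case (Suc k)
    then show ?case using perfect by (simp only: bracket_series.simps)
  qed simp
  then have "lvecs m \<subseteq> {0}" using N by blast
  moreover obtain a where "a < m" using simple unfolding simple_lie_def by blast
  ultimately have "unitv a = 0" using unitv_in_lvecs by blast
  from fun_cong[OF this, of a] show False by (simp add: unitv_def)
qed

lemma kform_nondegenerate:
  assumes v: "v \<in> lvecs m" and radical: "\<And>b. b < m \<Longrightarrow> kform v (unitv b) = 0"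
  shows "v = 0"
proof -
  define R where "R = {v \<in> lvecs m. \<forall>w. kform v w = 0}"
  have "lie_ideal m c R"
    unfolding lie_ideal_iff
  proof (intro conjI ballI)
    show "cvec.subspace R"
      unfolding R_def cvec.subspace_def
      using cvec.subspace_0[OF subspace_lvecs] cvec.subspace_add[OF subspace_lvecs] cvec.subspace_scale[OF subspace_lvecs]
      by (auto simp: kform_def op_trace_def lbracket_zero_left lbracket_add_left lbracket_scale_left sum.distrib
          simp flip: sum_distrib_left)
    have "kform (br x s) w = kform s (br w x)" for x s w
      using kform_invariant[of w x s] by (simp only: kform_sym)
    then show "br x s \<in> R" if "s \<in> R" for x s
      using that by (simp add: R_def lbracket_in_lvecs)
  qed (auto simp: R_def)
  moreover have "R \<noteq> lvecs m"
  proof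
    assume "R = lvecs m"
    then have "kform (unitv a) w = 0" if "a < m" for a w
      using unitv_in_lvecs[OF that] by (auto simp: R_def)
    then have "kform y z = 0" for y z unfolding kform_expand[of y] by simp
    then show False using kform_nonzero by blast
  qed
  moreover have "v \<in> R"
  proof -
    have "kform v w = (\<Sum>a<m. w a * kform v (unitv a))" for w
      unfolding kform_sym[of v] by (rule kform_expand)
    then have "kform v w = 0" for w using radical by simp
    then show ?thesis unfolding R_def using v by blast
  qed
  ultimately show ?thesis using ideal_cases by blast
qed

lemma gform_invertible:
  assumes lam: "lam \<noteq> 0"
  shows "\<exists>M. \<forall>a<m. \<forall>b<m. (\<Sum>k<m. gform m c lam a k * M k b) = (if a = b then 1 else 0)"
proof -
  define G where "G = mat m m (\<lambda>(i,j). gform m c lam i j)"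
  have G: "G \<in> carrier_mat m m" by (simp add: G_def)
  have "det G \<noteq> 0"
  proof
    assume "det G = 0"
    then obtain v where v: "v \<in> carrier_vec m" "v \<noteq> 0\<^sub>v m" "G *\<^sub>v v = 0\<^sub>v m"
      using det_0_iff_vec_prod_zero_field[OF G] by blast
    define u where "u = (\<lambda>i. if i < m then v $ i else 0)"
    have "kform u (unitv b) = 0" if b: "b < m" for b
    proof -
      have "lam * kform u (unitv b) = (\<Sum>a<m. gform m c lam b a * v $ a)"
        unfolding kform_expand[of u] sum_distrib_left using b
        by (intro sum.cong) (auto simp: u_def gform_def kform_unitv killing_sym[of b])
      also have "\<dots> = (G *\<^sub>v v) $ b"
        using b v(1) by (simp add: G_def scalar_prod_def atLeast0LessThan)
      also have "\<dots> = 0" using v(3) b by simp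
      finally show ?thesis using lam by simp
    qed
    moreover have "u \<in> lvecs m" by (simp add: u_def lvecs_def)
    ultimately have "u = 0" using kform_nondegenerate by blast
    then have "u i = 0" for i by (simp only: zero_fun_apply)
    moreover have "v $ i = u i" if "i < m" for i using that by (simp add: u_def)
    ultimately have "v = 0\<^sub>v m" using v(1) by (intro eq_vecI) auto
    then show False using v(2) by simp
  qed
  from det_non_zero_imp_unit[OF G this, of "()"] obtain M where M: "M \<in> carrier_mat m m" "G * M = 1\<^sub>m m"
    unfolding Units_def ring_mat_simps by blast
  have "(\<Sum>k<m. gform m c lam a k * M $$ (k,b)) = (G * M) $$ (a,b)" if "a < m" "b < m" for a b
    unfolding mult_mat_index_sum[OF G M(1) that] using that by (simp add: G_def)
  then show ?thesis using M(2) by (intro exI[of _ "\<lambda>k b. M $$ (k,b)"]) simp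
qed

end

section \<open>The free algebra and the enveloping algebra\<close>

instantiation list :: (type) monoid_add
begin

definition zero_list :: "'a list" where
  "zero_list = []"

definition plus_list :: "'a list \<Rightarrow> 'a list \<Rightarrow> 'a list" where
  "plus_list = (@)"

instance
  by standard (simp_all add: zero_list_def plus_list_def)

end

type_synonym fa = "nat list \<Rightarrow>\<^sub>0 complex"

abbreviation coef :: "fa \<Rightarrow> nat list \<Rightarrow> complex" where
  "coef \<equiv> poly_mapping.lookup"

abbreviation words :: "fa \<Rightarrow> nat list set" where
  "words \<equiv> Poly_Mapping.keys"

definition word :: "nat list \<Rightarrow> fa" where
  "word w = Poly_Mapping.single w 1"

definition scl :: "complex \<Rightarrow> fa \<Rightarrow> fa" where
  "scl r x = Poly_Mapping.single 0 r * x"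

lemma coef_scl: "coef (scl r x) w = r * coef x w"
  by (simp add: scl_def Poly_Mapping.map.rep_eq when_def flip: mult_map_scale_conv_mult)

lemma coef_word: "coef (word u) w = (if w = u then 1 else 0)"
  by (simp add: word_def lookup_single when_def eq_commute)

lemma coef_add_scl: "coef (x + scl r y) = fa_add (coef x) (fa_smult r (coef y))"
  by (simp add: fun_eq_iff lookup_add coef_scl fa_add_def fa_smult_def)

interpretation fa: vector_space scl
  by unfold_locales (simp_all add: scl_def distrib_left distrib_right single_add mult_single flip: mult.assoc)

lemma fa_expand: "x = (\<Sum>w\<in>words x. scl (coef x w) (word w))"
proof (rule poly_mapping_eqI)
  fix w
  have "coef (\<Sum>w\<in>words x. scl (coef x w) (word w)) w = (\<Sum>v\<in>words x. if v = w then coef x w else 0)"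
    unfolding lookup_sum by (intro sum.cong) (auto simp: coef_scl coef_word)
  then show "coef x w = coef (\<Sum>w\<in>words x. scl (coef x w) (word w)) w"
    by (simp add: in_keys_iff)
qed

lemma scl_mult_left [simp]: "scl r x * y = scl r (x * y)"
  by (simp add: scl_def mult.assoc)

lemma scl_mult_right [simp]: "x * scl r y = scl r (x * y)"
proof -
  have "Poly_Mapping.single 0 r * scl a (word w) = scl a (word w) * Poly_Mapping.single 0 r" for a w
    by (simp add: scl_def word_def mult_single mult.commute)
  then have "Poly_Mapping.single 0 r * x = x * Poly_Mapping.single 0 r"
    by (subst (1 2) fa_expand) (simp only: sum_distrib_left sum_distrib_right)
  then show ?thesis by (simp add: scl_def flip: mult.assoc)
qed

lemma word_Nil: "word [] = 1"
  by (simp add: word_def zero_list_def flip: single_one)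

lemma word_append: "word (u @ v) = word u * word v"
  by (simp add: word_def mult_single plus_list_def)

lemma coef_mult: "coef (x * y) = fa_mult (coef x) (coef y)" for x y :: fa
proof
  fix w :: "nat list"
  let ?split = "\<lambda>k. (take k w, drop k w)"
  have "coef (x * y) w = (\<Sum>(u, v). coef x u * coef y v when w = u @ v)"
    by (simp add: times_poly_mapping.rep_eq prod_fun_unfold_prod plus_list_def)
  also have "\<dots> = (\<Sum>(u, v)\<in>?split ` {..length w}. coef x u * coef y v when w = u @ v)"
  proof (rule Sum_any.expand_superset)
    show "{p. (case p of (u, v) \<Rightarrow> coef x u * coef y v when w = u @ v) \<noteq> 0} \<subseteq> ?split ` {..length w}"
    proof clarify
      fix u v assume "(coef x u * coef y v when w = u @ v) \<noteq> 0"
      then have "w = u @ v" by (simp add: when_def split: if_splits)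
      then show "(u, v) \<in> ?split ` {..length w}" by (intro image_eqI[of _ _ "length u"]) simp_all
    qed
  qed simp
  also have "\<dots> = (\<Sum>k\<le>length w. coef x (take k w) * coef y (drop k w))"
  proof (subst sum.reindex)
    show "inj_on ?split {..length w}"
      by (rule inj_onI) (metis Pair_inject atMost_iff length_take min.absorb2)
  qed simp
  finally show "coef (x * y) w = fa_mult (coef x) (coef y) w" by (simp add: fa_mult_def)
qed

definition ug_kernel :: "nat \<Rightarrow> (nat \<Rightarrow> nat \<Rightarrow> nat \<Rightarrow> complex) \<Rightarrow> fa set" where
  "ug_kernel m c = {x. coef x \<in> ug_ideal m c}"

lemma ug_kernel_add: "x \<in> ug_kernel m c \<Longrightarrow> y \<in> ug_kernel m c \<Longrightarrow> x + y \<in> ug_kernel m c"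
  using ug_ideal.add[of "coef x" m c "coef y"] by (simp add: ug_kernel_def fa_add_def lookup_add plus_poly_mapping.rep_eq)

lemma ug_kernel_scl: "x \<in> ug_kernel m c \<Longrightarrow> scl r x \<in> ug_kernel m c"
  using ug_ideal.smult[of "coef x" m c r] by (simp add: ug_kernel_def fa_smult_def flip: coef_scl)

lemma ug_kernel_zero: "0 \<in> ug_kernel m c"
  by (simp add: ug_kernel_def zero_poly_mapping.rep_eq ug_ideal.zero)

lemma ug_kernel_sum: "(\<And>i. i \<in> A \<Longrightarrow> F i \<in> ug_kernel m c) \<Longrightarrow> (\<Sum>i\<in>A. F i) \<in> ug_kernel m c"
  by (induction A rule: infinite_finite_induct) (auto intro: ug_kernel_zero ug_kernel_add)

lemma ug_kernel_mult_words: "x \<in> ug_kernel m c \<Longrightarrow> word u * x * word v \<in> ug_kernel m c"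
proof -
  assume "x \<in> ug_kernel m c"
  moreover have "coef (word w) = fa_word w" for w by (auto simp: coef_word fa_word_def)
  ultimately show ?thesis using ug_ideal.mult by (simp add: ug_kernel_def coef_mult)
qed

lemma ug_kernel_mult: "x \<in> ug_kernel m c \<Longrightarrow> y * x * z \<in> ug_kernel m c"
proof -
  assume x: "x \<in> ug_kernel m c"
  have "(\<Sum>u\<in>words y. scl (coef y u) (word u)) * x * (\<Sum>v\<in>words z. scl (coef z v) (word v)) \<in> ug_kernel m c"
    unfolding sum_distrib_left sum_distrib_right
    by (intro ug_kernel_sum) (simp add: x ug_kernel_scl ug_kernel_mult_words)
  then show ?thesis by (simp flip: fa_expand)
qed

definition ucong :: "nat \<Rightarrow> (nat \<Rightarrow> nat \<Rightarrow> nat \<Rightarrow> complex) \<Rightarrow> fa \<Rightarrow> fa \<Rightarrow> bool" where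
  "ucong m c x y \<longleftrightarrow> x - y \<in> ug_kernel m c"

lemma U_eq_coef: "U_eq m c (coef x) (coef y) \<longleftrightarrow> ucong m c x y"
proof -
  have "coef (x - y) = fa_sub (coef x) (coef y)" by (simp add: fun_eq_iff fa_sub_def lookup_minus)
  then show ?thesis by (simp add: U_eq_def ucong_def ug_kernel_def)
qed

lemma ucong_refl [simp]: "ucong m c x x"
  by (simp add: ucong_def ug_kernel_zero)

lemma ucong_add: "ucong m c x y \<Longrightarrow> ucong m c x' y' \<Longrightarrow> ucong m c (x + x') (y + y')"
  using ug_kernel_add[of "x - y" m c "x' - y'"] by (simp add: ucong_def algebra_simps)

lemma ucong_trans [trans]: "ucong m c x y \<Longrightarrow> ucong m c y z \<Longrightarrow> ucong m c x z"
  using ug_kernel_add[of "x - y" m c "y - z"] by (simp add: ucong_def)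

lemma ucong_scl: "ucong m c x y \<Longrightarrow> ucong m c (scl r x) (scl r y)"
  using ug_kernel_scl[of "x - y" m c r] by (simp add: ucong_def fa.scale_right_diff_distrib)

lemma ucong_minus: "ucong m c x y \<Longrightarrow> ucong m c (- x) (- y)"
  using ucong_scl[of m c x y "-1"] by simp

lemma ucong_sym: "ucong m c x y \<Longrightarrow> ucong m c y x"
  using ucong_minus[of m c x y] by (simp add: ucong_def)

lemma ucong_diff: "ucong m c x y \<Longrightarrow> ucong m c x' y' \<Longrightarrow> ucong m c (x - x') (y - y')"
  using ucong_add[of m c x y "- x'" "- y'"] ucong_minus[of m c x' y'] by simp

lemma ucong_sum: "(\<And>i. i \<in> A \<Longrightarrow> ucong m c (F i) (F' i)) \<Longrightarrow> ucong m c (\<Sum>i\<in>A. F i) (\<Sum>i\<in>A. F' i)"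
  by (induction A rule: infinite_finite_induct) (auto intro: ucong_add)

lemma ucong_mult: "ucong m c x y \<Longrightarrow> ucong m c x' y' \<Longrightarrow> ucong m c (x * x') (y * y')"
proof -
  assume "ucong m c x y" "ucong m c x' y'"
  then have "1 * (x - y) * x' + y * (x' - y') * 1 \<in> ug_kernel m c"
    unfolding ucong_def by (intro ug_kernel_add ug_kernel_mult)
  then show ?thesis by (simp add: ucong_def algebra_simps)
qed

lemma ucong_mult_left: "ucong m c x y \<Longrightarrow> ucong m c (z * x) (z * y)"
  by (intro ucong_mult ucong_refl)

lemma ucong_mult_right: "ucong m c x y \<Longrightarrow> ucong m c (x * z) (y * z)"
  by (intro ucong_mult ucong_refl)

lemma ucong_commutator:
  assumes "a < m" "b < m"
  shows "ucong m c (word [a] * word [b] - word [b] * word [a]) (\<Sum>k<m. scl (c a b k) (word [k]))"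
proof -
  have "coef (word [a] * word [b] - word [b] * word [a] - (\<Sum>k<m. scl (c a b k) (word [k])))
      = (\<lambda>w. fa_word [a,b] w - fa_word [b,a] w - (\<Sum>k<m. c a b k * fa_word [k] w))"
    unfolding word_append[symmetric]
    by (rule ext) (simp add: lookup_minus lookup_sum coef_scl coef_word fa_word_def)
  then show ?thesis unfolding ucong_def ug_kernel_def using ug_ideal.gen[OF assms] by simp
qed

lemma eq_ucong_trans [trans]: "x = y \<Longrightarrow> ucong m c y z \<Longrightarrow> ucong m c x z"
  and ucong_eq_trans [trans]: "ucong m c x y \<Longrightarrow> y = z \<Longrightarrow> ucong m c x z"
  by simp_all

lemmas ucong_intros = ucong_sum ucong_scl ucong_add ucong_diff ucong_mult ucong_refl

section \<open>The Casimir element\<close>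

locale metrized_simple_lie = simple_lie_algebra +
  fixes lam :: complex
  assumes lam_nonzero: "lam \<noteq> 0"
begin

abbreviation G :: "nat \<Rightarrow> nat \<Rightarrow> complex" where "G \<equiv> gform m c lam"
abbreviation g :: "nat \<Rightarrow> nat \<Rightarrow> complex" where "g \<equiv> ginv m c lam"
abbreviation t :: "nat \<Rightarrow> nat \<Rightarrow> nat \<Rightarrow> complex" where "t \<equiv> trip m c lam"
abbreviation E :: "nat \<Rightarrow> fa" where "E a \<equiv> word [a]"
abbreviation U_cong :: "fa \<Rightarrow> fa \<Rightarrow> bool" (infix "\<approx>" 50) where "x \<approx> y \<equiv> ucong m c x y"

definition form :: "(nat \<Rightarrow> complex) \<Rightarrow> (nat \<Rightarrow> complex) \<Rightarrow> complex" where
  "form x y = lam * kform x y"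

lemma form_sym: "form x y = form y x"
  unfolding form_def by (subst kform_sym) (rule refl)

lemma form_invariant: "form (br x y) z = form x (br y z)"
  unfolding form_def kform_invariant ..

lemma form_expand: "form v w = (\<Sum>a<m. v a * form (unitv a) w)"
  unfolding form_def by (subst kform_expand) (simp add: sum_distrib_left mult_ac)

lemma form_module_hom: "Modules.module_hom vscale (*) (\<lambda>v. form v w)"
proof -
  have "form (u + v) w = form u w + form v w" "form (vscale r v) w = r * form v w" for u v r
    by (subst (1 2 3) form_expand, simp add: distrib_right sum.distrib)
      (subst (1 2) form_expand, simp add: sum_distrib_left mult_ac)
  then show ?thesis
    using cvec.module_axioms by (simp add: module_hom_iff Modules.module_def algebra_simps)
qed

lemmas form_diff_left = module_hom.diff[OF form_module_hom]
  and form_scale_left = module_hom.scale[OF form_module_hom]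
  and form_sum_left = module_hom.sum[OF form_module_hom]
  and form_neg_left = module_hom.neg[OF form_module_hom]

lemma form_neg_right: "form v (- w) = - form v w"
  unfolding form_sym[of v] by (rule form_neg_left)

lemma form_nondegenerate:
  assumes "v \<in> lvecs m" "\<And>b. b < m \<Longrightarrow> form v (unitv b) = 0"
  shows "v = 0"
  using assms lam_nonzero by (intro kform_nondegenerate) (simp_all add: form_def)

lemma form_eqI:
  assumes "u \<in> lvecs m" "v \<in> lvecs m" "\<And>b. b < m \<Longrightarrow> form u (unitv b) = form v (unitv b)"
  shows "u = v"
proof -
  have "u - v = 0"
    using assms(3) by (intro form_nondegenerate cvec.subspace_diff[OF subspace_lvecs assms(1,2)])
      (simp only: form_diff_left diff_self)
  then show ?thesis by (simp only: right_minus_eq)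
qed

definition dual :: "nat \<Rightarrow> nat \<Rightarrow> complex" where
  "dual a = (\<lambda>j. if j < m then g j a else 0)"

lemma dual_in_lvecs: "dual a \<in> lvecs m"
  by (simp add: dual_def lvecs_def)

lemma dual_coords: "dual a = (\<Sum>b<m. vscale (g b a) (unitv b))"
  using lvecs_expand[OF dual_in_lvecs, of a] by (simp add: dual_def)

lemma form_dual_unitv:
  assumes "a < m" "b < m"
  shows "form (dual b) (unitv a) = (if a = b then 1 else 0)"
proof -
  have "form (dual b) (unitv a) = (\<Sum>k<m. G a k * g k b)"
    unfolding form_expand[of "dual b"] using assms
    by (intro sum.cong) (auto simp: dual_def form_def kform_unitv gform_def killing_sym[of a])
  also have "\<dots> = (if a = b then 1 else 0)"
    using someI_ex[OF gform_invertible[OF lam_nonzero]] assms unfolding ginv_def by blast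
  finally show ?thesis .
qed

lemma form_dual:
  assumes "a < m"
  shows "form v (dual a) = v a"
proof -
  have "form v (dual a) = (\<Sum>k<m. if k = a then v a else 0)"
    unfolding form_expand[of v] using assms
    by (intro sum.cong) (auto simp: form_sym[of "unitv _" "dual a"] form_dual_unitv)
  then show ?thesis using assms by simp
qed

lemma dual_expand:
  assumes "v \<in> lvecs m"
  shows "v = (\<Sum>a<m. vscale (form v (unitv a)) (dual a))"
proof (rule form_eqI[OF assms])
  show "(\<Sum>a<m. vscale (form v (unitv a)) (dual a)) \<in> lvecs m"
    by (intro cvec.subspace_sum cvec.subspace_scale subspace_lvecs dual_in_lvecs)
  show "form v (unitv b) = form (\<Sum>a<m. vscale (form v (unitv a)) (dual a)) (unitv b)" if "b < m" for b
    using that by (simp add: form_sum_left form_scale_left form_dual_unitv if_distrib[of "(*) _"] cong: if_cong)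
qed

lemma g_sym:
  assumes "a < m" "b < m"
  shows "g a b = g b a"
  using assms form_dual[of a "dual b"] form_dual[of b "dual a"] form_sym[of "dual a" "dual b"]
  by (simp add: dual_def)

text \<open>The tensor \<open>\<Sum> e\<^sub>a \<otimes> e\<^sub>a\<^sup>*\<close> is symmetric and invariant; \<open>F u * X * F' v\<close> stands for an arbitrary bilinear
  function of \<open>u\<close> and \<open>v\<close>.\<close>
context
  fixes F F' :: "(nat \<Rightarrow> complex) \<Rightarrow> fa" and X :: fa
  assumes F: "Modules.module_hom vscale scl F" and F': "Modules.module_hom vscale scl F'"
begin

lemma casimir_tensor_sym: "(\<Sum>a<m. F (unitv a) * X * F' (dual a)) = (\<Sum>a<m. F (dual a) * X * F' (unitv a))"
proof -
  have "(\<Sum>a<m. F (unitv a) * X * F' (dual a)) = (\<Sum>a<m. \<Sum>b<m. scl (g b a) (F (unitv a) * X * F' (unitv b)))"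
    unfolding dual_coords module_hom.sum[OF F'] module_hom.scale[OF F'] by (simp add: sum_distrib_left)
  also have "\<dots> = (\<Sum>b<m. \<Sum>a<m. scl (g a b) (F (unitv a) * X * F' (unitv b)))"
    by (subst sum.swap) (intro sum.cong refl, simp add: g_sym)
  also have "\<dots> = (\<Sum>a<m. F (dual a) * X * F' (unitv a))"
    unfolding dual_coords module_hom.sum[OF F] module_hom.scale[OF F] by (simp add: sum_distrib_right)
  finally show ?thesis .
qed

lemma casimir_tensor_invariant:
  "(\<Sum>a<m. F (br x (unitv a)) * X * F' (dual a)) + (\<Sum>a<m. F (unitv a) * X * F' (br x (dual a))) = 0"
proof -
  have "br x (dual a) = (\<Sum>b<m. vscale (- br x (unitv b) a) (dual b))" if "a < m" for a
  proof -
    have "form (br x (dual a)) (unitv b) = - br x (unitv b) a" for b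
      unfolding br_antisym[of x "dual a"] form_neg_left form_invariant form_sym[of "dual a"] form_dual[OF that] ..
    then show ?thesis using dual_expand[OF lbracket_in_lvecs[of m c x "dual a"]] by (simp only:)
  qed
  then have "(\<Sum>a<m. F (unitv a) * X * F' (br x (dual a)))
      = (\<Sum>a<m. \<Sum>b<m. - scl (br x (unitv b) a) (F (unitv a) * X * F' (dual b)))"
    by (simp add: module_hom.sum[OF F'] module_hom.scale[OF F'] module_hom.neg[OF F'] sum_distrib_left)
  also have "\<dots> = - (\<Sum>b<m. \<Sum>a<m. scl (br x (unitv b) a) (F (unitv a) * X * F' (dual b)))"
    by (subst sum.swap) (simp add: sum_negf)
  also have "\<dots> = - (\<Sum>b<m. F (br x (unitv b)) * X * F' (dual b))"
  proof -
    have "F (br x (unitv b)) = (\<Sum>a<m. scl (br x (unitv b) a) (F (unitv a)))" for b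
      by (subst lvecs_expand[OF lbracket_in_lvecs]) (simp add: module_hom.sum[OF F] module_hom.scale[OF F])
    then show ?thesis by (simp add: sum_distrib_right)
  qed
  finally show ?thesis by simp
qed

end

lemma adjoint_casimir:
  assumes "x \<in> lvecs m"
  shows "(\<Sum>a<m. br (unitv a) (br (dual a) x)) = vscale (1 / lam) x"
proof (rule form_eqI)
  show "(\<Sum>a<m. br (unitv a) (br (dual a) x)) \<in> lvecs m" "vscale (1 / lam) x \<in> lvecs m"
    using assms by (auto intro!: cvec.subspace_sum cvec.subspace_scale subspace_lvecs lbracket_in_lvecs)
  fix b
  let ?y = "unitv b"
  have "form (br (unitv a) (br (dual a) x)) ?y = br x (br ?y (unitv a)) a" if "a < m" for a
  proof -
    have "form (br (unitv a) (br (dual a) x)) ?y = form (br (dual a) x) (br ?y (unitv a))"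
      unfolding br_antisym[of "unitv a" "br (dual a) x"] form_neg_left form_invariant[of "br (dual a) x"]
        br_antisym[of "unitv a" ?y] form_neg_right by (rule minus_minus)
    also have "\<dots> = br x (br ?y (unitv a)) a"
      by (simp only: form_invariant[of "dual a"] form_sym[of "dual a"] form_dual[OF that])
    finally show ?thesis .
  qed
  then have "form (\<Sum>a<m. br (unitv a) (br (dual a) x)) ?y = kform x ?y"
    by (simp add: form_sum_left kform_def op_trace_def)
  also have "\<dots> = form (vscale (1 / lam) x) ?y"
    unfolding form_scale_left using lam_nonzero by (simp add: form_def)
  finally show "form (\<Sum>a<m. br (unitv a) (br (dual a) x)) ?y = form (vscale (1 / lam) x) ?y" .
qed

definition emb :: "(nat \<Rightarrow> complex) \<Rightarrow> fa" where
  "emb v = (\<Sum>k<m. scl (v k) (E k))"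

lemma emb_unitv: "a < m \<Longrightarrow> emb (unitv a) = E a"
proof -
  have "emb (unitv a) = (\<Sum>k<m. if k = a then E k else 0)"
    unfolding emb_def by (intro sum.cong) (auto simp: unitv_def)
  then show "a < m \<Longrightarrow> emb (unitv a) = E a" by simp
qed

lemma module_hom_emb: "Modules.module_hom vscale scl emb"
proof -
  have "emb (u + v) = emb u + emb v" "emb (vscale r v) = scl r (emb v)" for u v r
    by (simp_all add: emb_def fa.scale_left_distrib sum.distrib fa.scale_sum_right)
  then show ?thesis
    using cvec.module_axioms fa.module_axioms by (simp add: module_hom_iff)
qed

lemma module_hom_emb_br: "Modules.module_hom vscale scl (\<lambda>u. emb (br x u))"
  using module_hom_compose[OF lin_op_module_hom[OF lin_op_lbracket] module_hom_emb] by (simp add: o_def)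

lemma emb_br: "emb (br x y) \<approx> emb x * emb y - emb y * emb x"
proof -
  have "emb (br x y) = (\<Sum>k<m. \<Sum>a<m. \<Sum>b<m. scl (x a * y b * c a b k) (E k))"
    by (simp add: emb_def lbracket_def fa.scale_sum_left)
  also have "\<dots> = (\<Sum>a<m. \<Sum>k<m. \<Sum>b<m. scl (x a * y b * c a b k) (E k))" by (rule sum.swap)
  also have "\<dots> = (\<Sum>a<m. \<Sum>b<m. \<Sum>k<m. scl (x a * y b * c a b k) (E k))" by (intro sum.cong refl sum.swap)
  also have "\<dots> = (\<Sum>a<m. \<Sum>b<m. scl (x a * y b) (\<Sum>k<m. scl (c a b k) (E k)))"
    by (simp add: fa.scale_sum_right)
  also have "\<dots> \<approx> (\<Sum>a<m. \<Sum>b<m. scl (x a * y b) (E a * E b - E b * E a))"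
    by (intro ucong_sum ucong_scl ucong_sym[OF ucong_commutator]) auto
  also have "\<dots> = emb x * emb y - emb y * emb x"
  proof -
    have "emb x * emb y = (\<Sum>a<m. \<Sum>b<m. scl (x a * y b) (E a * E b))"
      by (simp add: emb_def sum_product mult.commute)
    moreover have "emb y * emb x = (\<Sum>b<m. \<Sum>a<m. scl (x a * y b) (E b * E a))"
      unfolding emb_def sum_product by (intro sum.cong refl) (simp add: mult.commute)
    then have "emb y * emb x = (\<Sum>a<m. \<Sum>b<m. scl (x a * y b) (E b * E a))"
      by (rule trans[OF _ sum.swap])
    ultimately show ?thesis by (simp only: fa.scale_right_diff_distrib sum_subtractf)
  qed
  finally show ?thesis .
qed

lemma emb_br_unitv: "a < m \<Longrightarrow> emb (br (unitv a) x) \<approx> E a * emb x - emb x * E a"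
  using emb_br[of "unitv a" x] by (simp only: emb_unitv)

definition Phi :: "fa \<Rightarrow> fa" where
  "Phi X = (\<Sum>a<m. E a * X * emb (dual a))"

definition Cas :: fa where
  "Cas = Phi 1"

definition Cas_shift :: fa where
  "Cas_shift = Cas - scl (1 / (2 * lam)) 1"

lemma Phi_coords: "Phi X = (\<Sum>a<m. \<Sum>b<m. scl (g b a) (E a * X * E b))"
  by (simp add: Phi_def emb_def dual_def sum_distrib_left)

lemma module_hom_Phi: "Modules.module_hom scl scl Phi"
  using fa.module_axioms
  by (simp add: module_hom_iff Phi_def distrib_left distrib_right sum.distrib fa.scale_sum_right)

lemma Phi_cong: "X \<approx> Y \<Longrightarrow> Phi X \<approx> Phi Y"
  unfolding Phi_def by (intro ucong_intros)

lemma E_Phi_commutator: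
  assumes "d < m"
  shows "E d * Phi X - Phi X * E d \<approx> Phi (E d * X - X * E d)"
proof -
  let ?x = "unitv d"
  have "E d * Phi X - Phi X * E d = (\<Sum>a<m. (E d * E a - E a * E d) * X * emb (dual a)
      + E a * (E d * X - X * E d) * emb (dual a) + E a * X * (E d * emb (dual a) - emb (dual a) * E d))"
    unfolding Phi_def sum_distrib_left sum_distrib_right sum_subtractf[symmetric]
    by (intro sum.cong refl) (simp add: algebra_simps)
  also have "\<dots> \<approx> (\<Sum>a<m. emb (br ?x (unitv a)) * X * emb (dual a)
      + E a * (E d * X - X * E d) * emb (dual a) + E a * X * emb (br ?x (dual a)))"
  proof (intro ucong_sum ucong_add ucong_mult ucong_refl)
    fix a assume "a \<in> {..<m}"
    then show "E d * E a - E a * E d \<approx> emb (br ?x (unitv a))"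
      using ucong_sym[OF emb_br_unitv[OF assms, of "unitv a"]] by (simp add: emb_unitv)
    show "E d * emb (dual a) - emb (dual a) * E d \<approx> emb (br ?x (dual a))"
      by (rule ucong_sym[OF emb_br_unitv[OF assms]])
  qed
  also have "\<dots> = Phi (E d * X - X * E d) + ((\<Sum>a<m. emb (br ?x (unitv a)) * X * emb (dual a))
      + (\<Sum>a<m. emb (unitv a) * X * emb (br ?x (dual a))))"
    unfolding Phi_def sum.distrib[symmetric] by (intro sum.cong refl) (simp add: emb_unitv add_ac)
  also have "\<dots> = Phi (E d * X - X * E d)"
    unfolding casimir_tensor_invariant[OF module_hom_emb module_hom_emb] by simp
  finally show ?thesis .
qed

definition central :: "fa \<Rightarrow> bool" where
  "central z \<longleftrightarrow> (\<forall>a<m. E a * z \<approx> z * E a)"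

lemma central_Cas: "central Cas"
  unfolding central_def
proof (intro allI impI)
  fix a assume "a < m"
  from E_Phi_commutator[OF this, of 1] have "E a * Cas - Cas * E a \<approx> Phi 0"
    by (simp add: Cas_def)
  then have "E a * Cas - Cas * E a \<approx> 0" by (simp add: Phi_def)
  then show "E a * Cas \<approx> Cas * E a" by (simp add: ucong_def)
qed

lemma central_Cas_shift: "central Cas_shift"
  unfolding central_def
proof (intro allI impI)
  fix a assume "a < m"
  then have "E a * Cas \<approx> Cas * E a" using central_Cas by (simp add: central_def)
  from ucong_diff[OF this ucong_refl] have "E a * Cas - scl (1 / (2 * lam)) (E a) \<approx> Cas * E a - scl (1 / (2 * lam)) (E a)" .
  then show "E a * Cas_shift \<approx> Cas_shift * E a"
    by (simp add: Cas_shift_def left_diff_distrib right_diff_distrib)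
qed

lemma central_mult:
  assumes "central y" "central z"
  shows "central (y * z)"
  unfolding central_def
proof (intro allI impI)
  fix a assume a: "a < m"
  have "E a * (y * z) \<approx> (y * E a) * z"
    unfolding mult.assoc[symmetric] using assms(1) a by (intro ucong_mult_right) (simp add: central_def)
  also have "\<dots> \<approx> y * (z * E a)"
    unfolding mult.assoc using assms(2) a by (intro ucong_mult_left) (simp add: central_def)
  finally show "E a * (y * z) \<approx> y * z * E a" by (simp only: mult.assoc)
qed

lemma central_power: "central z \<Longrightarrow> central (z ^ k)"
  by (induction k) (simp add: central_def, simp add: central_mult)

lemma central_commute:
  assumes z: "central z" and x: "words x \<subseteq> lists {..<m}"
  shows "x * z \<approx> z * x"
proof -
  have word: "word w * z \<approx> z * word w" if "w \<in> lists {..<m}" for w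
    using that
  proof (induction w)
    case (Cons a w)
    have "word (a # w) * z = E a * (word w * z)" using word_append[of "[a]" w] by (simp add: mult.assoc)
    also have "\<dots> \<approx> E a * (z * word w)" using Cons by (intro ucong_mult_left) auto
    also have "\<dots> = (E a * z) * word w" by (simp add: mult.assoc)
    also have "\<dots> \<approx> (z * E a) * word w"
      using z Cons.hyps by (intro ucong_mult_right) (simp add: central_def)
    also have "\<dots> = z * word (a # w)" using word_append[of "[a]" w] by (simp add: mult.assoc)
    finally show ?case .
  qed (simp add: word_Nil)
  have "(\<Sum>w\<in>words x. scl (coef x w) (word w)) * z \<approx> z * (\<Sum>w\<in>words x. scl (coef x w) (word w))"
    unfolding sum_distrib_left sum_distrib_right scl_mult_left scl_mult_right
    using x by (intro ucong_sum ucong_scl word) auto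
  then show ?thesis by (simp flip: fa_expand)
qed

lemma Phi_central:
  assumes "central z"
  shows "Phi (z * X) \<approx> z * Phi X"
proof -
  have "Phi (z * X) = (\<Sum>a<m. (E a * z) * X * emb (dual a))" by (simp add: Phi_def mult.assoc)
  also have "\<dots> \<approx> (\<Sum>a<m. (z * E a) * X * emb (dual a))"
    using assms by (intro ucong_sum ucong_mult_right) (simp add: central_def)
  also have "\<dots> = z * Phi X" by (simp add: Phi_def sum_distrib_left mult.assoc)
  finally show ?thesis .
qed

lemma Phi_emb:
  assumes "x \<in> lvecs m"
  shows "Phi (emb x) \<approx> Cas_shift * emb x"
proof -
  define N where "N = (\<Sum>a<m. E a * emb (br x (dual a)))"
  have "Phi (emb x) = (\<Sum>a<m. E a * emb (dual a) * emb x + E a * (emb x * emb (dual a) - emb (dual a) * emb x))"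
    unfolding Phi_def by (intro sum.cong refl) (simp add: algebra_simps)
  also have "\<dots> \<approx> (\<Sum>a<m. E a * emb (dual a) * emb x + E a * emb (br x (dual a)))"
    by (intro ucong_sum ucong_add ucong_mult ucong_refl ucong_sym[OF emb_br])
  also have "\<dots> = Cas * emb x + N"
    by (simp add: N_def Cas_def Phi_def sum.distrib sum_distrib_right)
  finally have expand: "Phi (emb x) \<approx> Cas * emb x + N" .
  have "N + (\<Sum>a<m. emb (br x (dual a)) * emb (unitv a)) = 0"
    using casimir_tensor_invariant[OF module_hom_emb module_hom_emb, of x 1]
      casimir_tensor_sym[OF module_hom_emb_br module_hom_emb, of x 1]
    by (simp add: N_def emb_unitv add.commute)
  then have "N = - (\<Sum>a<m. emb (br x (dual a)) * E a)"
    by (simp add: emb_unitv eq_neg_iff_add_eq_0)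
  then have "scl 2 N = (\<Sum>a<m. E a * emb (br x (dual a)) - emb (br x (dual a)) * E a)"
    using fa.scale_left_distrib[of 1 1 N] by (simp add: sum_subtractf flip: N_def)
  also have "\<dots> \<approx> (\<Sum>a<m. emb (br (unitv a) (br x (dual a))))"
    by (intro ucong_sum ucong_sym[OF emb_br_unitv]) simp
  also have "\<dots> = - emb (\<Sum>a<m. br (unitv a) (br (dual a) x))"
    unfolding br_antisym[of x] lbracket_neg_right
    by (simp add: module_hom.neg[OF module_hom_emb] module_hom.sum[OF module_hom_emb] sum_negf)
  also have "\<dots> = scl (- 1 / lam) (emb x)"
    unfolding adjoint_casimir[OF assms] module_hom.scale[OF module_hom_emb] by simp
  finally have "scl (1 / 2) (scl 2 N) \<approx> scl (1 / 2) (scl (- 1 / lam) (emb x))" by (rule ucong_scl)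
  then have "N \<approx> - scl (1 / (2 * lam)) (emb x)" by simp
  then have "Cas * emb x + N \<approx> Cas * emb x + - scl (1 / (2 * lam)) (emb x)" by (intro ucong_intros)
  with expand have "Phi (emb x) \<approx> Cas * emb x + - scl (1 / (2 * lam)) (emb x)" by (rule ucong_trans)
  then show ?thesis by (simp add: Cas_shift_def left_diff_distrib)
qed

text \<open>The four positions of the chord after STU at both ends of a rung; \<open>Phi_emb\<close> evaluates the two of them in which it
  crosses a single leg.\<close>
lemma rung_relation:
  assumes "x \<in> lvecs m" "y \<in> lvecs m"
  shows "(\<Sum>a<m. emb (br (unitv a) x) * emb (br y (dual a)))
    \<approx> Phi (emb x * emb y) + scl (1 / lam) (emb x * emb y) - Cas * (emb x * emb y)"
proof -
  let ?X = "emb x" and ?Y = "emb y"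
  have "(\<Sum>a<m. emb (br (unitv a) x) * emb (br y (dual a)))
     \<approx> (\<Sum>a<m. (E a * ?X - ?X * E a) * (?Y * emb (dual a) - emb (dual a) * ?Y))"
    by (intro ucong_sum ucong_mult emb_br emb_br_unitv) simp
  also have "\<dots> = Phi (?X * ?Y) - Phi ?X * ?Y - ?X * Phi ?Y + ?X * Cas * ?Y"
    by (simp add: Phi_def Cas_def sum_distrib_left sum_distrib_right algebra_simps sum.distrib sum_subtractf)
  also have "\<dots> \<approx> Phi (?X * ?Y) - (Cas_shift * ?X) * ?Y - ?X * (Cas_shift * ?Y) + ?X * Cas * ?Y"
    by (intro ucong_intros Phi_emb assms)
  also have "\<dots> = Phi (?X * ?Y) + scl (1 / lam) (?X * ?Y) - Cas * (?X * ?Y)"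
  proof -
    have "scl (1 / lam) Z = scl (1 / (2 * lam)) Z + scl (1 / (2 * lam)) Z" for Z
      unfolding fa.scale_left_distrib[symmetric] by simp
    then show ?thesis by (simp add: Cas_shift_def algebra_simps)
  qed
  finally show ?thesis .
qed

lemma module_hom_funpow_Phi: "Modules.module_hom scl scl (Phi ^^ n)"
proof (induction n)
  case 0
  show ?case unfolding funpow.simps id_def by (rule Modules.module.module_hom_ident[OF fa.module_axioms])
next
  case (Suc n)
  from module_hom_compose[OF this module_hom_Phi] show ?case by (simp only: funpow.simps)
qed

lemmas funpow_Phi_add = module_hom.add[OF module_hom_funpow_Phi]
  and funpow_Phi_diff = module_hom.diff[OF module_hom_funpow_Phi]
  and funpow_Phi_scl = module_hom.scale[OF module_hom_funpow_Phi]
  and funpow_Phi_sum = module_hom.sum[OF module_hom_funpow_Phi]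

lemma funpow_Phi_cong: "X \<approx> Y \<Longrightarrow> (Phi ^^ n) X \<approx> (Phi ^^ n) Y"
  by (induction n) (auto intro: Phi_cong)

lemma funpow_Phi_central: "central z \<Longrightarrow> (Phi ^^ n) (z * X) \<approx> z * (Phi ^^ n) X"
proof (induction n)
  case (Suc n)
  from ucong_trans[OF Phi_cong[OF Suc.IH] Phi_central] Suc.prems show ?case by simp
qed simp

lemma funpow_Phi_eigenvector:
  assumes z: "central z" and X: "Phi X \<approx> z * X"
  shows "(Phi ^^ n) X \<approx> z ^ n * X"
proof (induction n)
  case (Suc n)
  have "(Phi ^^ Suc n) X \<approx> Phi (z ^ n * X)" using Phi_cong[OF Suc] by simp
  also have "\<dots> \<approx> z ^ n * Phi X" by (rule Phi_central[OF central_power[OF z]])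
  also have "\<dots> \<approx> z ^ n * (z * X)" by (rule ucong_mult_left[OF X])
  also have "\<dots> = z ^ Suc n * X" by (simp only: power_Suc2 mult.assoc)
  finally show ?case .
qed simp

lemma funpow_Phi_one: "(Phi ^^ n) 1 \<approx> Cas ^ n"
  using funpow_Phi_eigenvector[OF central_Cas, of 1] by (simp add: Cas_def)

lemma funpow_Phi_emb: "x \<in> lvecs m \<Longrightarrow> (Phi ^^ n) (emb x) \<approx> Cas_shift ^ n * emb x"
  by (rule funpow_Phi_eigenvector[OF central_Cas_shift Phi_emb])

end

section \<open>Sums over splittings\<close>

text \<open>\<open>x\<close> joins the block \<open>B\<close>, or forms a block of its own if \<open>B = {}\<close>.\<close>
definition add_to_block :: "'a \<Rightarrow> 'a set \<Rightarrow> 'a set set \<Rightarrow> 'a set set" where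
  "add_to_block x B P = insert (insert x B) (P - {B})"

lemma partition_on_disjoint: "partition_on A P \<Longrightarrow> B \<in> P \<Longrightarrow> C \<in> P \<Longrightarrow> B \<noteq> C \<Longrightarrow> B \<inter> C = {}"
  by (auto simp: partition_on_def disjoint_def)

lemma partition_on_subset: "partition_on A P \<Longrightarrow> B \<in> P \<Longrightarrow> B \<subseteq> A"
  by (auto simp: partition_on_def)

lemma partition_on_minus_block:
  assumes "partition_on A P" "B \<in> insert {} P"
  shows "partition_on (A - B) (P - {B})"
proof (cases "B \<in> P")
  case True
  have "disjnt B (\<Union>(P - {B}))"
    using partition_on_disjoint[OF assms(1) True] by (auto simp: disjnt_def)
  then show ?thesis using assms(1) partition_on_insert[of B "P - {B}" A] True by (simp add: insert_absorb)
next
  case False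
  then show ?thesis using assms by simp
qed

lemma partition_on_add_to_block:
  assumes P: "partition_on A P" and x: "x \<notin> A" and B: "B \<in> insert {} P"
  shows "partition_on (insert x A) (add_to_block x B P)"
proof -
  have "partition_on (A - B) (P - {B})" by (rule partition_on_minus_block[OF P B])
  moreover have "\<Union>(P - {B}) = A - B" using partition_onD1[OF calculation] by simp
  moreover have "B \<subseteq> A" using B partition_on_subset[OF P] by auto
  moreover have "insert x A - insert x B = A - B" using x by auto
  ultimately show ?thesis
    using x unfolding add_to_block_def by (subst partition_on_insert) (auto simp: disjnt_iff)
qed

lemma partition_on_doubleton:
  assumes "a \<noteq> b"
  shows "partition_on {a,b} T \<longleftrightarrow> T = {{a,b}} \<or> T = {{a},{b}}"
proof
  assume T: "partition_on {a,b} T"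
  obtain A B where AB: "A \<in> T" "a \<in> A" "B \<in> T" "b \<in> B" using partition_onD1[OF T] by blast
  have sub: "C \<subseteq> {a,b}" "C \<noteq> {}" if "C \<in> T" for C using partition_onD1[OF T] partition_onD3[OF T] that by blast+
  have eq: "C = A \<or> C = B" if "C \<in> T" for C
    using sub[OF that] partition_on_disjoint[OF T that AB(1)] partition_on_disjoint[OF T that AB(3)] AB by blast
  show "T = {{a,b}} \<or> T = {{a},{b}}"
  proof (cases "A = B")
    case True
    then have "A = {a,b}" using sub(1)[OF AB(1)] AB by blast
    then show ?thesis using True eq AB by blast
  next
    case False
    then have "A \<inter> B = {}" by (rule partition_on_disjoint[OF T AB(1,3)])
    then have "A = {a}" "B = {b}" using sub(1)[OF AB(1)] sub(1)[OF AB(3)] AB by blast+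
    then show ?thesis using eq AB by blast
  qed
next
  assume "T = {{a,b}} \<or> T = {{a},{b}}"
  then show "partition_on {a,b} T" using assms by (auto simp: partition_on_def disjoint_def)
qed

lemma partition_on_singleton: "partition_on {a} T \<longleftrightarrow> T = {{a}}"
proof
  assume "partition_on {a} T"
  then have "\<Union>T = {a}" "{} \<notin> T" by (auto dest: partition_onD1 partition_onD3)
  then have "C = {a}" if "C \<in> T" for C using that subset_singletonD[of C a] by blast
  moreover have "T \<noteq> {}" using \<open>\<Union>T = {a}\<close> by auto
  ultimately show "T = {{a}}" by blast
qed (simp add: partition_on_def)

definition block :: "'a \<Rightarrow> 'a set set \<Rightarrow> 'a set" where
  "block x P = \<Union>{C \<in> P. x \<in> C}"

lemma block_eq: "partition_on A P \<Longrightarrow> B \<in> P \<Longrightarrow> x \<in> B \<Longrightarrow> block x P = B"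
  unfolding block_def using partition_on_disjoint[of A P B] by blast

definition remove_from_block :: "'a \<Rightarrow> 'a set set \<Rightarrow> 'a set set" where
  "remove_from_block x P = (P - {block x P}) \<union> ({block x P - {x}} - {{}})"

lemma remove_add_to_block:
  assumes P: "partition_on A P" and x: "x \<notin> A" and B: "B \<in> insert {} P"
  shows "remove_from_block x (add_to_block x B P) = P" "block x (add_to_block x B P) - {x} = B"
proof -
  have x_new: "x \<notin> C" if "C \<in> insert {} P" for C using partition_on_subset[OF P] x that by auto
  have "block x (add_to_block x B P) = insert x B"
    by (rule block_eq[OF partition_on_add_to_block[OF assms]]) (simp_all add: add_to_block_def)
  then show "block x (add_to_block x B P) - {x} = B" using x_new[OF B] by auto
  then have "remove_from_block x (add_to_block x B P) = (P - {B}) \<union> ({B} - {{}})"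
    using x_new \<open>block x (add_to_block x B P) = insert x B\<close>
    unfolding remove_from_block_def add_to_block_def by auto
  then show "remove_from_block x (add_to_block x B P) = P"
    using B partition_onD3[OF P] by auto
qed

lemma add_remove_from_block:
  assumes P: "partition_on (insert x A) P" and x: "x \<notin> A"
  shows "partition_on A (remove_from_block x P)" "block x P - {x} \<in> insert {} (remove_from_block x P)"
    "add_to_block x (block x P - {x}) (remove_from_block x P) = P"
proof -
  obtain C where C: "C \<in> P" "x \<in> C" using partition_onD1[OF P] by auto
  note block = block_eq[OF P C]
  define B where "B = C - {x}"
  have "partition_on (insert x A - C) (P - {C})" by (rule partition_on_minus_block[OF P insertI2[OF C(1)]])
  moreover have "insert x A - C = A - B" using C x by (auto simp: B_def)
  ultimately have rest: "partition_on (A - B) (P - {C})" by simp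
  have "B \<subseteq> A" using C partition_on_subset[OF P] by (auto simp: B_def)
  have remove: "remove_from_block x P = (P - {C}) \<union> ({B} - {{}})"
    by (simp add: remove_from_block_def block B_def)
  show "partition_on A (remove_from_block x P)"
  proof (cases "B = {}")
    case True
    then show ?thesis using rest by (simp add: remove)
  next
    case False
    have "disjnt B (\<Union>(P - {C}))" using partition_onD1[OF rest] by (auto simp: disjnt_iff)
    then have "partition_on A (insert B (P - {C}))"
      using rest \<open>B \<subseteq> A\<close> False by (simp add: partition_on_insert)
    then show ?thesis using False by (simp add: remove)
  qed
  show "block x P - {x} \<in> insert {} (remove_from_block x P)"
    unfolding remove block B_def by blast
  have "B \<notin> P - {C}" if "B \<noteq> {}" using partition_onD1[OF rest] that by auto
  moreover have "insert x B = C" using C by (auto simp: B_def)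
  ultimately show "add_to_block x (block x P - {x}) (remove_from_block x P) = P"
    using C(1) partition_onD3[OF P] unfolding add_to_block_def remove block B_def[symmetric] by (cases "B = {}") auto
qed

lemma sum_partitions_insert:
  fixes F :: "'a set set \<Rightarrow> 'b::comm_monoid_add"
  assumes "finite A" "x \<notin> A"
  shows "(\<Sum>P | partition_on (insert x A) P. F P)
    = (\<Sum>P | partition_on A P. \<Sum>B\<in>insert {} P. F (add_to_block x B P))"
proof -
  have "(\<Sum>P | partition_on (insert x A) P. F P)
    = (\<Sum>(P,B)\<in>Sigma {P. partition_on A P} (insert {}). F (add_to_block x B P))"
  proof (rule sum.reindex_bij_witness[where i = "\<lambda>(P,B). add_to_block x B P"
        and j = "\<lambda>P. (remove_from_block x P, block x P - {x})"])
    fix P assume "P \<in> {P. partition_on (insert x A) P}"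
    then have "partition_on (insert x A) P" by simp
    note add_remove = add_remove_from_block[OF this assms(2)]
    show "(case (remove_from_block x P, block x P - {x}) of (P,B) \<Rightarrow> add_to_block x B P) = P"
      "(case (remove_from_block x P, block x P - {x}) of (P,B) \<Rightarrow> F (add_to_block x B P)) = F P"
      by (simp_all only: prod.case add_remove(3))
    show "(remove_from_block x P, block x P - {x}) \<in> Sigma {P. partition_on A P} (insert {})"
      using add_remove(1,2) by (intro SigmaI CollectI)
  next
    fix PB assume "PB \<in> Sigma {P. partition_on A P} (insert {})"
    then obtain P B where PB: "PB = (P,B)" and "partition_on A P" "B \<in> insert {} P" by auto
    note remove_add = remove_add_to_block[OF this(2) assms(2) this(3)]
      and add = partition_on_add_to_block[OF this(2) assms(2) this(3)]
    show "(\<lambda>P. (remove_from_block x P, block x P - {x})) (case PB of (P,B) \<Rightarrow> add_to_block x B P) = PB"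
      by (simp only: PB prod.case remove_add)
    show "(case PB of (P,B) \<Rightarrow> add_to_block x B P) \<in> {P. partition_on (insert x A) P}"
      using add by (simp add: PB)
  qed
  also have "\<dots> = (\<Sum>P | partition_on A P. \<Sum>B\<in>insert {} P. F (add_to_block x B P))"
    using assms(1) by (intro sum.Sigma[symmetric]) (auto intro: finitely_many_partition_on finite_elements)
  finally show ?thesis .
qed

lemma card_add_to_block:
  assumes P: "partition_on A P" and "finite A" "x \<notin> A"
  shows "card (add_to_block x {} P) = Suc (card P)" "B \<in> P \<Longrightarrow> card (add_to_block x B P) = card P"
proof -
  have fin: "finite P" by (rule finite_elements[OF \<open>finite A\<close> P])
  have new: "insert x C \<notin> P" for C using partition_on_subset[OF P] \<open>x \<notin> A\<close> by blast
  show "card (add_to_block x {} P) = Suc (card P)"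
    using new[of "{}"] fin partition_onD3[OF P] by (simp add: add_to_block_def)
  show "card (add_to_block x B P) = card P" if "B \<in> P"
    using new[of B] fin card_Suc_Diff1[OF fin that] by (simp add: add_to_block_def)
qed

text \<open>As \<open>pi_coeff 1 = 1\<close>, the leading term of \<open>\<pi>(D)\<close> is the term of the splitting into one part.\<close>
definition pi_coeff :: "nat \<Rightarrow> complex" where
  "pi_coeff n = - ((-1) ^ n * of_nat (fact (n - 1)))"

lemma pi_coeff_Suc: "n \<ge> 1 \<Longrightarrow> pi_coeff (Suc n) = - of_nat n * pi_coeff n"
  by (cases n) (simp_all add: pi_coeff_def algebra_simps)

definition touching :: "'a set \<Rightarrow> 'a set set \<Rightarrow> 'a set set" where
  "touching Q P = {B \<in> P. Q \<inter> B \<noteq> {}}"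

definition trace :: "'a set \<Rightarrow> 'a set set \<Rightarrow> 'a set set" where
  "trace Q P = (\<inter>) Q ` touching Q P"

lemma partition_on_trace: "partition_on A P \<Longrightarrow> Q \<subseteq> A \<Longrightarrow> partition_on Q (trace Q P)"
proof -
  have "trace Q P = (\<inter>) Q ` P - {{}}" by (auto simp: trace_def touching_def)
  then show "partition_on A P \<Longrightarrow> Q \<subseteq> A \<Longrightarrow> partition_on Q (trace Q P)"
    using partition_on_restrict[of A P Q] by (simp add: inf.absorb1)
qed

lemma card_trace: "partition_on A P \<Longrightarrow> card (trace Q P) = card (touching Q P)"
  unfolding trace_def
  by (intro card_image inj_onI) (auto simp: touching_def dest: partition_on_disjoint)

lemma touching_self: "partition_on Q P \<Longrightarrow> touching Q P = P"
  using partition_on_subset[of Q P] partition_onD3[of Q P] by (auto simp: touching_def Int_absorb1)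

lemma trace_self: "partition_on Q P \<Longrightarrow> trace Q P = P"
  using partition_on_subset[of Q P] by (auto simp: trace_def touching_self Int_absorb1 image_iff)

lemma touching_add_to_block:
  assumes "x \<notin> Q" "B \<in> insert {} P"
  shows "touching Q (add_to_block x B P) = (if B \<in> touching Q P then add_to_block x B (touching Q P) else touching Q P)"
proof -
  have "Q \<inter> insert x C = Q \<inter> C" for C using assms(1) by auto
  then show ?thesis using assms(2) by (auto simp: touching_def add_to_block_def)
qed

lemma trace_add_to_block:
  assumes "x \<notin> Q" "B \<in> insert {} P"
  shows "trace Q (add_to_block x B P) = trace Q P"
proof -
  have "Q \<inter> insert x C = Q \<inter> C" for C using assms(1) by auto
  then show ?thesis unfolding trace_def touching_add_to_block[OF assms] by (auto simp: add_to_block_def image_iff)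
qed

lemma sum_if_trace_add_to_block:
  assumes "x \<notin> Q"
  shows "(\<Sum>B\<in>insert {} P. if trace Q (add_to_block x B P) = T then F (add_to_block x B P) else 0)
    = (if trace Q P = T then \<Sum>B\<in>insert {} P. F (add_to_block x B P) else 0)"
  using trace_add_to_block[OF assms]
  by (cases "trace Q P = T") (simp_all only: simp_thms if_True if_False sum.neutral_const cong: sum.cong)

lemma Union_touching_add_to_block:
  assumes "x \<notin> Q" "B \<in> insert {} P"
  shows "\<Union>(touching Q (add_to_block x B P))
    = (if B \<in> touching Q P then insert x (\<Union>(touching Q P)) else \<Union>(touching Q P))"
  unfolding touching_add_to_block[OF assms] by (auto simp: add_to_block_def)

text \<open>\<open>(S - z)\<^sup>j Y\<close> at 0, for the shift operator \<open>S\<close> on sequences.\<close>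
primrec shift_diff :: "fa \<Rightarrow> nat \<Rightarrow> (nat \<Rightarrow> fa) \<Rightarrow> fa" where
  "shift_diff z 0 Y = Y 0"
| "shift_diff z (Suc j) Y = shift_diff z j (\<lambda>n. Y (Suc n)) - z * shift_diff z j Y"

lemma shift_diff_linear:
  "shift_diff z j (\<lambda>n. Y n + scl r (Y' n) - z * Y'' n)
    = shift_diff z j Y + scl r (shift_diff z j Y') - z * shift_diff z j Y''"
proof (induction j arbitrary: Y Y' Y'')
  case (Suc j)
  have "shift_diff z (Suc j) (\<lambda>n. Y n + scl r (Y' n) - z * Y'' n)
      = shift_diff z j (\<lambda>n. Y (Suc n) + scl r (Y' (Suc n)) - z * Y'' (Suc n))
        - z * shift_diff z j (\<lambda>n. Y n + scl r (Y' n) - z * Y'' n)"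
    by simp
  also have "\<dots> = shift_diff z (Suc j) Y + scl r (shift_diff z (Suc j) Y') - z * shift_diff z (Suc j) Y''"
    unfolding Suc by (simp add: fa.scale_right_diff_distrib algebra_simps)
  finally show ?case .
qed simp

text \<open>The blocks of \<open>P\<close> that touch \<open>Q\<close> contain \<open>n\<close> elements of \<open>Ch\<close> in total and contribute \<open>Y n\<close>; every other
  element of \<open>Ch\<close> contributes a factor \<open>z\<close>.\<close>
definition split_weight :: "fa \<Rightarrow> (nat \<Rightarrow> fa) \<Rightarrow> 'a set \<Rightarrow> 'a set \<Rightarrow> 'a set set \<Rightarrow> fa" where
  "split_weight z Y Q Ch P = z ^ card (Ch - \<Union>(touching Q P)) * Y (card (Ch \<inter> \<Union>(touching Q P)))"

lemma split_weight_add_to_block: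
  assumes x: "x \<notin> Q" "x \<notin> Ch" "x \<notin> \<Union>P" and "finite Ch" and B: "B \<in> insert {} P"
  shows "split_weight z Y Q (insert x Ch) (add_to_block x B P)
    = (if B \<in> touching Q P then split_weight z (\<lambda>n. Y (Suc n)) Q Ch P else z * split_weight z Y Q Ch P)"
proof -
  let ?U = "\<Union>(touching Q P)"
  have "x \<notin> ?U" using x(3) by (auto simp: touching_def)
  then have "card (insert x Ch - ?U) = Suc (card (Ch - ?U))" "insert x Ch \<inter> ?U = Ch \<inter> ?U"
    using x(2) \<open>finite Ch\<close> by (auto simp: insert_Diff_if)
  moreover have "insert x Ch - insert x ?U = Ch - ?U" "card (insert x Ch \<inter> insert x ?U) = Suc (card (Ch \<inter> ?U))"
    using x(2) \<open>finite Ch\<close> by (auto simp flip: Int_insert_right simp: Int_insert_left)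
  ultimately show ?thesis
    unfolding split_weight_def Union_touching_add_to_block[OF x(1) B] by (simp add: mult.assoc)
qed

lemma sum_scl_const: "(\<Sum>b\<in>S. scl r v) = scl (of_nat (card S) * r) v"
  unfolding fa.scale_sum_left[symmetric] sum_constant ..

text \<open>As \<open>pi_coeff (n + 1) = - n pi_coeff n\<close>, a new part and the \<open>n - card S\<close> parts outside \<open>S\<close> leave \<open>- card S\<close> times
  their common weight.\<close>
lemma sum_pi_coeff_add_to_block:
  assumes P: "partition_on A P" and A: "finite A" "x \<notin> A" and S: "S \<subseteq> P" "S \<noteq> {}"
  shows "(\<Sum>B\<in>insert {} P. scl (pi_coeff (card (add_to_block x B P))) (if B \<in> S then v else w))
    = scl (of_nat (card S) * pi_coeff (card P)) (v - w)"
proof -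
  have fin: "finite P" by (rule finite_elements[OF A(1) P])
  have empty: "{} \<notin> P" by (rule partition_onD3[OF P])
  have "card P \<ge> 1" using S fin by (metis One_nat_def Suc_leI card_gt_0_iff subset_empty)
  note coeff = pi_coeff_Suc[OF this]
  let ?p = "pi_coeff (card P)"
  have "(\<Sum>B\<in>insert {} P. scl (pi_coeff (card (add_to_block x B P))) (if B \<in> S then v else w))
      = scl (- of_nat (card P) * ?p) w + (\<Sum>B\<in>P. scl ?p (if B \<in> S then v else w))"
  proof (subst sum.insert[OF fin empty], rule arg_cong2[of _ _ _ _ "(+)"])
    show "scl (pi_coeff (card (add_to_block x {} P))) (if {} \<in> S then v else w) = scl (- of_nat (card P) * ?p) w"
      using S(1) empty unfolding card_add_to_block(1)[OF P A] coeff by auto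
    show "(\<Sum>B\<in>P. scl (pi_coeff (card (add_to_block x B P))) (if B \<in> S then v else w))
        = (\<Sum>B\<in>P. scl ?p (if B \<in> S then v else w))"
      by (intro sum.cong refl) (simp only: card_add_to_block(2)[OF P A])
  qed
  also have "(\<Sum>B\<in>P. scl ?p (if B \<in> S then v else w)) = (\<Sum>B\<in>P. scl ?p w + (if B \<in> S then scl ?p (v - w) else 0))"
    by (intro sum.cong refl) (simp add: fa.scale_right_diff_distrib)
  also have "\<dots> = (\<Sum>B\<in>P. scl ?p w) + (\<Sum>B\<in>S. scl ?p (v - w))"
    unfolding sum.distrib using fin S(1) by (simp add: sum.If_cases Int_absorb1 del: sum_constant)
  finally show ?thesis unfolding sum_scl_const by simp
qed

lemma sum_split_weight_add_to_block:
  assumes P: "partition_on (Q \<union> Ch) P" and A: "finite (Q \<union> Ch)" and x: "x \<notin> Q \<union> Ch" and "Q \<noteq> {}"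
  shows "(\<Sum>B\<in>insert {} P. scl (pi_coeff (card (add_to_block x B P))) (split_weight z Y Q (insert x Ch) (add_to_block x B P)))
    = scl (of_nat (card (trace Q P)) * pi_coeff (card P)) (split_weight z (\<lambda>n. Y (Suc n)) Q Ch P - z * split_weight z Y Q Ch P)"
proof -
  have "x \<notin> Q" "x \<notin> Ch" "x \<notin> \<Union>P" using partition_onD1[OF P] x by auto
  moreover have "finite Ch" using A by simp
  ultimately have weight: "split_weight z Y Q (insert x Ch) (add_to_block x B P)
      = (if B \<in> touching Q P then split_weight z (\<lambda>n. Y (Suc n)) Q Ch P else z * split_weight z Y Q Ch P)"
    if "B \<in> insert {} P" for B
    using that by (rule split_weight_add_to_block)
  have "trace Q P \<noteq> {}" using partition_onD1[OF partition_on_trace[OF P Un_upper1]] \<open>Q \<noteq> {}\<close> by auto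
  then have touching: "touching Q P \<subseteq> P" "touching Q P \<noteq> {}" by (auto simp: touching_def trace_def)
  have "(\<Sum>B\<in>insert {} P. scl (pi_coeff (card (add_to_block x B P))) (split_weight z Y Q (insert x Ch) (add_to_block x B P)))
      = (\<Sum>B\<in>insert {} P. scl (pi_coeff (card (add_to_block x B P)))
          (if B \<in> touching Q P then split_weight z (\<lambda>n. Y (Suc n)) Q Ch P else z * split_weight z Y Q Ch P))"
    by (intro sum.cong refl) (simp only: weight)
  then show ?thesis
    unfolding sum_pi_coeff_add_to_block[OF P A x touching] card_trace[OF P] .
qed

theorem sum_splittings_trace:
  assumes Q: "finite Q" "Q \<noteq> {}" and T: "partition_on Q T" and Ch: "finite Ch" "Q \<inter> Ch = {}"
  shows "(\<Sum>P | partition_on (Q \<union> Ch) P \<and> trace Q P = T. scl (pi_coeff (card P)) (split_weight z Y Q Ch P))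
    = scl (of_nat (card T) ^ card Ch * pi_coeff (card T)) (shift_diff z (card Ch) Y)"
  using Ch
proof (induction Ch arbitrary: Y rule: finite_induct)
  case empty
  have "{P. partition_on Q P \<and> trace Q P = T} = {T}" using T trace_self by blast
  then show ?case by (simp add: split_weight_def)
next
  case (insert x Ch)
  let ?A = "Q \<union> Ch" and ?k = "of_nat (card T) :: complex"
  let ?W = "\<lambda>Ch Y P. scl (pi_coeff (card P)) (split_weight z Y Q Ch P)"
  have x: "x \<notin> ?A" and A: "finite ?A" "finite (insert x ?A)" and disjoint: "Q \<inter> Ch = {}" using insert Q by auto
  have "(\<Sum>P | partition_on (Q \<union> insert x Ch) P \<and> trace Q P = T. ?W (insert x Ch) Y P)
      = (\<Sum>P | partition_on (insert x ?A) P. if trace Q P = T then ?W (insert x Ch) Y P else 0)"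
    using sum.inter_filter[OF finitely_many_partition_on[OF A(2)]] by simp
  also have "\<dots> = (\<Sum>P | partition_on ?A P. \<Sum>B\<in>insert {} P.
      if trace Q (add_to_block x B P) = T then ?W (insert x Ch) Y (add_to_block x B P) else 0)"
    by (rule sum_partitions_insert[OF A(1) x])
  also have "\<dots> = (\<Sum>P | partition_on ?A P. if trace Q P = T
      then scl ?k (?W Ch (\<lambda>n. Y (Suc n)) P) - scl ?k (z * ?W Ch Y P) else 0)"
  proof (intro sum.cong refl)
    fix P assume "P \<in> {P. partition_on ?A P}"
    then have P: "partition_on ?A P" by simp
    have "x \<notin> Q" using x by simp
    show "(\<Sum>B\<in>insert {} P. if trace Q (add_to_block x B P) = T then ?W (insert x Ch) Y (add_to_block x B P) else 0)
        = (if trace Q P = T then scl ?k (?W Ch (\<lambda>n. Y (Suc n)) P) - scl ?k (z * ?W Ch Y P) else 0)"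
      unfolding sum_if_trace_add_to_block[OF \<open>x \<notin> Q\<close>, where F = "?W (insert x Ch) Y"]
        sum_split_weight_add_to_block[OF P A(1) x Q(2)]
      by (simp add: fa.scale_right_diff_distrib)
  qed
  also have "\<dots> = (\<Sum>P | partition_on ?A P \<and> trace Q P = T. scl ?k (?W Ch (\<lambda>n. Y (Suc n)) P) - scl ?k (z * ?W Ch Y P))"
    unfolding sum.inter_filter[OF finitely_many_partition_on[OF A(1)], symmetric] by (simp only: mem_Collect_eq)
  also have "\<dots> = scl ?k (scl (?k ^ card Ch * pi_coeff (card T)) (shift_diff z (card Ch) (\<lambda>n. Y (Suc n))))
      - scl ?k (z * scl (?k ^ card Ch * pi_coeff (card T)) (shift_diff z (card Ch) Y))"
    unfolding sum_subtractf fa.scale_sum_right[symmetric] sum_distrib_left[symmetric] insert.IH[OF disjoint] ..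
  also have "\<dots> = scl (?k ^ card (insert x Ch) * pi_coeff (card T)) (shift_diff z (card (insert x Ch)) Y)"
    using insert.hyps by (simp add: fa.scale_right_diff_distrib mult.assoc)
  finally show ?case .
qed

section \<open>State sums\<close>

definition depends_on :: "'a set \<Rightarrow> (('a \<Rightarrow> 'b) \<Rightarrow> 'c) \<Rightarrow> bool" where
  "depends_on H F \<longleftrightarrow> (\<forall>f h. (\<forall>x\<in>H. f x = h x) \<longrightarrow> F f = F h)"

lemma depends_onD: "depends_on H F \<Longrightarrow> (\<And>x. x \<in> H \<Longrightarrow> f x = h x) \<Longrightarrow> F f = F h"
  by (simp add: depends_on_def)

lemma depends_on_mono: "depends_on H F \<Longrightarrow> H \<subseteq> H' \<Longrightarrow> depends_on H' F"
  by (auto simp: depends_on_def)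

lemma depends_on_fun_upd: "depends_on H F \<Longrightarrow> x \<notin> H \<Longrightarrow> F (f(x := a)) = F f"
  by (rule depends_onD) auto

lemma depends_on_comb2:
  assumes "depends_on H F" "depends_on H F'"
  shows "depends_on H (\<lambda>f. op (F f) (F' f))"
proof -
  have "op (F f) (F' f) = op (F h) (F' h)" if "\<forall>x\<in>H. f x = h x" for f h
    using depends_onD[OF assms(1), of f h] depends_onD[OF assms(2), of f h] that by simp
  then show ?thesis unfolding depends_on_def by blast
qed

lemma depends_on_map: "set xs \<subseteq> H \<Longrightarrow> depends_on H (\<lambda>f. map f xs)"
  by (auto simp: depends_on_def)

lemma depends_on_prod_list:
  assumes "\<And>e. e \<in> set es \<Longrightarrow> depends_on H (F e)"
  shows "depends_on H (\<lambda>f. prod_list (map (\<lambda>e. F e f) es))"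
  using assms unfolding depends_on_def by (auto intro!: arg_cong[of _ _ prod_list])

lemma sum_PiE_Un:
  assumes "A \<inter> B = {}"
  shows "(\<Sum>f\<in>(A \<union> B) \<rightarrow>\<^sub>E S. F f) = (\<Sum>f\<in>A \<rightarrow>\<^sub>E S. \<Sum>h\<in>B \<rightarrow>\<^sub>E S. F (\<lambda>x. if x \<in> A then f x else h x))"
  unfolding sum.cartesian_product
proof (rule sum.reindex_bij_witness[where i = "\<lambda>(f,h) x. if x \<in> A then f x else h x"
      and j = "\<lambda>f. (restrict f A, restrict f B)"])
  fix f assume f: "f \<in> (A \<union> B) \<rightarrow>\<^sub>E S"
  show "(case (restrict f A, restrict f B) of (f, h) \<Rightarrow> \<lambda>x. if x \<in> A then f x else h x) = f"
    using f by (auto simp: fun_eq_iff restrict_def PiE_def extensional_def)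
  then show "(case (restrict f A, restrict f B) of (f, h) \<Rightarrow> F (\<lambda>x. if x \<in> A then f x else h x)) = F f"
    by simp
  show "(restrict f A, restrict f B) \<in> (A \<rightarrow>\<^sub>E S) \<times> (B \<rightarrow>\<^sub>E S)"
    using f by (auto simp: PiE_def Pi_def)
next
  fix p assume p: "p \<in> (A \<rightarrow>\<^sub>E S) \<times> (B \<rightarrow>\<^sub>E S)"
  then show "(\<lambda>f. (restrict f A, restrict f B)) (case p of (f,h) \<Rightarrow> \<lambda>x. if x \<in> A then f x else h x) = p"
    using assms by (auto simp: fun_eq_iff restrict_def PiE_def extensional_def split: prod.splits)
  show "(case p of (f,h) \<Rightarrow> \<lambda>x. if x \<in> A then f x else h x) \<in> (A \<union> B) \<rightarrow>\<^sub>E S"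
    using p by (auto simp: PiE_def Pi_def extensional_def split: prod.splits)
qed

lemma sum_PiE_Un_mult:
  fixes F F' :: "('a \<Rightarrow> 'b) \<Rightarrow> 'c::semiring_0"
  assumes disjoint: "A \<inter> B = {}" and F: "depends_on A F" and F': "depends_on B F'"
  shows "(\<Sum>f\<in>(A \<union> B) \<rightarrow>\<^sub>E S. F f * F' f) = (\<Sum>f\<in>A \<rightarrow>\<^sub>E S. F f) * (\<Sum>f\<in>B \<rightarrow>\<^sub>E S. F' f)"
  unfolding sum_PiE_Un[OF disjoint] sum_product
proof (intro sum.cong refl arg_cong2[of _ _ _ _ "(*)"])
  fix f h :: "'a \<Rightarrow> 'b"
  show "F (\<lambda>x. if x \<in> A then f x else h x) = F f" by (rule depends_onD[OF F]) simp
  show "F' (\<lambda>x. if x \<in> A then f x else h x) = F' h" by (rule depends_onD[OF F']) (use disjoint in auto)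
qed

lemma sum_PiE_insert:
  assumes "x \<notin> A"
  shows "(\<Sum>f\<in>insert x A \<rightarrow>\<^sub>E S. F f) = (\<Sum>a\<in>S. \<Sum>f\<in>A \<rightarrow>\<^sub>E S. F (f(x := a)))"
proof -
  have "inj_on (\<lambda>(y, h). h(x := y)) (S \<times> (A \<rightarrow>\<^sub>E S))" using inj_combinator[OF assms, of "\<lambda>_. S"] .
  then show ?thesis
    unfolding PiE_insert_eq sum.cartesian_product by (subst sum.reindex) (auto simp: o_def case_prod_unfold)
qed

lemma sum_swap_past_two:
  "(\<Sum>y\<in>B. \<Sum>p\<in>C. \<Sum>q\<in>D. R y p q) = (\<Sum>p\<in>C. \<Sum>q\<in>D. \<Sum>y\<in>B. R y p q)"
  by (subst sum.swap) (intro sum.cong refl sum.swap)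

lemma sum_swap_pairs:
  "(\<Sum>x\<in>A. \<Sum>y\<in>B. \<Sum>p\<in>C. \<Sum>q\<in>D. R x y p q) = (\<Sum>p\<in>C. \<Sum>q\<in>D. \<Sum>x\<in>A. \<Sum>y\<in>B. R x y p q)"
  by (rule trans[OF sum.cong[OF refl sum_swap_past_two] sum_swap_past_two])

definition wf_diag :: "diagram \<Rightarrow> bool" where
  "wf_diag D \<longleftrightarrow> (\<forall>(x,y)\<in>set (dedges D). x \<in> halfedges D \<and> y \<in> halfedges D)"

lemma halfedges_dmult: "halfedges (dmult D1 D2) = halfedges D1 \<union> halfedges D2"
  by (auto simp: halfedges_def dmult_def)

lemma wf_dmult: "wf_diag D1 \<Longrightarrow> wf_diag D2 \<Longrightarrow> wf_diag (dmult D1 D2)"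
  unfolding wf_diag_def halfedges_dmult by (auto simp: dmult_def)

lemma halfedges_dunit: "halfedges dunit = {}"
  by (simp add: dunit_def halfedges_def)

lemma wf_dunit: "wf_diag dunit"
  by (simp add: wf_diag_def dunit_def)

text \<open>The diagram with loop \<open>l1 @ l2 @ l3\<close>, and parallel chords \<open>cs\<close> that enclose \<open>l2\<close>.\<close>
definition chorded ::
    "nat list \<Rightarrow> nat list \<Rightarrow> nat list \<Rightarrow> (nat \<times> nat \<times> nat) list \<Rightarrow> (nat \<times> nat) list \<Rightarrow> (nat \<times> nat) list \<Rightarrow> diagram" where
  "chorded l1 l2 l3 vs es cs =
    \<lparr>dloop = l1 @ map fst cs @ l2 @ rev (map snd cs) @ l3, dverts = vs, dedges = es @ cs\<rparr>"

definition fresh_chords :: "nat set \<Rightarrow> (nat \<times> nat) list \<Rightarrow> bool" where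
  "fresh_chords H cs \<longleftrightarrow> distinct (map fst cs @ map snd cs) \<and> set (map fst cs @ map snd cs) \<inter> H = {}"

context metrized_simple_lie
begin

definition edge_weight :: "(nat \<times> nat) list \<Rightarrow> (nat \<Rightarrow> nat) \<Rightarrow> complex" where
  "edge_weight es f = prod_list (map (\<lambda>(x,y). g (f y) (f x)) es)"

definition vert_weight :: "(nat \<times> nat \<times> nat) list \<Rightarrow> (nat \<Rightarrow> nat) \<Rightarrow> complex" where
  "vert_weight vs f = prod_list (map (\<lambda>(a,b,d). t (f a) (f b) (f d)) vs)"

definition state_weight :: "diagram \<Rightarrow> (nat \<Rightarrow> nat) \<Rightarrow> fa" where
  "state_weight D f = scl (edge_weight (dedges D) f * vert_weight (dverts D) f) (word (map f (dloop D)))"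

definition wval :: "diagram \<Rightarrow> fa" where
  "wval D = (\<Sum>f\<in>halfedges D \<rightarrow>\<^sub>E {..<m}. state_weight D f)"

lemma coef_wval: "coef (wval D) = wsys m c lam D"
  by (rule ext) (auto simp: wval_def state_weight_def wsys_def lookup_sum coef_scl coef_word edge_weight_def
      vert_weight_def intro!: sum.cong)

lemma words_wval: "words (wval D) \<subseteq> lists {..<m}"
proof
  fix w assume "w \<in> words (wval D)"
  then have "(\<Sum>f\<in>halfedges D \<rightarrow>\<^sub>E {..<m}. coef (state_weight D f) w) \<noteq> 0"
    by (simp add: in_keys_iff wval_def lookup_sum)
  then obtain f where f: "f \<in> halfedges D \<rightarrow>\<^sub>E {..<m}" "coef (state_weight D f) w \<noteq> 0"
    by (rule sum.not_neutral_contains_not_neutral)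
  then have "w = map f (dloop D)" by (auto simp: state_weight_def coef_scl coef_word split: if_splits)
  moreover have "f x < m" if "x \<in> set (dloop D)" for x
    using PiE_mem[OF f(1), of x] that by (simp add: halfedges_def)
  ultimately show "w \<in> lists {..<m}" by auto
qed

lemma depends_on_edge_weight:
  assumes "\<And>x y. (x,y) \<in> set es \<Longrightarrow> x \<in> H \<and> y \<in> H"
  shows "depends_on H (edge_weight es)"
  unfolding edge_weight_def using assms by (intro depends_on_prod_list) (auto simp: depends_on_def)

lemma depends_on_vert_weight:
  assumes "\<And>a b d. (a,b,d) \<in> set vs \<Longrightarrow> a \<in> H \<and> b \<in> H \<and> d \<in> H"
  shows "depends_on H (vert_weight vs)"
  unfolding vert_weight_def using assms by (intro depends_on_prod_list) (auto simp: depends_on_def)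

lemma depends_on_word_map: "set xs \<subseteq> H \<Longrightarrow> depends_on H (\<lambda>f. word (map f xs))"
  by (rule depends_on_comb2[OF depends_on_map depends_on_map, of xs H xs "\<lambda>w _. word w"])

lemma depends_on_weights:
  assumes "wf_diag D"
  shows "depends_on (halfedges D) (\<lambda>f. edge_weight (dedges D) f * vert_weight (dverts D) f)"
proof -
  have "depends_on (halfedges D) (edge_weight (dedges D))"
    using assms by (intro depends_on_edge_weight) (auto simp: wf_diag_def)
  moreover have "depends_on (halfedges D) (vert_weight (dverts D))"
    by (intro depends_on_vert_weight) (force simp: halfedges_def)
  ultimately show ?thesis by (rule depends_on_comb2)
qed

lemma depends_on_state_weight: "wf_diag D \<Longrightarrow> depends_on (halfedges D) (state_weight D)"
  unfolding state_weight_def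
  by (intro depends_on_comb2[where op = scl] depends_on_weights depends_on_word_map) (simp_all add: halfedges_def)

lemma edge_weight_append: "edge_weight (es @ es') f = edge_weight es f * edge_weight es' f"
  and vert_weight_append: "vert_weight (vs @ vs') f = vert_weight vs f * vert_weight vs' f"
  by (simp_all add: edge_weight_def vert_weight_def)

lemma wval_dmult:
  assumes "wf_diag D1" "wf_diag D2" "halfedges D1 \<inter> halfedges D2 = {}"
  shows "wval (dmult D1 D2) = wval D1 * wval D2"
proof -
  have "state_weight (dmult D1 D2) = (\<lambda>f. state_weight D1 f * state_weight D2 f)"
    by (rule ext)
      (simp add: state_weight_def dmult_def edge_weight_append vert_weight_append word_append mult_ac)
  then show ?thesis
    unfolding wval_def halfedges_dmult using assms by (simp add: sum_PiE_Un_mult depends_on_state_weight)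
qed

lemma wval_dunit: "wval dunit = 1"
  by (simp add: wval_def halfedges_dunit) (simp add: state_weight_def dunit_def edge_weight_def vert_weight_def word_Nil)

lemma wval_foldr_dmult:
  assumes "\<And>D. D \<in> set Ds \<Longrightarrow> wf_diag D" "sorted_wrt (\<lambda>D D'. halfedges D \<inter> halfedges D' = {}) Ds"
  shows "wval (foldr dmult Ds dunit) = prod_list (map wval Ds) \<and> wf_diag (foldr dmult Ds dunit)
    \<and> halfedges (foldr dmult Ds dunit) = (\<Union>D\<in>set Ds. halfedges D)"
  using assms
proof (induction Ds)
  case (Cons D Ds)
  then have "halfedges D \<inter> halfedges (foldr dmult Ds dunit) = {}" by auto
  with Cons show ?case by (simp add: wval_dmult wf_dmult halfedges_dmult)
qed (simp add: wval_dunit wf_dunit halfedges_dunit)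

lemma sum_chord:
  assumes L: "Modules.module_hom scl scl L" and xy: "x \<notin> H" "y \<notin> H" "x \<noteq> y" and l: "set l \<subseteq> H"
    and A: "depends_on H A" and B: "depends_on H B"
  shows "(\<Sum>f\<in>insert x (insert y H) \<rightarrow>\<^sub>E {..<m}. scl (g (f y) (f x)) (A f * L (word (map f (x # l @ [y]))) * B f))
    = (\<Sum>f\<in>H \<rightarrow>\<^sub>E {..<m}. A f * L (Phi (word (map f l))) * B f)"
proof -
  let ?f = "\<lambda>f p q. f(y := q, x := p)"
  have word: "word (map (?f f p q) (x # l @ [y])) = E p * word (map f l) * E q" for f p q
  proof -
    have "map (?f f p q) (x # l @ [y]) = [p] @ map f l @ [q]" using xy l by auto
    then show ?thesis by (simp only: word_append mult.assoc)
  qed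
  have A_upd: "A (?f f p q) = A f" and B_upd: "B (?f f p q) = B f" for f p q
    using xy by (simp_all add: depends_on_fun_upd[OF A] depends_on_fun_upd[OF B])
  have "(\<Sum>f\<in>insert x (insert y H) \<rightarrow>\<^sub>E {..<m}. scl (g (f y) (f x)) (A f * L (word (map f (x # l @ [y]))) * B f))
    = (\<Sum>p<m. \<Sum>q<m. \<Sum>f\<in>H \<rightarrow>\<^sub>E {..<m}. scl (g q p) (A f * L (E p * word (map f l) * E q) * B f))"
    using xy xy(3)[symmetric]
    by (simp only: sum_PiE_insert insert_iff simp_thms word A_upd B_upd fun_upd_apply if_True if_False)
  also have "\<dots> = (\<Sum>f\<in>H \<rightarrow>\<^sub>E {..<m}. \<Sum>p<m. \<Sum>q<m. scl (g q p) (A f * L (E p * word (map f l) * E q) * B f))"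
    by (subst sum.swap[of _ _ "{..<m}"], subst sum.swap) (intro sum.cong refl sum.swap)
  also have "\<dots> = (\<Sum>f\<in>H \<rightarrow>\<^sub>E {..<m}. A f * L (Phi (word (map f l))) * B f)"
    by (simp add: Phi_coords module_hom.sum[OF L] module_hom.scale[OF L] sum_distrib_left sum_distrib_right)
  finally show ?thesis .
qed

lemma sum_parallel_chords:
  assumes "distinct (map fst cs @ map snd cs)" "set (map fst cs @ map snd cs) \<inter> H = {}" "set l \<subseteq> H"
    and A: "depends_on H A" and B: "depends_on H B"
  shows "(\<Sum>f\<in>set (map fst cs @ map snd cs) \<union> H \<rightarrow>\<^sub>E {..<m}.
      scl (edge_weight cs f) (A f * word (map f (map fst cs @ l @ rev (map snd cs))) * B f))
    = (\<Sum>f\<in>H \<rightarrow>\<^sub>E {..<m}. A f * (Phi ^^ length cs) (word (map f l)) * B f)"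
  using assms
proof (induction cs arbitrary: l H A rule: rev_induct)
  case Nil
  then show ?case by (simp add: edge_weight_def)
next
  case (snoc e cs)
  obtain x y where e: "e = (x, y)" by fastforce
  let ?A = "\<lambda>f. scl (g (f y) (f x)) (A f)"
  have xy: "x \<notin> H" "y \<notin> H" "x \<noteq> y" using snoc.prems(1,2) e by auto
  have A: "depends_on (insert x (insert y H)) ?A"
  proof (rule depends_on_comb2[where op = scl])
    show "depends_on (insert x (insert y H)) A" by (rule depends_on_mono[OF snoc.prems(4)]) auto
  qed (simp add: depends_on_def)
  have B: "depends_on (insert x (insert y H)) B" by (rule depends_on_mono[OF snoc.prems(5)]) auto
  have edges: "scl (edge_weight (cs @ [e]) f) (A f * w * B f) = scl (edge_weight cs f) (?A f * w * B f)" for f w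
    by (simp add: edge_weight_append e edge_weight_def)
  have loop: "map fst (cs @ [e]) @ l @ rev (map snd (cs @ [e])) = map fst cs @ (x # l @ [y]) @ rev (map snd cs)"
    by (simp add: e)
  have support: "set (map fst (cs @ [e]) @ map snd (cs @ [e])) \<union> H
      = set (map fst cs @ map snd cs) \<union> insert x (insert y H)"
    by (auto simp: e)
  have "(\<Sum>f\<in>set (map fst (cs @ [e]) @ map snd (cs @ [e])) \<union> H \<rightarrow>\<^sub>E {..<m}.
      scl (edge_weight (cs @ [e]) f) (A f * word (map f (map fst (cs @ [e]) @ l @ rev (map snd (cs @ [e])))) * B f))
    = (\<Sum>f\<in>insert x (insert y H) \<rightarrow>\<^sub>E {..<m}. ?A f * (Phi ^^ length cs) (word (map f (x # l @ [y]))) * B f)"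
    unfolding edges loop support
    by (rule snoc.IH) (use snoc.prems e A B in auto)
  also have "\<dots> = (\<Sum>f\<in>insert x (insert y H) \<rightarrow>\<^sub>E {..<m}.
      scl (g (f y) (f x)) (A f * (Phi ^^ length cs) (word (map f (x # l @ [y]))) * B f))"
    by simp
  also have "\<dots> = (\<Sum>f\<in>H \<rightarrow>\<^sub>E {..<m}. A f * (Phi ^^ length cs) (Phi (word (map f l))) * B f)"
    by (rule sum_chord[OF module_hom_funpow_Phi xy snoc.prems(3-5)])
  finally show ?case by (simp add: funpow_swap1)
qed

definition chorded_val ::
    "nat list \<Rightarrow> nat list \<Rightarrow> nat list \<Rightarrow> (nat \<times> nat \<times> nat) list \<Rightarrow> (nat \<times> nat) list \<Rightarrow> nat \<Rightarrow> fa" where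
  "chorded_val l1 l2 l3 vs es n = (\<Sum>f\<in>halfedges (chorded l1 l2 l3 vs es []) \<rightarrow>\<^sub>E {..<m}.
    scl (edge_weight es f * vert_weight vs f) (word (map f l1) * (Phi ^^ n) (word (map f l2)) * word (map f l3)))"

lemma wval_chorded:
  assumes wf: "wf_diag (chorded l1 l2 l3 vs es [])" and fresh: "fresh_chords (halfedges (chorded l1 l2 l3 vs es [])) cs"
  shows "wval (chorded l1 l2 l3 vs es cs) = chorded_val l1 l2 l3 vs es (length cs)"
proof -
  define H where "H = halfedges (chorded l1 l2 l3 vs es [])"
  have cs: "distinct (map fst cs @ map snd cs)" "set (map fst cs @ map snd cs) \<inter> H = {}"
    using fresh by (simp_all add: fresh_chords_def H_def)
  let ?A = "\<lambda>f. scl (edge_weight es f * vert_weight vs f) (word (map f l1))"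
  let ?B = "\<lambda>f. word (map f l3)"
  have l: "set l1 \<subseteq> H" "set l2 \<subseteq> H" "set l3 \<subseteq> H" by (auto simp: H_def halfedges_def chorded_def)
  have "depends_on H (\<lambda>f. edge_weight es f * vert_weight vs f)"
    using depends_on_weights[OF wf] by (simp add: H_def chorded_def)
  then have A: "depends_on H ?A" by (rule depends_on_comb2[where op = scl]) (rule depends_on_word_map[OF l(1)])
  have "halfedges (chorded l1 l2 l3 vs es cs) = set (map fst cs @ map snd cs) \<union> H"
    by (auto simp: H_def halfedges_def chorded_def)
  moreover have "state_weight (chorded l1 l2 l3 vs es cs)
      = (\<lambda>f. scl (edge_weight cs f) (?A f * word (map f (map fst cs @ l2 @ rev (map snd cs))) * ?B f))"
    by (rule ext) (simp add: state_weight_def chorded_def edge_weight_append word_append mult_ac)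
  ultimately have "wval (chorded l1 l2 l3 vs es cs) = (\<Sum>f\<in>set (map fst cs @ map snd cs) \<union> H \<rightarrow>\<^sub>E {..<m}.
      scl (edge_weight cs f) (?A f * word (map f (map fst cs @ l2 @ rev (map snd cs))) * ?B f))"
    unfolding wval_def by (simp only:)
  then show ?thesis
    unfolding chorded_val_def H_def[symmetric] sum_parallel_chords[OF cs l(2) A depends_on_word_map[OF l(3)]] by simp
qed

end

section \<open>Ladders\<close>

context metrized_simple_lie
begin

lemma trip_form: "a < m \<Longrightarrow> b < m \<Longrightarrow> d < m \<Longrightarrow> t a b d = form (br (unitv a) (unitv b)) (unitv d)"
  unfolding form_expand[of "br _ _"] trip_def gform_def
  by (intro sum.cong) (simp_all add: lbracket_unitv form_def kform_unitv)

lemma sum_form_g: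
  assumes "p < m"
  shows "(\<Sum>b<m. form v (unitv b) * g b p) = v p"
proof -
  have "v p = form (dual p) v" using form_dual[OF assms, of v] by (simp only: form_sym[of v "dual p"])
  also have "\<dots> = (\<Sum>b<m. g b p * form (unitv b) v)"
    by (simp only: dual_coords[of p] form_sum_left form_scale_left)
  finally show ?thesis by (simp only: form_sym[of "unitv _" v] mult.commute[of "g _ p"])
qed

definition rung_tensor :: "nat \<Rightarrow> nat \<Rightarrow> nat \<Rightarrow> nat \<Rightarrow> complex" where
  "rung_tensor x y p q = (\<Sum>d<m. br (unitv d) (unitv x) p * br (unitv y) (dual d) q)"

text \<open>The rung whose six half-edges start at \<open>s\<close>, joined to half-edges with labels \<open>p\<close> and \<open>q\<close> on its left.\<close>
definition rung_weight :: "nat \<Rightarrow> nat \<Rightarrow> nat \<Rightarrow> (nat \<Rightarrow> nat) \<Rightarrow> complex" where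
  "rung_weight s p q f = t (f s) (f (s+1)) (f (s+2)) * t (f (s+3)) (f (s+4)) (f (s+5)) *
     g (f (s+4)) (f (s+2)) * g (f (s+1)) p * g (f (s+5)) q"

lemma rung_weight_cong:
  assumes "\<And>r. r < 6 \<Longrightarrow> f (s + r) = f' (s + r)"
  shows "rung_weight s p q f = rung_weight s p q f'"
  using assms[of 0] assms[of 1] assms[of 2] assms[of 3] assms[of 4] assms[of 5] by (simp add: rung_weight_def)

lemma sum_rung_weight:
  assumes pq: "p < m" "q < m"
  shows "(\<Sum>f\<in>{s..<s+6} \<rightarrow>\<^sub>E {..<m}. rung_weight s p q f * B (f s) (f (s+3)))
    = (\<Sum>x<m. \<Sum>y<m. B x y * rung_tensor x y p q)"
proof -
  have "{s..<s+6} = {s, s+3, s+2, s+4, s+5, s+1}" by auto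
  then have "(\<Sum>f\<in>{s..<s+6} \<rightarrow>\<^sub>E {..<m}. rung_weight s p q f * B (f s) (f (s+3)))
      = (\<Sum>x<m. \<Sum>y<m. \<Sum>d<m. \<Sum>u<m. \<Sum>w<m. \<Sum>v<m. t x v d * t y u w * g u d * g v p * g w q * B x y)"
    by (simp add: sum_PiE_insert rung_weight_def)
  also have "\<dots> = (\<Sum>x<m. \<Sum>y<m. B x y * (\<Sum>d<m. (\<Sum>v<m. t x v d * g v p) * (\<Sum>u<m. g u d * (\<Sum>w<m. t y u w * g w q))))"
    by (simp add: sum_product sum_distrib_left mult_ac)
  also have "\<dots> = (\<Sum>x<m. \<Sum>y<m. B x y * rung_tensor x y p q)"
  proof (intro sum.cong refl arg_cong2[of _ _ _ _ "(*)"])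
    fix x y assume xy: "x \<in> {..<m}" "y \<in> {..<m}"
    have left: "(\<Sum>v<m. t x v d * g v p) = br (unitv d) (unitv x) p" if "d < m" for d
    proof -
      have "t x v d = form (br (unitv x) (unitv v)) (unitv d)" if "v < m" for v
        using xy \<open>d < m\<close> that by (simp add: trip_form)
      moreover have "form (br (unitv x) (unitv v)) (unitv d) = form (br (unitv d) (unitv x)) (unitv v)" for v
        by (simp only: form_invariant[of "unitv d"] form_sym[of "unitv d"])
      ultimately show ?thesis using sum_form_g[OF pq(1)] by simp
    qed
    have "(\<Sum>w<m. t y u w * g w q) = br (unitv y) (unitv u) q" if "u < m" for u
      using xy that sum_form_g[OF pq(2)] by (simp add: trip_form)
    then have right: "(\<Sum>u<m. g u d * (\<Sum>w<m. t y u w * g w q)) = br (unitv y) (dual d) q" for d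
      unfolding lin_op_expand_apply[OF lin_op_lbracket, of _ _ _ "dual d"] by (simp add: dual_def)
    show "(\<Sum>d<m. (\<Sum>v<m. t x v d * g v p) * (\<Sum>u<m. g u d * (\<Sum>w<m. t y u w * g w q))) = rung_tensor x y p q"
      unfolding rung_tensor_def by (intro sum.cong refl) (simp add: left right)
  qed
  finally show ?thesis .
qed

definition upper_port :: "nat \<Rightarrow> nat \<Rightarrow> nat" where
  "upper_port s k = (if k = 0 then 1 else s + 6 * (k - 1))"

definition lower_port :: "nat \<Rightarrow> nat \<Rightarrow> nat" where
  "lower_port s k = (if k = 0 then 2 else s + 6 * (k - 1) + 3)"

definition rungs_weight :: "nat \<Rightarrow> nat \<Rightarrow> (nat \<Rightarrow> nat) \<Rightarrow> complex" where
  "rungs_weight s i f = (\<Prod>k<i. rung_weight (s + 6*k) (f (upper_port s k)) (f (lower_port s k)) f)"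

definition rung_op :: "(nat \<Rightarrow> nat \<Rightarrow> fa) \<Rightarrow> nat \<Rightarrow> nat \<Rightarrow> fa" where
  "rung_op V x y = (\<Sum>p<m. \<Sum>q<m. scl (rung_tensor x y p q) (V p q))"

lemma rungs_weight_restrict:
  assumes "s \<ge> 3" and f: "\<And>x. x \<in> {1,2} \<union> {s..<s+6*i} \<Longrightarrow> f x = f' x"
  shows "rungs_weight s i f = rungs_weight s i f'"
  unfolding rungs_weight_def
proof (intro prod.cong refl)
  fix k assume "k \<in> {..<i}"
  then have ports: "upper_port s k \<in> {1,2} \<union> {s..<s+6*i}" "lower_port s k \<in> {1,2} \<union> {s..<s+6*i}"
    and rung: "\<And>r. r < 6 \<Longrightarrow> s + 6*k + r \<in> {1,2} \<union> {s..<s+6*i}"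
    by (auto simp: upper_port_def lower_port_def)
  show "rung_weight (s + 6*k) (f (upper_port s k)) (f (lower_port s k)) f
      = rung_weight (s + 6*k) (f' (upper_port s k)) (f' (lower_port s k)) f'"
    unfolding f[OF ports(1)] f[OF ports(2)] by (rule rung_weight_cong) (rule f[OF rung])
qed

lemma rungs_weight_Suc_split:
  fixes f h :: "nat \<Rightarrow> nat" and s i :: nat
  assumes s: "s \<ge> 3"
  defines "H \<equiv> {1,2} \<union> {s..<s+6*i}"
  shows "rungs_weight s (Suc i) (\<lambda>x. if x \<in> H then f x else h x)
    = rungs_weight s i f * rung_weight (s + 6*i) (f (upper_port s i)) (f (lower_port s i)) h"
proof -
  let ?f = "\<lambda>x. if x \<in> H then f x else h x"
  have "rungs_weight s i ?f = rungs_weight s i f" by (rule rungs_weight_restrict[OF s]) (simp add: H_def)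
  moreover have "s + 6*i + r \<notin> H" for r using s by (auto simp: H_def)
  then have "rung_weight (s + 6*i) p q ?f = rung_weight (s + 6*i) p q h" for p q
    by (intro rung_weight_cong) (simp only: if_False)
  moreover have "upper_port s i \<in> H" "lower_port s i \<in> H" by (auto simp: H_def upper_port_def lower_port_def)
  ultimately show ?thesis unfolding rungs_weight_def prod.lessThan_Suc by (simp only: if_True)
qed

lemma sum_rungs_weight:
  assumes s: "s \<ge> 3"
  shows "(\<Sum>f\<in>{1,2} \<union> {s..<s+6*i} \<rightarrow>\<^sub>E {..<m}.
      scl (rungs_weight s i f * B (f (upper_port s i)) (f (lower_port s i))) (Z (f 1) (f 2)))
    = (\<Sum>x<m. \<Sum>y<m. scl (B x y) ((rung_op ^^ i) Z x y))"
proof (induction i arbitrary: B)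
  case 0
  show ?case by (simp add: upper_port_def lower_port_def rungs_weight_def sum_PiE_insert)
next
  case (Suc i)
  let ?H = "{1,2} \<union> {s..<s+6*i}" and ?s = "s + 6*i"
  define B' where "B' p q = (\<Sum>h\<in>{?s..<?s+6} \<rightarrow>\<^sub>E {..<m}. rung_weight ?s p q h * B (h ?s) (h (?s+3)))" for p q
  have split: "{1,2} \<union> {s..<s+6*Suc i} = ?H \<union> {?s..<?s+6}" "?H \<inter> {?s..<?s+6} = {}" using s by auto
  have next_ports: "upper_port s (Suc i) = ?s" "lower_port s (Suc i) = ?s + 3"
    by (auto simp: upper_port_def lower_port_def)
  have "(\<Sum>f\<in>{1,2} \<union> {s..<s+6*Suc i} \<rightarrow>\<^sub>E {..<m}.
      scl (rungs_weight s (Suc i) f * B (f (upper_port s (Suc i))) (f (lower_port s (Suc i)))) (Z (f 1) (f 2)))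
    = (\<Sum>f\<in>?H \<rightarrow>\<^sub>E {..<m}. \<Sum>h\<in>{?s..<?s+6} \<rightarrow>\<^sub>E {..<m}. scl (rungs_weight s i f *
        (rung_weight ?s (f (upper_port s i)) (f (lower_port s i)) h * B (h ?s) (h (?s+3)))) (Z (f 1) (f 2)))"
    unfolding split(1) sum_PiE_Un[OF split(2)] next_ports
  proof (intro sum.cong refl)
    fix f h :: "nat \<Rightarrow> nat"
    have "?s \<notin> ?H" "?s + 3 \<notin> ?H" "1 \<in> ?H" "2 \<in> ?H" using s by auto
    then show "scl (rungs_weight s (Suc i) (\<lambda>x. if x \<in> ?H then f x else h x)
          * B (if ?s \<in> ?H then f ?s else h ?s) (if ?s + 3 \<in> ?H then f (?s + 3) else h (?s + 3)))
        (Z (if 1 \<in> ?H then f 1 else h 1) (if 2 \<in> ?H then f 2 else h 2))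
      = scl (rungs_weight s i f * (rung_weight ?s (f (upper_port s i)) (f (lower_port s i)) h
          * B (h ?s) (h (?s+3)))) (Z (f 1) (f 2))"
      by (simp only: rungs_weight_Suc_split[OF s] if_True if_False mult.assoc)
  qed
  also have "\<dots> = (\<Sum>f\<in>?H \<rightarrow>\<^sub>E {..<m}.
      scl (rungs_weight s i f * B' (f (upper_port s i)) (f (lower_port s i))) (Z (f 1) (f 2)))"
    unfolding B'_def sum_distrib_left fa.scale_sum_left ..
  also have "\<dots> = (\<Sum>p<m. \<Sum>q<m. scl (B' p q) ((rung_op ^^ i) Z p q))" by (rule Suc.IH)
  also have "\<dots> = (\<Sum>p<m. \<Sum>q<m. \<Sum>x<m. \<Sum>y<m. scl (B x y * rung_tensor x y p q) ((rung_op ^^ i) Z p q))"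
    by (intro sum.cong refl) (simp add: B'_def sum_rung_weight fa.scale_sum_left)
  also have "\<dots> = (\<Sum>x<m. \<Sum>y<m. \<Sum>p<m. \<Sum>q<m. scl (B x y * rung_tensor x y p q) ((rung_op ^^ i) Z p q))"
    by (rule sum_swap_pairs)
  also have "\<dots> = (\<Sum>x<m. \<Sum>y<m. scl (B x y) ((rung_op ^^ Suc i) Z x y))"
    by (simp add: rung_op_def fa.scale_sum_right)
  finally show ?case .
qed

definition nest :: "nat \<Rightarrow> nat \<Rightarrow> nat \<Rightarrow> fa" where
  "nest n x y = (Phi ^^ n) (E x * E y)"

text \<open>The value of the ladder with \<open>i\<close> rungs crossed by \<open>n\<close> parallel chords.\<close>
definition ladder_val :: "nat \<Rightarrow> nat \<Rightarrow> fa" where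
  "ladder_val i n = (\<Sum>p<m. \<Sum>q<m. \<Sum>x<m. \<Sum>y<m. scl (g p x * g q y) (E p * (rung_op ^^ i) (nest n) x y * E q))"

lemma rungs_weight_fun_upd: "s \<ge> 4 \<Longrightarrow> x \<in> {0,3} \<Longrightarrow> rungs_weight s i (f(x := a)) = rungs_weight s i f"
  by (rule rungs_weight_restrict) auto

lemma rung_op_sandwich: "(rung_op ^^ i) (\<lambda>x y. A * V x y * B) = (\<lambda>x y. A * (rung_op ^^ i) V x y * B)"
  by (induction i) (auto simp: rung_op_def sum_distrib_left sum_distrib_right fun_eq_iff)

lemma sum_ladder:
  assumes s: "s \<ge> 4"
  shows "(\<Sum>f\<in>{0,1,2,3} \<union> {s..<s+6*i} \<rightarrow>\<^sub>E {..<m}.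
      scl (rungs_weight s i f * (g (f 0) (f (upper_port s i)) * g (f 3) (f (lower_port s i))))
        (E (f 0) * (Phi ^^ n) (E (f 1) * E (f 2)) * E (f 3))) = ladder_val i n"
proof -
  let ?H = "{1,2} \<union> {s..<s+6*i}"
  have H: "{0,1,2,3} \<union> {s..<s+6*i} = insert 0 (insert 3 ?H)" "0 \<notin> insert 3 ?H" "3 \<notin> ?H" using s by auto
  have ports: "upper_port s k \<notin> {0,3}" "lower_port s k \<notin> {0,3}" for k
    using s by (auto simp: upper_port_def lower_port_def)
  have "(\<Sum>f\<in>{0,1,2,3} \<union> {s..<s+6*i} \<rightarrow>\<^sub>E {..<m}.
      scl (rungs_weight s i f * (g (f 0) (f (upper_port s i)) * g (f 3) (f (lower_port s i))))
        (E (f 0) * (Phi ^^ n) (E (f 1) * E (f 2)) * E (f 3)))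
    = (\<Sum>p<m. \<Sum>q<m. \<Sum>f\<in>?H \<rightarrow>\<^sub>E {..<m}.
      scl (rungs_weight s i f * (g p (f (upper_port s i)) * g q (f (lower_port s i)))) (E p * nest n (f 1) (f 2) * E q))"
    unfolding H(1) sum_PiE_insert[OF H(2)] sum_PiE_insert[OF H(3)] nest_def
    using ports[of i] by (simp add: rungs_weight_fun_upd[OF s])
  also have "\<dots> = ladder_val i n"
    unfolding ladder_val_def
  proof (intro sum.cong refl)
    fix p q
    show "(\<Sum>f\<in>?H \<rightarrow>\<^sub>E {..<m}. scl (rungs_weight s i f * (g p (f (upper_port s i)) * g q (f (lower_port s i))))
        (E p * nest n (f 1) (f 2) * E q))
      = (\<Sum>x<m. \<Sum>y<m. scl (g p x * g q y) (E p * (rung_op ^^ i) (nest n) x y * E q))"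
      using sum_rungs_weight[of s i "\<lambda>x y. g p x * g q y" "\<lambda>x y. E p * nest n x y * E q"] s
      unfolding rung_op_sandwich by simp
  qed
  finally show ?thesis .
qed

lemma rung_op_nest:
  assumes "x < m" "y < m"
  shows "rung_op (nest n) x y \<approx> nest (Suc n) x y + scl (1 / lam) (nest n x y) - Cas * nest n x y"
proof -
  have "rung_op (nest n) x y
      = (\<Sum>p<m. \<Sum>q<m. \<Sum>d<m. scl (br (unitv d) (unitv x) p * br (unitv y) (dual d) q) (nest n p q))"
    by (simp add: rung_op_def rung_tensor_def fa.scale_sum_left)
  also have "\<dots> = (\<Sum>d<m. \<Sum>p<m. \<Sum>q<m. scl (br (unitv d) (unitv x) p * br (unitv y) (dual d) q) (nest n p q))"
    by (rule sum_swap_past_two[symmetric])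
  also have "\<dots> = (Phi ^^ n) (\<Sum>d<m. emb (br (unitv d) (unitv x)) * emb (br (unitv y) (dual d)))"
    by (simp add: emb_def nest_def sum_product funpow_Phi_sum funpow_Phi_scl mult.commute)
  also have "\<dots> \<approx> (Phi ^^ n) (Phi (E x * E y) + scl (1 / lam) (E x * E y) - Cas * (E x * E y))"
    using rung_relation[OF unitv_in_lvecs[OF assms(1)] unitv_in_lvecs[OF assms(2)]] assms
    by (intro funpow_Phi_cong) (simp add: emb_unitv)
  also have "\<dots> = nest (Suc n) x y + scl (1 / lam) (nest n x y) - (Phi ^^ n) (Cas * (E x * E y))"
    by (simp add: nest_def funpow_Phi_add funpow_Phi_diff funpow_Phi_scl funpow_swap1)
  also have "\<dots> \<approx> nest (Suc n) x y + scl (1 / lam) (nest n x y) - Cas * nest n x y"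
    unfolding nest_def by (intro ucong_diff ucong_refl funpow_Phi_central central_Cas)
  finally show ?thesis .
qed

lemma funpow_rung_op_cong:
  assumes "\<And>x y. x < m \<Longrightarrow> y < m \<Longrightarrow> V x y \<approx> V' x y" "x < m" "y < m"
  shows "(rung_op ^^ i) V x y \<approx> (rung_op ^^ i) V' x y"
  using assms(2,3)
proof (induction i arbitrary: x y)
  case (Suc i)
  show ?case unfolding funpow.simps o_apply rung_op_def[of "(rung_op ^^ i) _"] by (intro ucong_sum ucong_scl Suc.IH) auto
qed (simp add: assms(1))

lemma funpow_rung_op_linear:
  "(rung_op ^^ i) (\<lambda>x y. V x y + scl r (V' x y) - A * V'' x y)
    = (\<lambda>x y. (rung_op ^^ i) V x y + scl r ((rung_op ^^ i) V' x y) - A * (rung_op ^^ i) V'' x y)"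
proof (induction i)
  case (Suc i)
  show ?case unfolding funpow.simps o_apply Suc
    by (simp add: rung_op_def fun_eq_iff fa.scale_right_distrib fa.scale_right_diff_distrib sum.distrib sum_subtractf
        fa.scale_sum_right sum_distrib_left mult.commute)
qed simp

lemma ladder_val_recursion:
  "ladder_val (Suc i) n \<approx> ladder_val i (Suc n) + scl (1 / lam) (ladder_val i n) - Cas * ladder_val i n"
proof -
  let ?V = "\<lambda>n. (rung_op ^^ i) (nest n)"
  have "ladder_val (Suc i) n = (\<Sum>p<m. \<Sum>q<m. \<Sum>x<m. \<Sum>y<m.
      scl (g p x * g q y) (E p * (rung_op ^^ i) (rung_op (nest n)) x y * E q))"
    by (simp add: ladder_val_def funpow_swap1)
  also have "\<dots> \<approx> (\<Sum>p<m. \<Sum>q<m. \<Sum>x<m. \<Sum>y<m. scl (g p x * g q y)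
      (E p * (rung_op ^^ i) (\<lambda>x y. nest (Suc n) x y + scl (1 / lam) (nest n x y) - Cas * nest n x y) x y * E q))"
    by (intro ucong_sum ucong_scl ucong_mult ucong_refl funpow_rung_op_cong rung_op_nest) auto
  also have "\<dots> = ladder_val i (Suc n) + scl (1 / lam) (ladder_val i n)
      - (\<Sum>p<m. \<Sum>q<m. \<Sum>x<m. \<Sum>y<m. scl (g p x * g q y) (E p * Cas * (?V n x y * E q)))"
    unfolding funpow_rung_op_linear
    by (simp add: ladder_val_def distrib_left distrib_right right_diff_distrib left_diff_distrib fa.scale_right_distrib
        fa.scale_right_diff_distrib sum.distrib sum_subtractf fa.scale_sum_right mult.assoc
        mult.left_commute[of "1 / lam"])
  also have "\<dots> \<approx> ladder_val i (Suc n) + scl (1 / lam) (ladder_val i n)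
      - (\<Sum>p<m. \<Sum>q<m. \<Sum>x<m. \<Sum>y<m. scl (g p x * g q y) (Cas * E p * (?V n x y * E q)))"
    using central_Cas by (intro ucong_diff ucong_sum ucong_scl ucong_mult_right ucong_refl) (simp add: central_def)
  also have "\<dots> = ladder_val i (Suc n) + scl (1 / lam) (ladder_val i n) - Cas * ladder_val i n"
    by (simp add: ladder_val_def sum_distrib_left mult.assoc)
  finally show ?thesis .
qed

end

section \<open>Components\<close>

lemma equiv_comps: "equiv UNIV ((adj D \<union> (adj D)\<inverse>)\<^sup>*)"
  by (intro equivI refl_rtrancl sym_rtrancl trans_rtrancl) (auto simp: sym_def)

lemma comps_disjoint:
  assumes "C \<in> comps D" "C' \<in> comps D" "C \<noteq> C'"
  shows "C \<inter> C' = {}"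
proof -
  have "C \<in> UNIV // ((adj D \<union> (adj D)\<inverse>)\<^sup>*)" "C' \<in> UNIV // ((adj D \<union> (adj D)\<inverse>)\<^sup>*)"
    using assms by (auto simp: comps_def quotient_def)
  with assms(3) show ?thesis using quotient_disj[OF equiv_comps] by blast
qed

lemma comps_adj: "C \<in> comps D \<Longrightarrow> (x,y) \<in> adj D \<Longrightarrow> x \<in> C \<longleftrightarrow> y \<in> C"
  by (auto simp: comps_def quotient_def intro: rtrancl_into_rtrancl)

lemma Union_comps_adj: "\<B> \<subseteq> comps D \<Longrightarrow> (x,y) \<in> adj D \<Longrightarrow> x \<in> \<Union>\<B> \<longleftrightarrow> y \<in> \<Union>\<B>"
  using comps_adj by blast

lemma mem_Union_comps: "\<B> \<subseteq> comps D \<Longrightarrow> C \<in> comps D \<Longrightarrow> x \<in> C \<Longrightarrow> x \<in> \<Union>\<B> \<longleftrightarrow> C \<in> \<B>"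
  using comps_disjoint[of C D] by blast

lemma comps_nonempty: "C \<in> comps D \<Longrightarrow> C \<noteq> {}"
  by (auto simp: comps_def quotient_def)

lemma comps_connected:
  assumes "C \<in> comps D" "x \<in> C" "y \<in> C"
  shows "(x,y) \<in> (adj D \<union> (adj D)\<inverse>)\<^sup>*"
proof -
  obtain z where "(z,x) \<in> (adj D \<union> (adj D)\<inverse>)\<^sup>*" "(z,y) \<in> (adj D \<union> (adj D)\<inverse>)\<^sup>*"
    using assms by (auto simp: comps_def quotient_def)
  then show ?thesis using equiv_comps[of D] by (metis equivE symD transD)
qed

lemma adj_halfedges: "wf_diag D \<Longrightarrow> (x,y) \<in> adj D \<Longrightarrow> x \<in> halfedges D \<and> y \<in> halfedges D"
  by (auto simp: adj_def wf_diag_def halfedges_def)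

lemma Union_comps:
  assumes "wf_diag D"
  shows "\<Union>(comps D) = halfedges D"
proof
  show "halfedges D \<subseteq> \<Union>(comps D)" by (auto simp: comps_def quotient_def)
  have "y \<in> halfedges D" if "(x,y) \<in> (adj D \<union> (adj D)\<inverse>)\<^sup>*" "x \<in> halfedges D" for x y
    using that by (induction rule: rtrancl_induct) (auto dest: adj_halfedges[OF assms])
  then show "\<Union>(comps D) \<subseteq> halfedges D" by (auto simp: comps_def quotient_def)
qed

lemma comps_eqI:
  assumes union: "\<Union>\<Q> = halfedges D"
    and closed: "\<And>Q x y. Q \<in> \<Q> \<Longrightarrow> (x,y) \<in> adj D \<Longrightarrow> x \<in> Q \<longleftrightarrow> y \<in> Q"
    and connected: "\<And>Q. Q \<in> \<Q> \<Longrightarrow> \<exists>r\<in>Q. \<forall>x\<in>Q. (r,x) \<in> (adj D \<union> (adj D)\<inverse>)\<^sup>*"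
  shows "comps D = \<Q>"
proof -
  let ?R = "(adj D \<union> (adj D)\<inverse>)\<^sup>*"
  have image: "?R `` {x} = Q" if Q: "Q \<in> \<Q>" and x: "x \<in> Q" for Q x
  proof
    have "y \<in> Q" if "(x,y) \<in> ?R" for y
      using that x by (induction rule: rtrancl_induct) (use closed[OF Q] in auto)
    then show "?R `` {x} \<subseteq> Q" by auto
    obtain r where r: "\<And>y. y \<in> Q \<Longrightarrow> (r,y) \<in> ?R" using connected[OF Q] by blast
    have "sym ?R" by (intro sym_rtrancl) (auto simp: sym_def)
    then show "Q \<subseteq> ?R `` {x}" using r[OF x] r by (auto dest: symD intro: rtrancl_trans)
  qed
  have nonempty: "Q \<noteq> {}" if "Q \<in> \<Q>" for Q using connected[OF that] by blast
  have "comps D = (\<Union>Q\<in>\<Q>. \<Union>x\<in>Q. {?R `` {x}})" unfolding comps_def quotient_def union[symmetric] by blast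
  also have "\<dots> = (\<Union>Q\<in>\<Q>. \<Union>x\<in>Q. {Q})" by (intro SUP_cong refl) (simp add: image)
  also have "\<dots> = \<Q>" using nonempty by auto
  finally show ?thesis .
qed

lemma comps_singletonI:
  assumes wf: "wf_diag D" and r: "r \<in> halfedges D"
    and connected: "\<And>U. (\<And>x y. (x,y) \<in> adj D \<Longrightarrow> x \<in> U \<longleftrightarrow> y \<in> U) \<Longrightarrow> r \<in> U \<Longrightarrow> halfedges D \<subseteq> U"
  shows "comps D = {halfedges D}"
proof (rule comps_eqI)
  let ?U = "(adj D \<union> (adj D)\<inverse>)\<^sup>* `` {r}"
  have "halfedges D \<subseteq> ?U"
    by (rule connected) (auto intro: rtrancl_into_rtrancl)
  then show "\<exists>r\<in>Q. \<forall>x\<in>Q. (r,x) \<in> (adj D \<union> (adj D)\<inverse>)\<^sup>*" if "Q \<in> {halfedges D}" for Q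
    using that r by auto
qed (use adj_halfedges[OF wf] in auto)

lemma finite_halfedges: "finite (halfedges D)"
  by (auto simp: halfedges_def)

lemma finite_comps: "finite (comps D)"
proof -
  have "comps D = (\<lambda>x. (adj D \<union> (adj D)\<inverse>)\<^sup>* `` {x}) ` halfedges D"
    by (auto simp: comps_def quotient_def)
  then show ?thesis by (simp add: finite_halfedges)
qed

lemma halfedges_subdiag:
  assumes closed: "\<And>x y. (x,y) \<in> adj D \<Longrightarrow> x \<in> U \<longleftrightarrow> y \<in> U"
  shows "halfedges (subdiag D U) = halfedges D \<inter> U"
proof -
  have "{a,b,d} \<inter> U = (if a \<in> U then {a,b,d} else {})" if "(a,b,d) \<in> set (dverts D)" for a b d
  proof -
    have "(a,b) \<in> adj D" "(b,d) \<in> adj D" using that by (force simp: adj_def)+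
    then show ?thesis using closed[of a b] closed[of b d] by auto
  qed
  then have "(\<Union>(a,b,d)\<in>set (dverts D). {a,b,d} \<inter> U) = (\<Union>(a,b,d)\<in>set (dverts D). if a \<in> U then {a,b,d} else {})"
    by (intro SUP_cong refl) (simp add: case_prod_unfold)
  also have "\<dots> = (\<Union>(a,b,d)\<in>{(a,b,d) \<in> set (dverts D). a \<in> U}. {a,b,d})"
    by (force split: if_splits)
  finally have "(\<Union>(a,b,d)\<in>set (dverts D). {a,b,d}) \<inter> U = (\<Union>(a,b,d)\<in>{(a,b,d) \<in> set (dverts D). a \<in> U}. {a,b,d})"
    by (simp add: case_prod_unfold)
  moreover have "set (filter (\<lambda>h. h \<in> U) (dloop D)) = set (dloop D) \<inter> U" by auto
  ultimately show ?thesis by (simp add: halfedges_def subdiag_def Int_Un_distrib2 case_prod_unfold)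
qed

lemma wf_subdiag:
  assumes wf: "wf_diag D" and closed: "\<And>x y. (x,y) \<in> adj D \<Longrightarrow> x \<in> U \<longleftrightarrow> y \<in> U"
  shows "wf_diag (subdiag D U)"
proof -
  have "x \<in> halfedges D \<inter> U \<and> y \<in> halfedges D \<inter> U" if "(x,y) \<in> set (dedges (subdiag D U))" for x y
  proof -
    have xy: "(x,y) \<in> adj D" "x \<in> U" using that by (auto simp: subdiag_def adj_def)
    then show ?thesis using adj_halfedges[OF wf xy(1)] closed[OF xy(1)] by blast
  qed
  moreover have "halfedges (subdiag D U) = halfedges D \<inter> U" by (rule halfedges_subdiag) (rule closed)
  ultimately show ?thesis by (auto simp: wf_diag_def)
qed

lemma subdiag_halfedges:
  assumes "wf_diag D"
  shows "subdiag D (halfedges D) = D"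
proof -
  have "filter (\<lambda>h. h \<in> halfedges D) (dloop D) = dloop D"
    by (intro filter_True) (auto simp: halfedges_def)
  moreover have "filter (\<lambda>(a,_,_). a \<in> halfedges D) (dverts D) = dverts D"
    by (intro filter_True) (force simp: halfedges_def)
  moreover have "filter (\<lambda>(a,_). a \<in> halfedges D) (dedges D) = dedges D"
    using assms by (intro filter_True) (auto simp: wf_diag_def)
  ultimately show ?thesis by (simp add: subdiag_def)
qed

lemma subdiag_comps: "wf_diag D \<Longrightarrow> subdiag D (\<Union>(comps D)) = D"
  by (simp only: Union_comps subdiag_halfedges)

lemma sorted_wrt_distinctI:
  assumes "distinct xs" "\<And>x y. x \<in> set xs \<Longrightarrow> y \<in> set xs \<Longrightarrow> x \<noteq> y \<Longrightarrow> R x y"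
  shows "sorted_wrt R xs"
  using assms by (induction xs) auto

lemma partition_on_card_cases:
  assumes "finite A" "A \<noteq> {}" "partition_on A P"
  shows "P = {A} \<or> card P \<ge> 2"
proof (cases "card P = 1")
  case True
  then obtain B where "P = {B}" by (rule card_1_singletonE)
  then show ?thesis using assms(3) by (simp add: partition_on_def)
next
  case False
  have "P \<noteq> {}" using assms(2,3) by (auto simp: partition_on_def)
  then have "card P \<noteq> 0" using finite_elements[OF assms(1,3)] by simp
  with False show ?thesis by linarith
qed

context metrized_simple_lie
begin

lemma wval_split_prod:
  assumes wf: "wf_diag D" and fin: "finite (comps D)" and P: "partition_on (comps D) P"
  obtains Bs where "distinct Bs" "set Bs = P" "wval (split_prod D P) = prod_list (map (\<lambda>B. wval (subdiag D (\<Union>B))) Bs)"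
proof -
  define Bs where "Bs = (SOME Bs. distinct Bs \<and> set Bs = P)"
  have "\<exists>Bs. distinct Bs \<and> set Bs = P" using finite_distinct_list[OF finite_elements[OF fin P]] by blast
  then have Bs: "distinct Bs" "set Bs = P" unfolding Bs_def by (metis (mono_tags, lifting) someI_ex)+
  let ?Ds = "map (\<lambda>B. subdiag D (\<Union>B)) Bs"
  have sub: "B \<subseteq> comps D" if "B \<in> set Bs" for B
    by (rule partition_on_subset[OF P]) (simp only: that flip: Bs(2))
  have closed: "x \<in> \<Union>B \<longleftrightarrow> y \<in> \<Union>B" if "B \<in> set Bs" "(x,y) \<in> adj D" for B x y
    by (rule Union_comps_adj[OF sub[OF that(1)] that(2)])
  have half: "halfedges (subdiag D (\<Union>B)) = halfedges D \<inter> \<Union>B" if "B \<in> set Bs" for B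
    by (rule halfedges_subdiag) (rule closed[OF that])
  have "sorted_wrt (\<lambda>B B'. halfedges (subdiag D (\<Union>B)) \<inter> halfedges (subdiag D (\<Union>B')) = {}) Bs"
  proof (rule sorted_wrt_distinctI[OF Bs(1)])
    fix B B' assume B: "B \<in> set Bs" "B' \<in> set Bs" "B \<noteq> B'"
    then have "B \<inter> B' = {}" using partition_on_disjoint[OF P] Bs(2) by simp
    then have "\<Union>B \<inter> \<Union>B' = {}" using comps_disjoint[of _ D] sub[OF B(1)] sub[OF B(2)] by blast
    then show "halfedges (subdiag D (\<Union>B)) \<inter> halfedges (subdiag D (\<Union>B')) = {}"
      unfolding half[OF B(1)] half[OF B(2)] by blast
  qed
  then have "sorted_wrt (\<lambda>D D'. halfedges D \<inter> halfedges D' = {}) ?Ds" by (simp add: sorted_wrt_map)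
  moreover have "wf_diag (subdiag D (\<Union>B))" if "B \<in> set Bs" for B
    by (rule wf_subdiag[OF wf]) (rule closed[OF that])
  ultimately have "wval (foldr dmult ?Ds dunit) = prod_list (map wval ?Ds)"
    using wval_foldr_dmult[of ?Ds] by auto
  then have "wval (split_prod D P) = prod_list (map (\<lambda>B. wval (subdiag D (\<Union>B))) Bs)"
    by (simp add: split_prod_def Bs_def[symmetric] o_def)
  then show thesis using that Bs by blast
qed

definition wval_prim :: "diagram \<Rightarrow> fa" where
  "wval_prim D = (\<Sum>P | partition_on (comps D) P. scl (pi_coeff (card P)) (wval (split_prod D P)))"

lemma coef_wval_prim:
  assumes wf: "wf_diag D" and fin: "finite (comps D)" and nonempty: "comps D \<noteq> {}"
  shows "coef (wval_prim D) = wbar m c lam D"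
proof
  fix w
  let ?A = "comps D"
  let ?S = "{P. partition_on ?A P \<and> card P \<ge> 2}"
  have trivial: "partition_on ?A {?A}" using nonempty by (auto simp: partition_on_def)
  then have "{P. partition_on ?A P} = insert {?A} ?S"
    using partition_on_card_cases[OF fin nonempty] by auto
  moreover have "finite ?S" using finitely_many_partition_on[OF fin] by (rule finite_subset[rotated]) auto
  moreover have "{?A} \<notin> ?S" by simp
  ultimately have "coef (wval_prim D) w = pi_coeff 1 * wsys m c lam (split_prod D {?A}) w
      + (\<Sum>P\<in>?S. pi_coeff (card P) * wsys m c lam (split_prod D P) w)"
    by (simp add: wval_prim_def lookup_add lookup_sum coef_scl coef_wval)
  also have "(\<Sum>P\<in>?S. pi_coeff (card P) * wsys m c lam (split_prod D P) w)
      = - (\<Sum>P\<in>?S. (-1) ^ card P * of_nat (fact (card P - 1)) * wsys m c lam (split_prod D P) w)"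
    unfolding sum_negf[symmetric] by (simp add: pi_coeff_def)
  also have "wsys m c lam (split_prod D {?A}) = wsys m c lam D"
  proof -
    obtain Bs where Bs: "distinct Bs" "set Bs = {?A}"
      "wval (split_prod D {?A}) = prod_list (map (\<lambda>B. wval (subdiag D (\<Union>B))) Bs)"
      by (rule wval_split_prod[OF wf fin trivial])
    have "Bs = [?A]" using Bs(1,2) by (cases Bs) (auto dest: subset_singletonD)
    then show ?thesis using Bs(3) subdiag_comps[OF wf] coef_wval by (simp flip: coef_wval)
  qed
  finally show "coef (wval_prim D) w = wbar m c lam D w" by (simp add: wbar_def pi_coeff_def)
qed

end

section \<open>Parallel chords on a diagram\<close>

definition chord_sets :: "(nat \<times> nat) list \<Rightarrow> nat set set" where
  "chord_sets cs = (\<lambda>(x,y). {x,y}) ` set cs"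

lemma fresh_chords_notin: "fresh_chords H cs \<Longrightarrow> (x,y) \<in> set cs \<Longrightarrow> x \<notin> H \<and> y \<notin> H"
  by (force simp: fresh_chords_def)

lemma fresh_chords_eq:
  assumes "fresh_chords H cs" "e \<in> set cs" "e' \<in> set cs" "{fst e, snd e} \<inter> {fst e', snd e'} \<noteq> {}"
  shows "e = e'"
proof -
  have "inj_on fst (set cs)" "inj_on snd (set cs)" "fst ` set cs \<inter> snd ` set cs = {}"
    using assms(1) by (auto simp: fresh_chords_def distinct_map)
  then show ?thesis using assms(2-4) by (auto dest: inj_onD)
qed

lemma chord_sets_disjoint:
  assumes "fresh_chords H cs" "C \<in> chord_sets cs"
  shows "C \<inter> H = {}"
  using assms fresh_chords_notin[OF assms(1)] by (auto simp: chord_sets_def)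

lemma chord_set_closed:
  assumes fresh: "fresh_chords H cs" and C: "C \<in> chord_sets cs" and xy: "(x,y) \<in> set cs"
  shows "x \<in> C \<longleftrightarrow> y \<in> C"
proof -
  obtain a b where ab: "(a,b) \<in> set cs" "C = {a,b}" using C by (auto simp: chord_sets_def)
  have "(a,b) = (x,y)" if "x \<in> C \<or> y \<in> C"
    by (rule fresh_chords_eq[OF fresh ab(1) xy]) (use that ab(2) in auto)
  then show ?thesis using ab(2) by auto
qed

lemma card_chord_sets_filter:
  assumes fresh: "fresh_chords H cs"
  shows "card {C \<in> chord_sets cs. p C} = length (filter (\<lambda>(x,y). p {x,y}) cs)"
proof -
  have "inj_on (\<lambda>(x,y). {x,y}) (set cs)"
    by (rule inj_onI, rule fresh_chords_eq[OF fresh]) auto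
  then have "inj_on (\<lambda>(x,y). {x,y}) {(x,y) \<in> set cs. p {x,y}}" by (rule inj_on_subset) auto
  moreover have "{C \<in> chord_sets cs. p C} = (\<lambda>(x,y). {x,y}) ` {(x,y) \<in> set cs. p {x,y}}"
    by (auto simp: chord_sets_def)
  moreover have "distinct (filter (\<lambda>(x,y). p {x,y}) cs)"
    using fresh by (auto simp: fresh_chords_def distinct_map)
  then have "card {(x,y) \<in> set cs. p {x,y}} = length (filter (\<lambda>(x,y). p {x,y}) cs)"
    by (auto dest: distinct_card simp: case_prod_unfold)
  ultimately show ?thesis by (simp add: card_image)
qed

lemma card_chord_sets: "fresh_chords H cs \<Longrightarrow> card (chord_sets cs) = length cs"
  using card_chord_sets_filter[of H cs "\<lambda>_. True"] by simp

lemma finite_chord_sets: "finite (chord_sets cs)"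
  by (simp add: chord_sets_def)

lemma halfedges_chorded:
  "halfedges (chorded l1 l2 l3 vs es cs) = halfedges (chorded l1 l2 l3 vs es []) \<union> \<Union>(chord_sets cs)"
proof -
  have "\<Union>(chord_sets cs) = fst ` set cs \<union> snd ` set cs" by (force simp: chord_sets_def)
  then show ?thesis by (simp add: halfedges_def chorded_def Un_ac)
qed

lemma adj_chorded: "adj (chorded l1 l2 l3 vs es cs) = adj (chorded l1 l2 l3 vs es []) \<union> set cs"
  by (auto simp: adj_def chorded_def)

lemma wf_chorded: "wf_diag (chorded l1 l2 l3 vs es []) \<Longrightarrow> wf_diag (chorded l1 l2 l3 vs es cs)"
  unfolding wf_diag_def halfedges_chorded[of _ _ _ _ _ cs] by (force simp: chorded_def chord_sets_def)

lemma comps_chorded: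
  assumes wf: "wf_diag (chorded l1 l2 l3 vs es [])" and fresh: "fresh_chords (halfedges (chorded l1 l2 l3 vs es [])) cs"
  shows "comps (chorded l1 l2 l3 vs es cs) = comps (chorded l1 l2 l3 vs es []) \<union> chord_sets cs"
proof (rule comps_eqI)
  let ?K = "chorded l1 l2 l3 vs es []" and ?D = "chorded l1 l2 l3 vs es cs"
  show "\<Union>(comps ?K \<union> chord_sets cs) = halfedges ?D"
    unfolding halfedges_chorded[of _ _ _ _ _ cs] using Union_comps[OF wf] by simp
  show "x \<in> Q \<longleftrightarrow> y \<in> Q" if "Q \<in> comps ?K \<union> chord_sets cs" "(x,y) \<in> adj ?D" for Q x y
    using that(1)
  proof
    assume Q: "Q \<in> comps ?K"
    then have "Q \<subseteq> halfedges ?K" using Union_comps[OF wf] by blast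
    then show ?thesis
      using that(2) comps_adj[OF Q] fresh_chords_notin[OF fresh] unfolding adj_chorded[of _ _ _ _ _ cs] by blast
  next
    assume Q: "Q \<in> chord_sets cs"
    show ?thesis
      using that(2) chord_set_closed[OF fresh Q] chord_sets_disjoint[OF fresh Q] adj_halfedges[OF wf]
      unfolding adj_chorded[of _ _ _ _ _ cs] by blast
  qed
  show "\<exists>r\<in>Q. \<forall>x\<in>Q. (r,x) \<in> (adj ?D \<union> (adj ?D)\<inverse>)\<^sup>*" if "Q \<in> comps ?K \<union> chord_sets cs" for Q
    using that
  proof
    assume Q: "Q \<in> comps ?K"
    have "(adj ?K \<union> (adj ?K)\<inverse>)\<^sup>* \<subseteq> (adj ?D \<union> (adj ?D)\<inverse>)\<^sup>*"
      by (rule rtrancl_mono) (auto simp: adj_chorded[of _ _ _ _ _ cs])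
    then show ?thesis using comps_connected[OF Q] comps_nonempty[OF Q] by blast
  next
    assume "Q \<in> chord_sets cs"
    then obtain x y where "(x,y) \<in> set cs" "Q = {x,y}" by (auto simp: chord_sets_def)
    then show ?thesis by (auto simp: adj_def chorded_def)
  qed
qed

lemma subdiag_chorded:
  assumes "\<And>x y. (x,y) \<in> set cs \<Longrightarrow> x \<in> U \<longleftrightarrow> y \<in> U"
  shows "subdiag (chorded l1 l2 l3 vs es cs) U = chorded (filter (\<lambda>h. h \<in> U) l1) (filter (\<lambda>h. h \<in> U) l2)
    (filter (\<lambda>h. h \<in> U) l3) (filter (\<lambda>(a,_,_). a \<in> U) vs) (filter (\<lambda>(a,_). a \<in> U) es) (filter (\<lambda>(a,_). a \<in> U) cs)"
proof -
  have "filter (\<lambda>(a,_). a \<in> U) cs = filter (\<lambda>(_,b). b \<in> U) cs" using assms by (intro filter_cong) auto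
  then have "filter (\<lambda>h. h \<in> U) (rev (map snd cs)) = rev (map snd (filter (\<lambda>(a,_). a \<in> U) cs))"
    by (simp add: filter_map o_def case_prod_unfold flip: rev_filter)
  moreover have "filter (\<lambda>h. h \<in> U) (map fst cs) = map fst (filter (\<lambda>(a,_). a \<in> U) cs)"
    by (simp add: filter_map o_def case_prod_unfold)
  ultimately show ?thesis by (simp add: subdiag_def chorded_def)
qed

lemma sum_list_card_Int_blocks:
  assumes P: "partition_on A P" and "finite A" "C \<subseteq> A" and Bs: "distinct Bs" "set Bs = P"
  shows "sum_list (map (\<lambda>B. card (C \<inter> B)) (filter p Bs)) = card (C \<inter> \<Union>{B \<in> P. p B})"
proof -
  have "finite {B \<in> P. p B}" using finite_elements[OF \<open>finite A\<close> P] by simp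
  moreover have "finite (C \<inter> B)" for B using assms(2,3) by (auto intro: finite_subset)
  moreover have "(C \<inter> B) \<inter> (C \<inter> B') = {}" if "B \<in> P" "B' \<in> P" "B \<noteq> B'" for B B'
    using partition_on_disjoint[OF P, of B B'] that by blast
  ultimately have "card (\<Union>B\<in>{B \<in> P. p B}. C \<inter> B) = (\<Sum>B\<in>{B \<in> P. p B}. card (C \<inter> B))"
    by (intro card_UN_disjoint) blast+
  moreover have "(\<Sum>B\<in>{B \<in> P. p B}. card (C \<inter> B)) = sum_list (map (\<lambda>B. card (C \<inter> B)) (filter p Bs))"
    using Bs by (simp add: sum_list_distinct_conv_sum_set)
  ultimately show ?thesis by (simp only: Int_Union)
qed

context metrized_simple_lie
begin

lemma prod_list_central:
  assumes z: "central z" and words: "\<And>x. x \<in> set xs \<Longrightarrow> words (w x) \<subseteq> lists {..<m}"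
    and w: "\<And>x. x \<in> set xs \<Longrightarrow> \<not> p x \<Longrightarrow> w x \<approx> z ^ k x"
  shows "prod_list (map w xs) \<approx> z ^ sum_list (map k (filter (\<lambda>x. \<not> p x) xs)) * prod_list (map w (filter p xs))"
  using words w
proof (induction xs)
  case (Cons x xs)
  let ?k = "sum_list (map k (filter (\<lambda>x. \<not> p x) xs))" and ?r = "prod_list (map w (filter p xs))"
  have "prod_list (map w xs) \<approx> z ^ ?k * ?r" using Cons by simp
  then have "prod_list (map w (x # xs)) \<approx> (w x * z ^ ?k) * ?r"
    using ucong_mult_left by (simp add: mult.assoc)
  also have "(w x * z ^ ?k) * ?r
      \<approx> z ^ sum_list (map k (filter (\<lambda>x. \<not> p x) (x # xs))) * prod_list (map w (filter p (x # xs)))"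
  proof (cases "p x")
    case True
    have "w x * z ^ ?k \<approx> z ^ ?k * w x" using Cons.prems(1) by (intro central_commute central_power z) simp
    from ucong_mult_right[OF this, of ?r] show ?thesis using True by (simp add: mult.assoc)
  next
    case False
    then have "w x \<approx> z ^ k x" using Cons.prems(2) by simp
    then have "w x * z ^ ?k * ?r \<approx> z ^ k x * z ^ ?k * ?r" by (intro ucong_mult_right)
    then show ?thesis using False by (simp add: power_add)
  qed
  finally show ?case .
qed simp

end

locale chorded_diagram = metrized_simple_lie +
  fixes l1 l2 l3 :: "nat list" and vs :: "(nat \<times> nat \<times> nat) list" and es cs :: "(nat \<times> nat) list"
  assumes wf_core: "wf_diag (chorded l1 l2 l3 vs es [])"
    and fresh: "fresh_chords (halfedges (chorded l1 l2 l3 vs es [])) cs"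
begin

abbreviation core :: diagram where
  "core \<equiv> chorded l1 l2 l3 vs es []"

abbreviation chorded_core :: diagram where
  "chorded_core \<equiv> chorded l1 l2 l3 vs es cs"

text \<open>The value of the part \<open>U\<close> of the core together with \<open>n\<close> of the parallel chords.\<close>
definition part_val :: "nat set \<Rightarrow> nat \<Rightarrow> fa" where
  "part_val U = chorded_val (filter (\<lambda>h. h \<in> U) l1) (filter (\<lambda>h. h \<in> U) l2) (filter (\<lambda>h. h \<in> U) l3)
    (filter (\<lambda>(a,_,_). a \<in> U) vs) (filter (\<lambda>(a,_). a \<in> U) es)"

lemma comps_core_chord_sets_disjoint: "comps core \<inter> chord_sets cs = {}"
proof -
  have "C = {}" if "C \<in> comps core" "C \<in> chord_sets cs" for C
    using Union_comps[OF wf_core] chord_sets_disjoint[OF fresh that(2)] that(1) by blast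
  then show ?thesis using comps_nonempty by blast
qed

lemma part_val_cong:
  assumes U: "\<And>x. x \<in> halfedges core \<Longrightarrow> x \<in> U \<longleftrightarrow> x \<in> V"
  shows "part_val U = part_val V"
proof -
  have "filter (\<lambda>h. h \<in> U) l = filter (\<lambda>h. h \<in> V) l" if "set l \<subseteq> halfedges core" for l
    using U that by (intro filter_cong) auto
  moreover have "set l1 \<subseteq> halfedges core" "set l2 \<subseteq> halfedges core" "set l3 \<subseteq> halfedges core"
    by (auto simp: halfedges_def chorded_def)
  moreover have "filter (\<lambda>(a,_,_). a \<in> U) vs = filter (\<lambda>(a,_,_). a \<in> V) vs"
  proof (intro filter_cong refl)
    fix v assume v: "v \<in> set vs"
    then have "fst v \<in> halfedges core" by (force simp: halfedges_def chorded_def)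
    then show "(case v of (a,_,_) \<Rightarrow> a \<in> U) \<longleftrightarrow> (case v of (a,_,_) \<Rightarrow> a \<in> V)" using U by (simp add: case_prod_unfold)
  qed
  moreover have "filter (\<lambda>(a,_). a \<in> U) es = filter (\<lambda>(a,_). a \<in> V) es"
  proof (intro filter_cong refl)
    fix e assume e: "e \<in> set es"
    then have "fst e \<in> halfedges core" using wf_core by (force simp: wf_diag_def chorded_def)
    then show "(case e of (a,_) \<Rightarrow> a \<in> U) \<longleftrightarrow> (case e of (a,_) \<Rightarrow> a \<in> V)" using U by (simp add: case_prod_unfold)
  qed
  ultimately show ?thesis unfolding part_val_def by (simp only:)
qed

lemma fresh_filter: "fresh_chords (halfedges core \<inter> U) (filter p cs)"
  using fresh by (auto simp: fresh_chords_def distinct_map_filter)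

lemma finite_core_chord_sets: "finite (comps core \<union> chord_sets cs)"
  by (simp add: finite_comps finite_chord_sets)

lemma wval_block:
  assumes B: "\<B> \<subseteq> comps core \<union> chord_sets cs"
  shows "wval (subdiag chorded_core (\<Union>\<B>)) = part_val (\<Union>(comps core \<inter> \<B>)) (card (chord_sets cs \<inter> \<B>))"
proof -
  define U where "U = \<Union>\<B>"
  let ?cs = "filter (\<lambda>(a,_). a \<in> U) cs"
  have sub: "\<B> \<subseteq> comps chorded_core" using B by (simp add: comps_chorded[OF wf_core fresh])
  have closed: "x \<in> U \<longleftrightarrow> y \<in> U" if "(x,y) \<in> adj chorded_core" for x y
    unfolding U_def by (rule Union_comps_adj[OF sub that])
  have closed_core: "x \<in> U \<longleftrightarrow> y \<in> U" if "(x,y) \<in> adj core" for x y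
    by (rule closed) (use that in \<open>simp add: adj_chorded[of _ _ _ _ _ cs]\<close>)
  have closed_chord: "x \<in> U \<longleftrightarrow> y \<in> U" if "(x,y) \<in> set cs" for x y
    by (rule closed) (use that in \<open>simp add: adj_chorded[of _ _ _ _ _ cs]\<close>)
  have core: "subdiag core U = chorded (filter (\<lambda>h. h \<in> U) l1) (filter (\<lambda>h. h \<in> U) l2) (filter (\<lambda>h. h \<in> U) l3)
      (filter (\<lambda>(a,_,_). a \<in> U) vs) (filter (\<lambda>(a,_). a \<in> U) es) []"
    using subdiag_chorded[of "[]" U l1 l2 l3 vs es] by simp
  have wf: "wf_diag (subdiag core U)" by (rule wf_subdiag[OF wf_core]) (rule closed_core)
  have half: "halfedges (subdiag core U) = halfedges core \<inter> U" by (rule halfedges_subdiag) (rule closed_core)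
  have "subdiag chorded_core U = chorded (filter (\<lambda>h. h \<in> U) l1) (filter (\<lambda>h. h \<in> U) l2) (filter (\<lambda>h. h \<in> U) l3)
      (filter (\<lambda>(a,_,_). a \<in> U) vs) (filter (\<lambda>(a,_). a \<in> U) es) ?cs"
    by (rule subdiag_chorded) (rule closed_chord)
  then have "wval (subdiag chorded_core U) = part_val U (length ?cs)"
    unfolding part_val_def
    by (simp only: wval_chorded[OF wf[unfolded core] fresh_filter[of U, folded half, unfolded core]])
  moreover have "part_val U = part_val (\<Union>(comps core \<inter> \<B>))"
    using B chord_sets_disjoint[OF fresh] unfolding U_def by (intro part_val_cong) blast
  moreover have "length ?cs = card (chord_sets cs \<inter> \<B>)"
  proof -
    have "x \<in> U \<longleftrightarrow> {x,y} \<in> \<B>" if "(x,y) \<in> set cs" for x y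
      unfolding U_def
    proof (rule mem_Union_comps[OF sub])
      show "{x,y} \<in> comps chorded_core"
        using that unfolding comps_chorded[OF wf_core fresh] by (force simp: chord_sets_def)
    qed simp
    then have "?cs = filter (\<lambda>(x,y). {x,y} \<in> \<B>) cs" by (intro filter_cong) auto
    then show ?thesis using card_chord_sets_filter[OF fresh, of "\<lambda>C. C \<in> \<B>"] by (simp add: Int_def)
  qed
  ultimately show ?thesis by (simp only: U_def)
qed

lemma part_val_empty: "part_val {} n \<approx> Cas ^ n"
proof -
  have "part_val {} n = (Phi ^^ n) 1"
    by (simp add: part_val_def chorded_val_def halfedges_def chorded_def edge_weight_def vert_weight_def word_Nil)
  then show ?thesis using funpow_Phi_one by simp
qed

text \<open>\<open>Ss\<close> lists the parts of the splitting \<open>T\<close> of the core, each with the number of chords added to it.\<close>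
definition splits_as :: "nat set set set \<Rightarrow> (nat \<Rightarrow> fa) \<Rightarrow> bool" where
  "splits_as T Y \<longleftrightarrow> (\<forall>Ss. distinct (map fst Ss) \<longrightarrow> set (map fst Ss) = T \<longrightarrow>
    prod_list (map (\<lambda>(S,n). part_val (\<Union>S) n) Ss) \<approx> Y (sum_list (map snd Ss)))"

lemma prod_list_touching:
  assumes P: "partition_on (comps core \<union> chord_sets cs) P" and Y: "splits_as (trace (comps core) P) Y"
    and Bs: "distinct Bs" "set Bs = P"
  shows "prod_list (map (\<lambda>B. part_val (\<Union>(comps core \<inter> B)) (card (chord_sets cs \<inter> B)))
      (filter (\<lambda>B. comps core \<inter> B \<noteq> {}) Bs))
    \<approx> Y (card (chord_sets cs \<inter> \<Union>(touching (comps core) P)))"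
proof -
  let ?Q = "comps core" and ?Ch = "chord_sets cs"
  let ?touching = "filter (\<lambda>B. ?Q \<inter> B \<noteq> {}) Bs"
  let ?Ss = "map (\<lambda>B. (?Q \<inter> B, card (?Ch \<inter> B))) ?touching"
  have "inj_on ((\<inter>) ?Q) (set ?touching)"
    using partition_on_disjoint[OF P] Bs(2) by (intro inj_onI) auto
  then have "distinct (map fst ?Ss)" "set (map fst ?Ss) = trace ?Q P"
    using Bs by (auto simp: distinct_map o_def trace_def touching_def)
  then have "prod_list (map (\<lambda>(S,n). part_val (\<Union>S) n) ?Ss) \<approx> Y (sum_list (map snd ?Ss))"
    using Y unfolding splits_as_def by blast
  moreover have "sum_list (map snd ?Ss) = card (?Ch \<inter> \<Union>(touching ?Q P))"
    unfolding touching_def sum_list_card_Int_blocks[OF P finite_core_chord_sets Un_upper2 Bs, symmetric]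
    by (simp add: o_def)
  ultimately show ?thesis by (simp add: o_def del: Int_iff)
qed

lemma wval_split_chorded:
  assumes P: "partition_on (comps core \<union> chord_sets cs) P" and Y: "splits_as (trace (comps core) P) Y"
  shows "wval (split_prod chorded_core P) \<approx> split_weight Cas Y (comps core) (chord_sets cs) P"
proof -
  let ?Q = "comps core" and ?Ch = "chord_sets cs"
  let ?w = "\<lambda>B. part_val (\<Union>(?Q \<inter> B)) (card (?Ch \<inter> B))"
  have comps: "comps chorded_core = ?Q \<union> ?Ch" by (rule comps_chorded[OF wf_core fresh])
  obtain Bs where Bs: "distinct Bs" "set Bs = P"
    "wval (split_prod chorded_core P) = prod_list (map (\<lambda>B. wval (subdiag chorded_core (\<Union>B))) Bs)"
    by (rule wval_split_prod[OF wf_chorded[OF wf_core] finite_comps P[folded comps]])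
  have w: "wval (subdiag chorded_core (\<Union>B)) = ?w B" if "B \<in> P" for B
    by (rule wval_block[OF partition_on_subset[OF P that]])
  let ?touching = "filter (\<lambda>B. ?Q \<inter> B \<noteq> {}) Bs" and ?others = "filter (\<lambda>B. \<not> ?Q \<inter> B \<noteq> {}) Bs"
  have "wval (split_prod chorded_core P) = prod_list (map ?w Bs)"
    unfolding Bs(3) using w Bs(2) by (intro arg_cong[of _ _ prod_list] map_cong) auto
  also have "\<dots> \<approx> Cas ^ sum_list (map (\<lambda>B. card (?Ch \<inter> B)) ?others) * prod_list (map ?w ?touching)"
  proof (rule prod_list_central[OF central_Cas])
    show "words (?w B) \<subseteq> lists {..<m}" if "B \<in> set Bs" for B using words_wval w that Bs(2) by metis
    show "?w B \<approx> Cas ^ card (?Ch \<inter> B)" if "\<not> ?Q \<inter> B \<noteq> {}" for B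
      using that part_val_empty by simp
  qed
  also have "sum_list (map (\<lambda>B. card (?Ch \<inter> B)) ?others) = card (?Ch - \<Union>(touching ?Q P))"
  proof -
    have others: "{B \<in> P. \<not> ?Q \<inter> B \<noteq> {}} = P - touching ?Q P" by (auto simp: touching_def)
    have "\<Union>(P - touching ?Q P) = \<Union>P - \<Union>(touching ?Q P)"
      using partition_onD2[OF P]
      by (intro diff_Union_pairwise_disjoint[symmetric]) (auto simp: touching_def disjoint_def disjnt_def pairwise_def)
    then have "?Ch \<inter> \<Union>(P - touching ?Q P) = ?Ch - \<Union>(touching ?Q P)"
      using partition_onD1[OF P] by blast
    then show ?thesis
      unfolding sum_list_card_Int_blocks[OF P finite_core_chord_sets Un_upper2 Bs(1,2)] others by (simp only:)
  qed
  also have "Cas ^ card (?Ch - \<Union>(touching ?Q P)) * prod_list (map ?w ?touching) \<approx> split_weight Cas Y ?Q ?Ch P"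
    unfolding split_weight_def by (intro ucong_mult_left prod_list_touching P Y Bs)
  finally show ?thesis .
qed

theorem wval_prim_chorded:
  assumes nonempty: "comps core \<noteq> {}" and Y: "\<And>T. partition_on (comps core) T \<Longrightarrow> splits_as T (Y T)"
  shows "wval_prim chorded_core \<approx> (\<Sum>T | partition_on (comps core) T.
    scl (of_nat (card T) ^ length cs * pi_coeff (card T)) (shift_diff Cas (length cs) (Y T)))"
proof -
  let ?Q = "comps core" and ?Ch = "chord_sets cs"
  let ?\<P> = "{P. partition_on (?Q \<union> ?Ch) P}" and ?\<T> = "{T. partition_on ?Q T}"
  have trace: "trace ?Q P \<in> ?\<T>" if "P \<in> ?\<P>" for P
    using that partition_on_trace[of "?Q \<union> ?Ch" P ?Q] by simp
  have fin: "finite ?\<P>" "finite ?\<T>"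
    by (intro finitely_many_partition_on finite_core_chord_sets finite_comps)+
  have "wval_prim chorded_core = (\<Sum>P\<in>?\<P>. scl (pi_coeff (card P)) (wval (split_prod chorded_core P)))"
    unfolding wval_prim_def comps_chorded[OF wf_core fresh] ..
  also have "\<dots> \<approx> (\<Sum>P\<in>?\<P>. scl (pi_coeff (card P)) (split_weight Cas (Y (trace ?Q P)) ?Q ?Ch P))"
    using trace by (intro ucong_sum ucong_scl wval_split_chorded Y) auto
  also have "\<dots> = (\<Sum>T\<in>?\<T>. \<Sum>P\<in>{P \<in> ?\<P>. trace ?Q P = T}.
      scl (pi_coeff (card P)) (split_weight Cas (Y (trace ?Q P)) ?Q ?Ch P))"
    using trace by (intro sum.group[symmetric] fin) auto
  also have "\<dots> = (\<Sum>T\<in>?\<T>. \<Sum>P | partition_on (?Q \<union> ?Ch) P \<and> trace ?Q P = T.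
      scl (pi_coeff (card P)) (split_weight Cas (Y T) ?Q ?Ch P))"
    by (intro sum.cong) auto
  also have "\<dots> = (\<Sum>T\<in>?\<T>. scl (of_nat (card T) ^ length cs * pi_coeff (card T)) (shift_diff Cas (length cs) (Y T)))"
    using sum_splittings_trace[OF finite_comps nonempty _ finite_chord_sets comps_core_chord_sets_disjoint]
    by (intro sum.cong refl) (simp add: card_chord_sets[OF fresh])
  finally show ?thesis .
qed

lemma part_val_Union_comps: "part_val (\<Union>(comps core)) = chorded_val l1 l2 l3 vs es"
proof -
  have "part_val (\<Union>(comps core)) = part_val UNIV" by (rule part_val_cong) (simp only: Union_comps[OF wf_core] UNIV_I)
  also have "\<dots> = chorded_val l1 l2 l3 vs es" by (simp add: part_val_def)
  finally show ?thesis .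
qed

lemma splits_as_whole: "splits_as {comps core} (chorded_val l1 l2 l3 vs es)"
  unfolding splits_as_def
proof (intro allI impI)
  fix Ss :: "(nat set set \<times> nat) list" assume Ss: "distinct (map fst Ss)" "set (map fst Ss) = {comps core}"
  then have "map fst Ss = [comps core]" by (cases "map fst Ss") (auto dest: subset_singletonD)
  then obtain n where "Ss = [(comps core, n)]" by auto
  then show "prod_list (map (\<lambda>(S,n). part_val (\<Union>S) n) Ss) \<approx> chorded_val l1 l2 l3 vs es (sum_list (map snd Ss))"
    by (simp add: part_val_Union_comps del: Sup_apply)
qed

lemma splits_as_power:
  assumes part: "\<And>S n. S \<in> T \<Longrightarrow> part_val (\<Union>S) n \<approx> z ^ n * y" and commute: "z * y = y * z"
  shows "splits_as T (\<lambda>n. z ^ n * y ^ card T)"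
proof -
  have product: "prod_list (map (\<lambda>(S,n). part_val (\<Union>S) n) Ss) \<approx> z ^ sum_list (map snd Ss) * y ^ length Ss"
    if "fst ` set Ss \<subseteq> T" for Ss
    using that
  proof (induction Ss)
    case (Cons p Ss)
    obtain S n where p: "p = (S,n)" by fastforce
    let ?k = "sum_list (map snd Ss)"
    have "prod_list (map (\<lambda>(S,n). part_val (\<Union>S) n) (p # Ss)) \<approx> (z ^ n * y) * (z ^ ?k * y ^ length Ss)"
      using Cons p part by (auto intro: ucong_mult)
    also have "\<dots> = z ^ n * (y * z ^ ?k) * y ^ length Ss" by (simp only: mult.assoc)
    also have "y * z ^ ?k = z ^ ?k * y" using power_commuting_commutes[OF commute] by (rule sym)
    also have "z ^ n * (z ^ ?k * y) * y ^ length Ss = z ^ sum_list (map snd (p # Ss)) * y ^ length (p # Ss)"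
      by (simp add: p power_add mult.assoc)
    finally show ?case .
  qed simp
  show ?thesis
    unfolding splits_as_def
  proof (intro allI impI)
    fix Ss :: "(nat set set \<times> nat) list" assume Ss: "distinct (map fst Ss)" "set (map fst Ss) = T"
    have "length Ss = card T" using distinct_card[OF Ss(1)] unfolding Ss(2) by simp
    then show "prod_list (map (\<lambda>(S,n). part_val (\<Union>S) n) Ss) \<approx> z ^ sum_list (map snd Ss) * y ^ card T"
      using product[of Ss] Ss(2) by simp
  qed
qed

lemma pi_coeff_1: "pi_coeff 1 = 1" and pi_coeff_2: "pi_coeff 2 = -1"
  by (simp_all add: pi_coeff_def)

lemma wval_prim_chorded_connected:
  assumes "comps core = {H}"
  shows "wval_prim chorded_core \<approx> shift_diff Cas (length cs) (chorded_val l1 l2 l3 vs es)"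
proof -
  let ?Y = "chorded_val l1 l2 l3 vs es"
  have parts: "{T. partition_on (comps core) T} = {{comps core}}"
    unfolding assms partition_on_singleton by simp
  have "wval_prim chorded_core \<approx> (\<Sum>T | partition_on (comps core) T.
      scl (of_nat (card T) ^ length cs * pi_coeff (card T)) (shift_diff Cas (length cs) ?Y))"
  proof (rule wval_prim_chorded)
    fix T assume "partition_on (comps core) T"
    then have "T \<in> {{comps core}}" using parts by blast
    then show "splits_as T ?Y" using splits_as_whole by (simp only: singleton_iff)
  qed (simp add: assms)
  then show ?thesis unfolding parts using pi_coeff_1 by simp
qed

lemma wval_prim_chorded_two_parts:
  assumes core: "comps core = {S, S'}" and "S \<noteq> S'"
    and part: "\<And>U n. U \<in> {S, S'} \<Longrightarrow> part_val U n \<approx> z ^ n * y" and commute: "z * y = y * z"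
  shows "wval_prim chorded_core \<approx> shift_diff Cas (length cs) (chorded_val l1 l2 l3 vs es)
    - scl (2 ^ length cs) (shift_diff Cas (length cs) (\<lambda>n. z ^ n * y\<^sup>2))"
proof -
  let ?apart = "{{S}, {S'}}"
  define Y where "Y T = (if T = ?apart then (\<lambda>n. z ^ n * y\<^sup>2) else chorded_val l1 l2 l3 vs es)" for T
  have parts: "{T. partition_on (comps core) T} = {{comps core}, ?apart}"
    unfolding core partition_on_doubleton[OF \<open>S \<noteq> S'\<close>] by auto
  have distinct: "{comps core} \<noteq> ?apart" and card: "card ?apart = 2"
    using \<open>S \<noteq> S'\<close> by (auto simp: core doubleton_eq_iff)
  have "wval_prim chorded_core \<approx> (\<Sum>T | partition_on (comps core) T.
      scl (of_nat (card T) ^ length cs * pi_coeff (card T)) (shift_diff Cas (length cs) (Y T)))"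
  proof (rule wval_prim_chorded)
    have "splits_as ?apart (\<lambda>n. z ^ n * y ^ card ?apart)"
      by (rule splits_as_power[OF _ commute]) (use part in auto)
    then have "splits_as ?apart (Y ?apart)" by (simp add: Y_def card)
    moreover have "splits_as {comps core} (Y {comps core})"
      using distinct splits_as_whole by (simp only: Y_def if_False)
    moreover fix T assume "partition_on (comps core) T"
    then have "T = {comps core} \<or> T = ?apart" using parts by blast
    ultimately show "splits_as T (Y T)" by (elim disjE) (simp_all only:)
  qed (simp add: core)
  also have "\<dots> = shift_diff Cas (length cs) (Y {comps core}) - scl (2 ^ length cs) (shift_diff Cas (length cs) (Y ?apart))"
    unfolding parts using distinct card pi_coeff_1 pi_coeff_2 by simp
  finally show ?thesis using distinct by (simp only: Y_def if_False if_True simp_thms)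
qed

end

section \<open>The diagrams \<open>J\<^sub>i\<^sub>,\<^sub>j\<close>\<close>

definition J_verts :: "nat \<Rightarrow> nat \<Rightarrow> (nat \<times> nat \<times> nat) list" where
  "J_verts s i = concat (map (\<lambda>k. [(s + 6*k, s + 6*k + 1, s + 6*k + 2), (s + 6*k + 3, s + 6*k + 4, s + 6*k + 5)]) [0..<i])"

definition J_edges :: "nat \<Rightarrow> nat \<Rightarrow> (nat \<times> nat) list" where
  "J_edges s i = (if i = 0 then [(0,1),(2,3)] else
     map (\<lambda>k. (s + 6*k + 2, s + 6*k + 4)) [0..<i] @
     map (\<lambda>k. (s + 6*k, s + 6*(k+1) + 1)) [0..<i-1] @
     map (\<lambda>k. (s + 6*k + 3, s + 6*(k+1) + 5)) [0..<i-1] @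
     [(s + 1, 1), (s + 5, 2), (s + 6*(i-1), 0), (s + 6*(i-1) + 3, 3)])"

definition J_chords :: "nat \<Rightarrow> (nat \<times> nat) list" where
  "J_chords j = map (\<lambda>k. (2*k+2, 2*k+3)) [1..<j+1]"

abbreviation J_core :: "nat \<Rightarrow> nat \<Rightarrow> diagram" where
  "J_core s i \<equiv> chorded [0] [1,2] [3] (J_verts s i) (J_edges s i) []"

lemma Jdiag_chorded: "Jdiag i j = chorded [0] [1,2] [3] (J_verts (2*j+4) i) (J_edges (2*j+4) i) (J_chords j)"
proof -
  have rungs: "[1..<i+1] = map Suc [0..<i]" by (simp add: map_Suc_upt)
  have rails: "[1..<i] = map Suc [0..<i-1]" if "i \<noteq> 0" using that by (cases i) (simp_all add: map_Suc_upt)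
  show ?thesis
  proof (cases "i = 0")
    case False
    then show ?thesis
      unfolding Jdiag_def chorded_def J_verts_def J_edges_def J_chords_def Let_def rungs rails[OF False] by (simp add: o_def)
  qed (simp add: Jdiag_def chorded_def J_verts_def J_edges_def J_chords_def Let_def o_def)
qed

lemma rung_halfedge_cases:
  fixes x s i :: nat
  assumes "x \<in> {s..<s+6*i}"
  obtains k r where "k < i" "r \<in> {0,1,2,3,4,5}" "x = s + 6*k + r"
proof -
  define k r where "k = (x - s) div 6" and "r = (x - s) mod 6"
  have x: "x = s + 6*k + r" "r < 6" using assms by (auto simp: k_def r_def)
  then have "k < i" "r \<in> {0,1,2,3,4,5}" using assms by auto
  then show thesis using x(1) by (rule that)
qed

lemma halfedges_J_core: "halfedges (J_core s i) = {0,1,2,3} \<union> {s..<s+6*i}"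
proof -
  have "(\<Union>(a,b,d)\<in>set (J_verts s i). {a,b,d}) = {s..<s+6*i}"
  proof (intro equalityI subsetI)
    fix x assume "x \<in> {s..<s+6*i}"
    then obtain k r where "k < i" "r \<in> {0,1,2,3,4,5}" "x = s + 6*k + r" by (rule rung_halfedge_cases)
    then show "x \<in> (\<Union>(a,b,d)\<in>set (J_verts s i). {a,b,d})" by (force simp: J_verts_def)
  qed (auto simp: J_verts_def)
  then show ?thesis by (simp add: halfedges_def chorded_def)
qed

lemma wf_J_core: "wf_diag (J_core s i)"
  unfolding wf_diag_def halfedges_J_core by (cases i) (auto simp: chorded_def J_edges_def)

lemma adj_J_core:
  assumes "k < i"
  shows "(s+6*k, s+6*k+1) \<in> adj (J_core s i)" "(s+6*k+1, s+6*k+2) \<in> adj (J_core s i)"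
    "(s+6*k+3, s+6*k+4) \<in> adj (J_core s i)" "(s+6*k+4, s+6*k+5) \<in> adj (J_core s i)"
    "(s+6*k+2, s+6*k+4) \<in> adj (J_core s i)"
    and "Suc k < i \<Longrightarrow> (s+6*k, s+6*Suc k+1) \<in> adj (J_core s i)"
proof -
  have "(s+6*k, s+6*k+1, s+6*k+2) \<in> set (J_verts s i)" "(s+6*k+3, s+6*k+4, s+6*k+5) \<in> set (J_verts s i)"
    using assms by (auto simp: J_verts_def)
  then show "(s+6*k, s+6*k+1) \<in> adj (J_core s i)" "(s+6*k+1, s+6*k+2) \<in> adj (J_core s i)"
    "(s+6*k+3, s+6*k+4) \<in> adj (J_core s i)" "(s+6*k+4, s+6*k+5) \<in> adj (J_core s i)"
    unfolding adj_def chorded_def by force+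
  show "(s+6*k+2, s+6*k+4) \<in> adj (J_core s i)" "Suc k < i \<Longrightarrow> (s+6*k, s+6*Suc k+1) \<in> adj (J_core s i)"
    using assms by (auto simp: adj_def chorded_def J_edges_def)
qed

lemma adj_J_core_legs:
  assumes "i > 0"
  shows "(s+1, 1) \<in> adj (J_core s i)" "(s+5, 2) \<in> adj (J_core s i)"
    "(s+6*(i-1), 0) \<in> adj (J_core s i)" "(s+6*(i-1)+3, 3) \<in> adj (J_core s i)"
  using assms by (auto simp: adj_def chorded_def J_edges_def)

lemma comps_J_core_Suc: "comps (J_core s (Suc i)) = {halfedges (J_core s (Suc i))}"
proof (rule comps_singletonI[OF wf_J_core])
  show "1 \<in> halfedges (J_core s (Suc i))" unfolding halfedges_J_core by simp
  fix U assume U: "\<And>x y. (x,y) \<in> adj (J_core s (Suc i)) \<Longrightarrow> x \<in> U \<longleftrightarrow> y \<in> U" and "1 \<in> U"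
  note leg = U[OF adj_J_core_legs(1)] U[OF adj_J_core_legs(2)] U[OF adj_J_core_legs(3)] U[OF adj_J_core_legs(4)]
  have rung: "s+6*k+r \<in> U \<longleftrightarrow> s+6*k+1 \<in> U" if k: "k < Suc i" and r: "r \<in> {0,1,2,3,4,5}" for k r
    using U[OF adj_J_core(1)[OF k]] U[OF adj_J_core(2)[OF k]] U[OF adj_J_core(3)[OF k]] U[OF adj_J_core(4)[OF k]]
      U[OF adj_J_core(5)[OF k]] r by auto
  have "s+6*k+1 \<in> U" if "k < Suc i" for k
    using that
  proof (induction k)
    case 0
    then show ?case using leg(1) \<open>1 \<in> U\<close> by simp
  next
    case (Suc k)
    then show ?case using rung[of k 0] U[OF adj_J_core(6)[of k]] by simp
  qed
  with rung have rungs: "s+6*k+r \<in> U" if "k < Suc i" "r \<in> {0,1,2,3,4,5}" for k r using that by blast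
  have "x \<in> U" if "x \<in> {s..<s+6*Suc i}" for x
    using that by (rule rung_halfedge_cases) (simp only: rungs)
  moreover have "2 \<in> U" "0 \<in> U" "3 \<in> U"
    using leg rungs[of 0 5] rungs[of i 0] rungs[of i 3] by simp_all
  ultimately show "halfedges (J_core s (Suc i)) \<subseteq> U"
    unfolding halfedges_J_core using \<open>1 \<in> U\<close> by auto
qed

lemma comps_J_core_0: "comps (J_core s 0) = {{0,1},{2,3}}"
proof (rule comps_eqI)
  have adj: "adj (J_core s 0) = {(0,1),(2,3)}" by (auto simp: adj_def chorded_def J_edges_def J_verts_def)
  show "\<Union>{{0,1},{2,3}} = halfedges (J_core s 0)" unfolding halfedges_J_core by auto
  show "x \<in> Q \<longleftrightarrow> y \<in> Q" if "Q \<in> {{0,1},{2,3}}" "(x,y) \<in> adj (J_core s 0)" for Q x y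
    using that unfolding adj by auto
  show "\<exists>r\<in>Q. \<forall>x\<in>Q. (r,x) \<in> (adj (J_core s 0) \<union> (adj (J_core s 0))\<inverse>)\<^sup>*" if "Q \<in> {{0,1},{2,3}}" for Q
    using that unfolding adj by auto
qed

lemma fresh_J_chords: "fresh_chords (halfedges (J_core (2*j+4) i)) (J_chords j)"
proof -
  have ends: "map fst (J_chords j) = map (\<lambda>k. 2*k+2) [1..<j+1]" "map snd (J_chords j) = map (\<lambda>k. 2*k+3) [1..<j+1]"
    by (simp_all add: J_chords_def)
  have "2*k+2 \<noteq> 2*l+3" for k l :: nat by presburger
  then have "distinct (map fst (J_chords j) @ map snd (J_chords j))"
    unfolding ends by (auto simp: distinct_map inj_on_def)
  then show ?thesis unfolding fresh_chords_def halfedges_J_core ends by auto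
qed

context metrized_simple_lie
begin

lemma length_J_chords: "length (J_chords j) = j"
  by (simp only: J_chords_def length_map length_upt)

lemma chorded_diagram_J: "chorded_diagram m c lam [0] [1,2] [3] (J_verts (2*j+4) i) (J_edges (2*j+4) i) (J_chords j)"
  by (intro chorded_diagram.intro chorded_diagram_axioms.intro metrized_simple_lie_axioms wf_J_core fresh_J_chords)

lemma prod_list_upt: "prod_list (map h [0..<n]) = (\<Prod>k<n. h k)" for h :: "nat \<Rightarrow> 'a::comm_monoid_mult"
  by (induction n) (simp_all add: mult.commute)

lemma vert_weight_J_verts: "vert_weight (J_verts s i) f = (\<Prod>k<i. t (f (s + 6*k)) (f (s + 6*k + 1)) (f (s + 6*k + 2)) *
     t (f (s + 6*k + 3)) (f (s + 6*k + 4)) (f (s + 6*k + 5)))"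
  by (induction i) (simp_all add: J_verts_def vert_weight_def mult_ac)

lemma edge_weight_map: "edge_weight (map (\<lambda>k. (x k, y k)) [0..<n]) f = (\<Prod>k<n. g (f (y k)) (f (x k)))"
  by (simp add: edge_weight_def o_def prod_list_upt)

lemma J_weight:
  assumes f: "f \<in> halfedges (J_core s i) \<rightarrow>\<^sub>E {..<m}"
  shows "edge_weight (J_edges s i) f * vert_weight (J_verts s i) f
    = rungs_weight s i f * (g (f 0) (f (upper_port s i)) * g (f 3) (f (lower_port s i)))"
proof (cases i)
  case 0
  have "f 0 < m" "f 1 < m" using PiE_mem[OF f, of 0] PiE_mem[OF f, of 1] unfolding halfedges_J_core by simp_all
  then show ?thesis
    using g_sym[of "f 1" "f 0"]
    by (simp add: 0 edge_weight_def vert_weight_def J_edges_def J_verts_def rungs_weight_def upper_port_def lower_port_def)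
next
  case (Suc n)
  have lt: "f x < m" if "x \<in> {0,1,2,3} \<union> {s..<s+6*i}" for x
    using PiE_mem[OF f, of x] that unfolding halfedges_J_core by simp
  let ?p = "\<lambda>k. g (f (s + 6*k + 1)) (f (upper_port s k))" and ?q = "\<lambda>k. g (f (s + 6*k + 5)) (f (lower_port s k))"
  have ports: "upper_port s (Suc k) = s + 6*k" "lower_port s (Suc k) = s + 6*k + 3" for k
    by (simp_all add: upper_port_def lower_port_def)
  have left: "g (f 1) (f (s+1)) = ?p 0" "g (f 2) (f (s+5)) = ?q 0"
    using lt Suc by (subst g_sym, auto simp: upper_port_def lower_port_def)+
  have edges: "J_edges s i = map (\<lambda>k. (s + 6*k + 2, s + 6*k + 4)) [0..<i] @ map (\<lambda>k. (s + 6*k, s + 6*Suc k + 1)) [0..<n]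
      @ map (\<lambda>k. (s + 6*k + 3, s + 6*Suc k + 5)) [0..<n] @ [(s + 1, 1), (s + 5, 2), (s + 6*n, 0), (s + 6*n + 3, 3)]"
    by (simp add: J_edges_def Suc)
  have legs: "edge_weight [(s + 1, 1), (s + 5, 2), (s + 6*n, 0), (s + 6*n + 3, 3)] f
      = g (f 1) (f (s+1)) * g (f 2) (f (s+5)) * g (f 0) (f (s+6*n)) * g (f 3) (f (s+6*n+3))"
    by (simp add: edge_weight_def)
  have "edge_weight (J_edges s i) f = (\<Prod>k<i. g (f (s + 6*k + 4)) (f (s + 6*k + 2))) * (\<Prod>k<n. ?p (Suc k)) * (\<Prod>k<n. ?q (Suc k))
      * (g (f 1) (f (s+1)) * g (f 2) (f (s+5)) * g (f 0) (f (s+6*n)) * g (f 3) (f (s+6*n+3)))"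
    unfolding edges edge_weight_append edge_weight_map legs ports by (simp only: mult.assoc)
  then have "edge_weight (J_edges s i) f = (\<Prod>k<i. g (f (s + 6*k + 4)) (f (s + 6*k + 2))) * (\<Prod>k<i. ?p k) * (\<Prod>k<i. ?q k)
      * (g (f 0) (f (upper_port s i)) * g (f 3) (f (lower_port s i)))"
    unfolding left Suc ports prod.lessThan_Suc_shift[of ?p] prod.lessThan_Suc_shift[of ?q] by (simp only: mult_ac)
  then show ?thesis
    unfolding vert_weight_J_verts rungs_weight_def rung_weight_def prod.distrib by (simp only: mult_ac)
qed

lemma chorded_val_J: "s \<ge> 4 \<Longrightarrow> chorded_val [0] [1,2] [3] (J_verts s i) (J_edges s i) = ladder_val i"
proof
  fix n assume s: "s \<ge> 4"
  have "word [x,y] = E x * E y" for x y using word_append[of "[x]" "[y]"] by simp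
  then have "chorded_val [0] [1,2] [3] (J_verts s i) (J_edges s i) n = (\<Sum>f\<in>{0,1,2,3} \<union> {s..<s+6*i} \<rightarrow>\<^sub>E {..<m}.
      scl (rungs_weight s i f * (g (f 0) (f (upper_port s i)) * g (f 3) (f (lower_port s i))))
        (E (f 0) * (Phi ^^ n) (E (f 1) * E (f 2)) * E (f 3)))"
    unfolding chorded_val_def halfedges_J_core[symmetric] by (intro sum.cong refl) (simp only: J_weight list.map)
  then show "chorded_val [0] [1,2] [3] (J_verts s i) (J_edges s i) n = ladder_val i n"
    by (simp only: sum_ladder[OF s])
qed

lemma sum_scl_g_Phi_right: "(\<Sum>x<m. \<Sum>y<m. scl (g y x) (E x * (Phi ^^ n) (E y))) \<approx> Cas_shift ^ n * Cas"
  and sum_scl_g_Phi_left: "(\<Sum>x<m. \<Sum>y<m. scl (g y x) ((Phi ^^ n) (E x) * E y)) \<approx> Cas_shift ^ n * Cas"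
proof -
  have Phi: "(Phi ^^ n) (E a) \<approx> Cas_shift ^ n * E a" if "a < m" for a
    using funpow_Phi_emb[OF unitv_in_lvecs[OF that]] by (simp add: emb_unitv that)
  have Cas: "Cas = (\<Sum>x<m. \<Sum>y<m. scl (g y x) (E x * E y))" by (simp add: Cas_def Phi_coords)
  have "(\<Sum>x<m. \<Sum>y<m. scl (g y x) ((Phi ^^ n) (E x) * E y)) \<approx> (\<Sum>x<m. \<Sum>y<m. scl (g y x) ((Cas_shift ^ n * E x) * E y))"
    by (intro ucong_sum ucong_scl ucong_mult_right Phi) simp
  then show "(\<Sum>x<m. \<Sum>y<m. scl (g y x) ((Phi ^^ n) (E x) * E y)) \<approx> Cas_shift ^ n * Cas"
    by (simp add: Cas sum_distrib_left mult.assoc)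
  have "(\<Sum>x<m. \<Sum>y<m. scl (g y x) (E x * (Phi ^^ n) (E y))) \<approx> (\<Sum>x<m. \<Sum>y<m. scl (g y x) (E x * (Cas_shift ^ n * E y)))"
    by (intro ucong_sum ucong_scl ucong_mult_left Phi) simp
  also have "\<dots> = (\<Sum>x<m. \<Sum>y<m. scl (g y x) ((E x * Cas_shift ^ n) * E y))" by (simp only: mult.assoc)
  also have "\<dots> \<approx> (\<Sum>x<m. \<Sum>y<m. scl (g y x) ((Cas_shift ^ n * E x) * E y))"
    using central_power[OF central_Cas_shift, of n]
    by (intro ucong_sum ucong_scl ucong_mult_right) (simp add: central_def)
  also have "\<dots> = Cas_shift ^ n * Cas" by (simp add: Cas sum_distrib_left mult.assoc)
  finally show "(\<Sum>x<m. \<Sum>y<m. scl (g y x) (E x * (Phi ^^ n) (E y))) \<approx> Cas_shift ^ n * Cas" .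
qed

lemma part_val_J_0:
  fixes j
  defines "part \<equiv> chorded_diagram.part_val m c lam [0] [1,2] [3] (J_verts (2*j+4) 0) (J_edges (2*j+4) 0)"
  assumes "U \<in> {{0,1},{2,3}}"
  shows "part U n \<approx> Cas_shift ^ n * Cas"
proof -
  interpret chorded_diagram m c lam "[0]" "[1,2]" "[3]" "J_verts (2*j+4) 0" "J_edges (2*j+4) 0" "J_chords j"
    by (rule chorded_diagram_J)
  have lists: "J_verts s 0 = []" "J_edges s 0 = [(0,1),(2,3)]" for s by (simp_all add: J_verts_def J_edges_def)
  have "part {0,1} n = (\<Sum>x<m. \<Sum>y<m. scl (g y x) (E x * (Phi ^^ n) (E y)))"
    unfolding part_def part_val_def unfolding lists
    by (simp add: chorded_val_def halfedges_def chorded_def edge_weight_def vert_weight_def word_Nil sum_PiE_insert)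
  moreover have "part {2,3} n = (\<Sum>x<m. \<Sum>y<m. scl (g y x) ((Phi ^^ n) (E x) * E y))"
    unfolding part_def part_val_def unfolding lists
    by (simp add: chorded_val_def halfedges_def chorded_def edge_weight_def vert_weight_def word_Nil sum_PiE_insert)
  ultimately show ?thesis using assms sum_scl_g_Phi_left sum_scl_g_Phi_right by auto
qed

lemma shift_diff_Cas_shift: "shift_diff Cas j (\<lambda>n. Cas_shift ^ n * X) = scl ((-1 / (2*lam)) ^ j) X"
proof (induction j arbitrary: X)
  case (Suc j)
  have "shift_diff Cas (Suc j) (\<lambda>n. Cas_shift ^ n * X)
      = shift_diff Cas j (\<lambda>n. Cas_shift ^ n * (Cas_shift * X)) - Cas * shift_diff Cas j (\<lambda>n. Cas_shift ^ n * X)"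
    by (simp only: shift_diff.simps power_Suc2 mult.assoc)
  also have "\<dots> = scl ((-1 / (2*lam)) ^ j) (Cas_shift * X - Cas * X)"
    unfolding Suc by (simp add: fa.scale_right_diff_distrib)
  also have "Cas_shift * X - Cas * X = scl (-1 / (2*lam)) X"
    by (simp add: Cas_shift_def left_diff_distrib)
  finally show ?case by (simp add: mult.commute)
qed simp

lemma wval_prim_J_Suc: "wval_prim (Jdiag (Suc i) j) \<approx> shift_diff Cas j (ladder_val (Suc i))"
proof -
  interpret chorded_diagram m c lam "[0]" "[1,2]" "[3]" "J_verts (2*j+4) (Suc i)" "J_edges (2*j+4) (Suc i)" "J_chords j"
    by (rule chorded_diagram_J)
  have "chorded_val [0] [1,2] [3] (J_verts (2*j+4) (Suc i)) (J_edges (2*j+4) (Suc i)) = ladder_val (Suc i)"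
    by (rule chorded_val_J) simp
  then show ?thesis
    using wval_prim_chorded_connected[OF comps_J_core_Suc] by (simp only: Jdiag_chorded length_J_chords)
qed

lemma wval_prim_J_0: "wval_prim (Jdiag 0 j) \<approx> shift_diff Cas j (ladder_val 0) - scl ((-1 / lam) ^ j) (Cas\<^sup>2)"
proof -
  interpret chorded_diagram m c lam "[0]" "[1,2]" "[3]" "J_verts (2*j+4) 0" "J_edges (2*j+4) 0" "J_chords j"
    by (rule chorded_diagram_J)
  have distinct: "{0,1} \<noteq> {2,3::nat}" by (simp add: doubleton_eq_iff)
  have commute: "Cas_shift * Cas = Cas * Cas_shift"
    by (simp add: Cas_shift_def left_diff_distrib right_diff_distrib)
  have "chorded_val [0] [1,2] [3] (J_verts (2*j+4) 0) (J_edges (2*j+4) 0) = ladder_val 0"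
    by (rule chorded_val_J) simp
  moreover have "wval_prim chorded_core
      \<approx> shift_diff Cas (length (J_chords j)) (chorded_val [0] [1,2] [3] (J_verts (2*j+4) 0) (J_edges (2*j+4) 0))
        - scl (2 ^ length (J_chords j)) (shift_diff Cas (length (J_chords j)) (\<lambda>n. Cas_shift ^ n * Cas\<^sup>2))"
    by (rule wval_prim_chorded_two_parts[OF comps_J_core_0 distinct _ commute]) (rule part_val_J_0)
  ultimately have "wval_prim (Jdiag 0 j)
      \<approx> shift_diff Cas j (ladder_val 0) - scl (2 ^ j) (shift_diff Cas j (\<lambda>n. Cas_shift ^ n * Cas\<^sup>2))"
    by (simp only: Jdiag_chorded length_J_chords)
  also have "scl (2 ^ j) (shift_diff Cas j (\<lambda>n. Cas_shift ^ n * Cas\<^sup>2)) = scl ((-1 / lam) ^ j) (Cas\<^sup>2)"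
  proof -
    have "2 ^ j * (-1 / (2*lam)) ^ j = (-1 / lam) ^ j" by (simp flip: power_mult_distrib)
    then show ?thesis by (simp add: shift_diff_Cas_shift)
  qed
  finally show ?thesis .
qed

lemma shift_diff_cong: "(\<And>n. Y n \<approx> Y' n) \<Longrightarrow> shift_diff z j Y \<approx> shift_diff z j Y'"
  by (induction j arbitrary: Y Y') (auto intro!: ucong_diff ucong_mult_left)

lemma shift_diff_ladder_val:
  "shift_diff Cas j (ladder_val (Suc i))
    \<approx> shift_diff Cas (Suc j) (ladder_val i) + scl (1 / lam) (shift_diff Cas j (ladder_val i))"
proof -
  have "shift_diff Cas j (ladder_val (Suc i))
      \<approx> shift_diff Cas j (\<lambda>n. ladder_val i (Suc n) + scl (1 / lam) (ladder_val i n) - Cas * ladder_val i n)"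
    by (rule shift_diff_cong) (rule ladder_val_recursion)
  also have "\<dots> = shift_diff Cas j (\<lambda>n. ladder_val i (Suc n)) + scl (1 / lam) (shift_diff Cas j (ladder_val i))
      - Cas * shift_diff Cas j (ladder_val i)"
    by (rule shift_diff_linear)
  also have "\<dots> = shift_diff Cas (Suc j) (ladder_val i) + scl (1 / lam) (shift_diff Cas j (ladder_val i))"
    by (simp add: algebra_simps)
  finally show ?thesis .
qed

lemma wval_prim_J_recursion:
  "wval_prim (Jdiag (Suc i) j) \<approx> wval_prim (Jdiag i (Suc j)) + scl (1 / lam) (wval_prim (Jdiag i j))"
proof -
  define A where "A j = (if i = 0 then scl ((-1 / lam) ^ j) (Cas\<^sup>2) else 0)" for j
  have prim: "shift_diff Cas j (ladder_val i) - A j \<approx> wval_prim (Jdiag i j)" for j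
    unfolding A_def using wval_prim_J_0 wval_prim_J_Suc by (cases i) (auto intro: ucong_sym)
  have "A (Suc j) + scl (1 / lam) (A j) = 0"
    by (simp add: A_def flip: fa.scale_left_distrib)
  have "wval_prim (Jdiag (Suc i) j)
      \<approx> shift_diff Cas (Suc j) (ladder_val i) + scl (1 / lam) (shift_diff Cas j (ladder_val i))"
    by (rule ucong_trans[OF wval_prim_J_Suc shift_diff_ladder_val])
  also have "\<dots> = (shift_diff Cas (Suc j) (ladder_val i) - A (Suc j))
      + scl (1 / lam) (shift_diff Cas j (ladder_val i) - A j)"
    using \<open>A (Suc j) + scl (1 / lam) (A j) = 0\<close>
    by (simp add: fa.scale_right_diff_distrib algebra_simps del: shift_diff.simps)
  also have "\<dots> \<approx> wval_prim (Jdiag i (Suc j)) + scl (1 / lam) (wval_prim (Jdiag i j))"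
    by (intro ucong_add ucong_scl prim)
  finally show ?thesis .
qed

lemma coef_wval_prim_J: "coef (wval_prim (Jdiag i j)) = wbar m c lam (Jdiag i j)"
proof (rule coef_wval_prim)
  show "wf_diag (Jdiag i j)" unfolding Jdiag_chorded by (rule wf_chorded[OF wf_J_core])
  have "0 \<in> halfedges (Jdiag i j)" by (simp add: Jdiag_chorded halfedges_def chorded_def)
  then show "comps (Jdiag i j) \<noteq> {}" by (auto simp: comps_def quotient_def)
qed (rule finite_comps)

end

theorem theorem1:
  fixes m :: nat and c :: "nat \<Rightarrow> nat \<Rightarrow> nat \<Rightarrow> complex" and lam :: complex and i j :: nat
  assumes "simple_lie m c" and "lam \<noteq> 0" and "i \<ge> 1"
  shows "U_eq m c (wbar m c lam (Jdiag i j))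
           (fa_add (wbar m c lam (Jdiag (i - 1) (j + 1)))
                   (fa_smult (1 / lam) (wbar m c lam (Jdiag (i - 1) j))))"
proof -
  interpret metrized_simple_lie m c lam by unfold_locales (use assms in auto)
  obtain k where i: "i = Suc k" using \<open>i \<ge> 1\<close> by (cases i) auto
  have "U_eq m c (coef (wval_prim (Jdiag (Suc k) j)))
      (coef (wval_prim (Jdiag k (Suc j)) + scl (1 / lam) (wval_prim (Jdiag k j))))"
    unfolding U_eq_coef by (rule wval_prim_J_recursion)
  then show ?thesis unfolding coef_add_scl coef_wval_prim_J by (simp add: i)
qed

end
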